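(* Let $k$ be any field of characteristic $p>0$ and let $$A = k[X,Y,Z,T]/(X^m Y + Z^{p^e} + T + T^{sp}),$$ where $m, e, s$ are positive integers such that $p^e \nmid sp$, $sp \nmid p^e$ and $m>1$. Then $A$ is not isomorphic, as a $k$-algebra, to the polynomial ring $k[X_1,X_2,X_3]$ in three variables over $k$.
   Context: $X,Y,Z,T$ are indeterminates over $k$. *)

theory Defs
  imports "HOL-Computational_Algebra.Polynomial" "HOL-Algebra.QuotRing"
begin

text \<open>Polynomial rings over a field k, realised as iterated univariate polynomials:
  k[X,Y,Z,T] = ((k[X])[Y])[Z])[T] and k[X1,X2,X3] = (k[X1])[X2])[X3].\<close>

type_synonym 'a poly4 = "'a poly poly poly poly"
type_synonym 'a poly3 = "'a poly poly poly"

definition ring_of :: "('b::comm_ring_1) ring" where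
  "ring_of = \<lparr>carrier = UNIV, monoid.mult = (*), one = 1, zero = 0, add = (+)\<rparr>"

definition varX :: "('a::comm_ring_1) poly4" where "varX = [:[:[:monom 1 1:]:]:]"
definition varY :: "('a::comm_ring_1) poly4" where "varY = [:[:monom 1 1:]:]"
definition varZ :: "('a::comm_ring_1) poly4" where "varZ = [:monom 1 1:]"
definition varT :: "('a::comm_ring_1) poly4" where "varT = monom 1 1"
definition const4 :: "'a::comm_ring_1 \<Rightarrow> 'a poly4" where "const4 c = [:[:[:[:c:]:]:]:]"
definition const3 :: "'a::comm_ring_1 \<Rightarrow> 'a poly3" where "const3 c = [:[:[:c:]:]:]"

definition defpoly :: "nat \<Rightarrow> nat \<Rightarrow> nat \<Rightarrow> nat \<Rightarrow> ('a::comm_ring_1) poly4" where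
  "defpoly p m e s = varX ^ m * varY + varZ ^ (p ^ e) + varT + varT ^ (s * p)"

definition algA :: "nat \<Rightarrow> nat \<Rightarrow> nat \<Rightarrow> nat \<Rightarrow> ('a::field) poly4 set ring" where
  "algA p m e s = ring_of Quot (genideal ring_of {defpoly p m e s})"

definition kalg_isos_A ::
  "nat \<Rightarrow> nat \<Rightarrow> nat \<Rightarrow> nat \<Rightarrow> (('a::field) poly4 set \<Rightarrow> 'a poly3) set" where
  "kalg_isos_A p m e s =
     {h. h \<in> ring_iso (algA p m e s) ring_of \<and>
         (\<forall>c::'a. h (genideal ring_of {defpoly p m e s} +>\<^bsub>ring_of\<^esub> const4 c) = const3 c)}"

end

(*
  Suppose A = k[U, V, W] and embed A into k[x, 1/x, z, t] by y = -F / x^m, F = z^(p^e) + t + t^(sp).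
  Some variable of A has a pole along x = 0, so there is an exponential map phi: A -> A[S] (a shift of coordinates)
  with an invariant u having such a pole and a second invariant v independent of u.
  Give x a very negative irrational weight and let z, t have weights making z^(p^e) and t^(sp) the leading part of F.
  The leading part of phi is an exponential map X, Y, Z, T of the associated graded ring, where
  X^m Y + (Z^q1 + T^s1)^(p^d) = 0, with q1 = p^(e-d) > 1 and s1 > 1 prime to p.
  The leading form of u is divisible by y, so Y = y is invariant, and counting dimensions in k[u, v] gives an invariant
  form that is not a power of y. Differentiation along t, which kills p-th powers, shows that X is not invariant and
  that one of Z, T is. The leading coefficients of X, Z, T in S are themselves invariant, and comparing their degrees in x
  shows that m is prime to p (and to s1, if Z is invariant). Hence Z^q1 + T^s1 is an m-th power up to constants, which a
  degree count of Mason-Stothers type excludes.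
*)
theory Submission
  imports Defs "HOL-Library.Poly_Mapping" "HOL-Library.Product_Lexorder" "HOL-Library.Product_Plus"
    "HOL-Computational_Algebra.Computational_Algebra" "HOL-Computational_Algebra.Field_as_Ring"
begin

section \<open>Ring homomorphisms\<close>

text \<open>The divisibility hypotheses enter through the exact power p^d of p in sp: p^e not
  dividing sp means d < e, and sp not dividing p^e means that the cofactor s1 is not 1. The weight
  of x can only be fixed after u: its size has to exceed the (z, t)-weight of every term of u, so
  that a term with a pole dominates all terms without one. Its irrationality forces terms of equal
  weight to have equal x-degree and equal (z, t)-weight, hence a common power of y in normal form.
  The associated graded ring is never built: an element of A together with an upper bound for its
  weight stands for its component in that weight, possibly zero, and the graded exponential map is a
  family of maps indexed by such bounds. In place of the full ring of invariants, k[u, v] suffices: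
  its dimension grows quadratically in the weight, that of the span of the powers of one form only
  linearly. Since k is arbitrary, a weighted form in Z and T need not split over k; the one factor
  that matters is found by comparing leading monomials, whose coefficients lie in k.\<close>

definition unital_hom :: "('a::comm_ring_1 \<Rightarrow> 'b::comm_ring_1) \<Rightarrow> bool" where
  "unital_hom f \<longleftrightarrow> (\<forall>a b. f (a + b) = f a + f b) \<and> (\<forall>a b. f (a * b) = f a * f b) \<and> f 1 = 1"

lemma unital_homD:
  assumes "unital_hom f"
  shows "f (a + b) = f a + f b" "f (a * b) = f a * f b" "f 1 = 1" "f 0 = 0"
    "f (- a) = - f a" "f (a - b) = f a - f b" "f (a ^ n) = f a ^ n" "f (sum g I) = (\<Sum>i\<in>I. f (g i))"
    "f (of_nat n) = of_nat n"
proof -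
  show A: "f (a + b) = f a + f b" and M: "f (a * b) = f a * f b" and o: "f 1 = 1" for a b
    using assms by (auto simp: unital_hom_def)
  show z: "f 0 = 0" using A[of 0 0] by simp
  show m: "f (- a) = - f a" for a using A[of a "- a"] z by (simp add: eq_neg_iff_add_eq_0 add.commute)
  show "f (a - b) = f a - f b" using A[of a "- b"] m by simp
  show "f (a ^ n) = f a ^ n" by (induction n) (auto simp: M o)
  show "f (sum g I) = (\<Sum>i\<in>I. f (g i))"
    by (induction I rule: infinite_finite_induct) (auto simp: A z)
  show "f (of_nat n) = of_nat n" by (induction n) (auto simp: A z o)
qed

lemma unital_hom_comp: "unital_hom f \<Longrightarrow> unital_hom g \<Longrightarrow> unital_hom (\<lambda>x. g (f x))"
  by (auto simp: unital_hom_def)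

lemma unital_hom_const_poly: "unital_hom (\<lambda>c. [:c:])"
  by (auto simp: unital_hom_def)

text \<open>The extension of \<open>f\<close> that sends the indeterminate to \<open>b\<close>.
  Nested, it gives the homomorphisms out of iterated polynomial rings.\<close>

definition eval_hom :: "('a::comm_ring_1 \<Rightarrow> 'b::comm_ring_1) \<Rightarrow> 'b \<Rightarrow> 'a poly \<Rightarrow> 'b" where
  "eval_hom f b p = poly (map_poly f p) b"

lemma eval_hom_pCons: "f 0 = 0 \<Longrightarrow> eval_hom f b (pCons c p) = f c + b * eval_hom f b p"
  by (simp add: eval_hom_def map_poly_pCons)

lemma eval_hom_0 [simp]: "eval_hom f b 0 = 0"
  by (simp add: eval_hom_def)

lemma unital_hom_eval_hom:
  assumes f: "unital_hom f"
  shows "unital_hom (eval_hom f b)"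
proof -
  note [simp] = eval_hom_pCons[of f, OF unital_homD(4)[OF f]] unital_homD(1-4)[OF f]
  have A: "eval_hom f b (p + q) = eval_hom f b p + eval_hom f b q" for p q
    by (induction p q rule: poly_induct2) (auto simp: algebra_simps)
  have S: "eval_hom f b (smult c q) = f c * eval_hom f b q" for c q
    by (induction q) (auto simp: algebra_simps)
  have "eval_hom f b (p * q) = eval_hom f b p * eval_hom f b q" for p q
    by (induction p) (auto simp: A S algebra_simps)
  moreover have "eval_hom f b 1 = 1" by (simp add: one_pCons)
  ultimately show ?thesis using A by (auto simp: unital_hom_def)
qed

lemma eval_hom_const: "unital_hom f \<Longrightarrow> eval_hom f b [:c:] = f c"
  by (simp add: eval_hom_pCons unital_homD)

lemma eval_hom_monom: "unital_hom f \<Longrightarrow> eval_hom f b (monom 1 1) = b"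
  by (simp add: eval_hom_pCons unital_homD monom_altdef)

text \<open>\<open>map_poly f\<close> is itself an evaluation: coefficients go through
  \<open>f\<close> into the constants, the indeterminate to itself.\<close>

lemma unital_hom_map_poly: "unital_hom f \<Longrightarrow> unital_hom (map_poly f)"
proof -
  assume f: "unital_hom f"
  have "map_poly f p = eval_hom (\<lambda>c. [:f c:]) (monom 1 1) p" for p
  proof (induction p)
    case 0 then show ?case by simp
  next
    case (pCons a p)
    then show ?case using f by (simp add: eval_hom_pCons map_poly_pCons unital_homD monom_altdef)
  qed
  then have "map_poly f = eval_hom (\<lambda>c. [:f c:]) (monom 1 1)" by auto
  then show ?thesis using unital_hom_eval_hom[OF unital_hom_comp[OF f unital_hom_const_poly]] by simp
qed

section \<open>Laurent polynomials and weights\<close>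

text \<open>A linear order on the exponents makes the ring of Laurent polynomials an integral domain.\<close>

instance prod :: (linordered_ab_group_add, linordered_ab_group_add) linordered_ab_group_add
  by standard (auto simp: less_eq_prod_def)

text \<open>The key \<open>(n, a, b)\<close> stands for the monomial $x^n z^a t^b$.\<close>

type_synonym 'a laur = "(int \<times> int \<times> int) \<Rightarrow>\<^sub>0 'a"

abbreviation mon :: "'g \<Rightarrow> 'g \<Rightarrow>\<^sub>0 'a::zero_neq_one" where
  "mon g \<equiv> Poly_Mapping.single g 1"

lemma mon_mult: "mon (g::'g::monoid_add) * mon h = (mon (g + h) :: 'g \<Rightarrow>\<^sub>0 'a::semiring_1)"
  by (simp add: mult_single)

section \<open>Homogeneous components and upper bounds for weights\<close>

definition homog_part :: "('g \<Rightarrow> 'o) \<Rightarrow> 'o \<Rightarrow> ('g \<Rightarrow>\<^sub>0 'a) \<Rightarrow> ('g \<Rightarrow>\<^sub>0 'a::comm_monoid_add)" where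
  "homog_part v c f = (\<Sum>g\<in>{g \<in> Poly_Mapping.keys f. v g = c}. Poly_Mapping.single g (Poly_Mapping.lookup f g))"

lemma lookup_homog_part: "Poly_Mapping.lookup (homog_part v c f) g = (if v g = c then Poly_Mapping.lookup f g else 0)"
proof -
  have "Poly_Mapping.lookup (homog_part v c f) g = (\<Sum>h\<in>{h \<in> Poly_Mapping.keys f. v h = c}. Poly_Mapping.lookup f h when h = g)"
    by (simp add: homog_part_def lookup_sum lookup_single)
  also have "\<dots> = (\<Sum>h\<in>{h \<in> Poly_Mapping.keys f. v h = c}. if h = g then Poly_Mapping.lookup f h else 0)"
    by (simp add: when_def)
  also have "\<dots> = (if v g = c then Poly_Mapping.lookup f g else 0)"
    by (subst sum.delta) (auto simp: in_keys_iff)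
  finally show ?thesis .
qed

text \<open>A bound instead of a degree: the component at a bound that is not attained is 0, so
  multiplicativity of leading parts needs no case distinction on zero or cancelling terms.\<close>

definition wt_le :: "('g \<Rightarrow> 'o::linorder) \<Rightarrow> 'o \<Rightarrow> ('g \<Rightarrow>\<^sub>0 'a::zero) \<Rightarrow> bool" where
  "wt_le v c f \<longleftrightarrow> (\<forall>g\<in>Poly_Mapping.keys f. v g \<le> c)"

lemma homog_part_add: "homog_part v c (f + g) = homog_part v c f + homog_part v c g"
  by (rule poly_mapping_eqI) (simp add: lookup_homog_part lookup_add)

lemma homog_part_0 [simp]: "homog_part v c 0 = 0"
  by (simp add: homog_part_def)

lemma homog_part_uminus: "homog_part v c (- f) = - homog_part v c (f :: 'g \<Rightarrow>\<^sub>0 'a::ab_group_add)"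
  by (rule poly_mapping_eqI) (simp add: lookup_homog_part)

lemma homog_part_sum: "homog_part v c (sum f I) = (\<Sum>i\<in>I. homog_part v c (f i))"
  by (induction I rule: infinite_finite_induct) (auto simp: homog_part_add)

lemma homog_part_single: "homog_part v c (Poly_Mapping.single g a) = (if v g = c then Poly_Mapping.single g a else 0)"
  by (rule poly_mapping_eqI) (auto simp: lookup_homog_part lookup_single when_def)

lemma wt_le_0 [simp]: "wt_le v c 0"
  by (simp add: wt_le_def)

lemma wt_le_add: "wt_le v c f \<Longrightarrow> wt_le v c g \<Longrightarrow> wt_le v c (f + g)"
  using keys_add[of f g] by (auto simp: wt_le_def)

lemma wt_le_sum: "(\<And>i. i \<in> I \<Longrightarrow> wt_le v c (f i)) \<Longrightarrow> wt_le v c (sum f I)"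
  by (induction I rule: infinite_finite_induct) (auto simp: wt_le_add)

lemma wt_le_uminus: "wt_le v c (f :: 'g \<Rightarrow>\<^sub>0 'a::ab_group_add) \<Longrightarrow> wt_le v c (- f)"
  by (auto simp: wt_le_def in_keys_iff)

lemma wt_le_mono: "wt_le v c f \<Longrightarrow> c \<le> d \<Longrightarrow> wt_le v d f"
  by (fastforce simp: wt_le_def)

lemma wt_le_single: "v g \<le> c \<Longrightarrow> wt_le v c (Poly_Mapping.single g a)"
  by (auto simp: wt_le_def)

lemma wt_le_homog_part_eq_0: "wt_le v c f \<Longrightarrow> c < d \<Longrightarrow> homog_part v d f = 0"
proof (rule poly_mapping_eqI)
  fix k
  assume "wt_le v c f" "c < d"
  then have "k \<notin> Poly_Mapping.keys f" if "v k = d" using that by (auto simp: wt_le_def)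
  then show "Poly_Mapping.lookup (homog_part v d f) k = Poly_Mapping.lookup 0 k"
    by (auto simp: lookup_homog_part in_keys_iff)
qed

lemma wt_le_le_homog_part: "wt_le v c f \<Longrightarrow> homog_part v d f \<noteq> 0 \<Longrightarrow> d \<le> c"
  using wt_le_homog_part_eq_0[of v c f d] by (meson not_le_imp_less)

locale additive_weight =
  fixes v :: "'g::ab_group_add \<Rightarrow> 'o::linordered_ab_group_add"
  assumes v_add: "v (a + b) = v a + v b"
begin

lemma v_0: "v 0 = 0"
  using v_add[of 0 0] by simp

lemma wt_le_mult:
  fixes f g :: "'g \<Rightarrow>\<^sub>0 'a::comm_ring_1"
  assumes "wt_le v a f" "wt_le v b g"
  shows "wt_le v (a + b) (f * g)"
  using keys_mult[of f g] assms by (fastforce simp: wt_le_def v_add intro: add_mono)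

text \<open>Any product that involves a part strictly below its bound stays strictly below
  \<open>a + b\<close>.\<close>

lemma homog_part_mult:
  fixes f g :: "'g \<Rightarrow>\<^sub>0 'a::comm_ring_1"
  assumes f: "wt_le v a f" and g: "wt_le v b g"
  shows "homog_part v (a + b) (f * g) = homog_part v a f * homog_part v b g"
proof -
  define f1 g1 where "f1 = homog_part v a f" and "g1 = homog_part v b g"
  have k1: "v x = a" if "x \<in> Poly_Mapping.keys f1" for x
    using that by (auto simp: f1_def in_keys_iff lookup_homog_part split: if_splits)
  have k2: "v x = b" if "x \<in> Poly_Mapping.keys g1" for x
    using that by (auto simp: g1_def in_keys_iff lookup_homog_part split: if_splits)
  have k3: "v x < a" if "x \<in> Poly_Mapping.keys (f - f1)" for x
  proof -
    have "Poly_Mapping.lookup f x \<noteq> 0 \<and> v x \<noteq> a"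
      using that by (auto simp: f1_def in_keys_iff lookup_homog_part lookup_minus split: if_splits)
    then show ?thesis using f by (auto simp: wt_le_def in_keys_iff order_less_le)
  qed
  have k4: "v x < b" if "x \<in> Poly_Mapping.keys (g - g1)" for x
  proof -
    have "Poly_Mapping.lookup g x \<noteq> 0 \<and> v x \<noteq> b"
      using that by (auto simp: g1_def in_keys_iff lookup_homog_part lookup_minus split: if_splits)
    then show ?thesis using g by (auto simp: wt_le_def in_keys_iff order_less_le)
  qed
  have z1: "homog_part v (a + b) ((f - f1) * g) = 0"
  proof (rule poly_mapping_eqI)
    fix x
    have "v x \<noteq> a + b" if "x \<in> Poly_Mapping.keys ((f - f1) * g)"
    proof -
      obtain p q where "x = p + q" "p \<in> Poly_Mapping.keys (f - f1)" "q \<in> Poly_Mapping.keys g"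
        using keys_mult[of "f - f1" g] \<open>x \<in> _\<close> by blast
      moreover have "v q \<le> b" using calculation g by (auto simp: wt_le_def)
      ultimately have "v x < a + b" using k3 by (auto simp: v_add intro: add_less_le_mono)
      then show ?thesis by simp
    qed
    then show "Poly_Mapping.lookup (homog_part v (a + b) ((f - f1) * g)) x = Poly_Mapping.lookup 0 x" by (auto simp: lookup_homog_part in_keys_iff)
  qed
  have z2: "homog_part v (a + b) (f1 * (g - g1)) = 0"
  proof (rule poly_mapping_eqI)
    fix x
    have "v x \<noteq> a + b" if "x \<in> Poly_Mapping.keys (f1 * (g - g1))"
    proof -
      obtain p q where "x = p + q" "p \<in> Poly_Mapping.keys f1" "q \<in> Poly_Mapping.keys (g - g1)"
        using keys_mult[of f1 "g - g1"] \<open>x \<in> _\<close> by blast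
      then have "v x < a + b" using k1 k4 by (auto simp: v_add)
      then show ?thesis by simp
    qed
    then show "Poly_Mapping.lookup (homog_part v (a + b) (f1 * (g - g1))) x = Poly_Mapping.lookup 0 x" by (auto simp: lookup_homog_part in_keys_iff)
  qed
  have z3: "homog_part v (a + b) (f1 * g1) = f1 * g1"
  proof (rule poly_mapping_eqI)
    fix x
    have "v x = a + b" if "x \<in> Poly_Mapping.keys (f1 * g1)"
      using keys_mult[of f1 g1] that k1 k2 by (auto simp: v_add)
    then show "Poly_Mapping.lookup (homog_part v (a + b) (f1 * g1)) x = Poly_Mapping.lookup (f1 * g1) x" by (auto simp: lookup_homog_part in_keys_iff)
  qed
  have "f * g = (f - f1) * g + f1 * (g - g1) + f1 * g1" by (simp add: algebra_simps)
  then have "homog_part v (a + b) (f * g) = f1 * g1" by (metis homog_part_add z1 z2 z3 add_0)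
  then show ?thesis by (simp add: f1_def g1_def)
qed

lemma wt_le_1: "wt_le v 0 1"
  by (metis wt_le_single order_refl single_one v_0)

lemma homog_part_1: "homog_part v 0 1 = 1"
  by (metis homog_part_single single_one v_0)

end

lemma single_hom: "unital_hom (\<lambda>c::'a::comm_ring_1. Poly_Mapping.single (0::'g::ab_group_add) c)"
  by (auto simp: unital_hom_def single_add mult_single)

context additive_weight
begin

text \<open>The value group is kept general because it occurs twice: as the exponent group itself,
  for leading monomials, and as the reals.\<close>

definition multiple :: "nat \<Rightarrow> 'o \<Rightarrow> 'o" where "multiple n c = ((+) c ^^ n) 0"

lemma multiple_simps: "multiple 0 c = 0" "multiple (Suc n) c = c + multiple n c"
  by (auto simp: multiple_def)

lemma multiple_add: "multiple (m + n) c = multiple m c + multiple n c"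
  by (induction m) (auto simp: add.assoc multiple_simps)

lemma wt_le_power:
  fixes f :: "'g \<Rightarrow>\<^sub>0 'a::comm_ring_1"
  shows "wt_le v c f \<Longrightarrow> wt_le v (multiple n c) (f ^ n)"
  by (induction n) (auto simp: wt_le_1 wt_le_mult multiple_simps)

lemma homog_part_power:
  fixes f :: "'g \<Rightarrow>\<^sub>0 'a::comm_ring_1"
  shows "wt_le v c f \<Longrightarrow> homog_part v (multiple n c) (f ^ n) = homog_part v c f ^ n"
  by (induction n) (auto simp: homog_part_1 homog_part_mult wt_le_power multiple_simps)

end

section \<open>Derivations\<close>

definition derivation :: "('a::comm_ring_1 \<Rightarrow> 'a) \<Rightarrow> bool" where
  "derivation d \<longleftrightarrow> (\<forall>a b. d (a + b) = d a + d b) \<and> (\<forall>a b. d (a * b) = d a * b + a * d b)"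

lemma derivationD:
  assumes "derivation d"
  shows "d (a + b) = d a + d b" "d (a * b) = d a * b + a * d b" "d 0 = 0" "d 1 = 0"
    "d (- a) = - d a" "d (a - b) = d a - d b" "d (sum g I) = (\<Sum>i\<in>I. d (g i))"
    "d (a ^ Suc n) = of_nat (Suc n) * a ^ n * d a"
proof -
  show A: "d (a + b) = d a + d b" and M: "d (a * b) = d a * b + a * d b" for a b
    using assms by (auto simp: derivation_def)
  show z: "d 0 = 0" using A[of 0 0] by simp
  show o: "d 1 = 0" using M[of 1 1] by simp
  show m: "d (- a) = - d a" for a using A[of a "- a"] z by (simp add: eq_neg_iff_add_eq_0 add.commute)
  show "d (a - b) = d a - d b" using A[of a "- b"] m by simp
  show "d (sum g I) = (\<Sum>i\<in>I. d (g i))"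
    by (induction I rule: infinite_finite_induct) (auto simp: A z)
  show "d (a ^ Suc n) = of_nat (Suc n) * a ^ n * d a"
    by (induction n) (auto simp: M o algebra_simps)
qed

lemma derivation_power_0:
  assumes "derivation d" "of_nat n = (0::'a::comm_ring_1)"
  shows "d (a ^ n) = (0::'a)"
  using assms derivationD(4)[OF assms(1)] by (cases n) (auto simp: derivationD(8) simp del: power_Suc of_nat_Suc)

lemma derivation_map_poly:
  assumes d: "derivation d"
  shows "derivation (map_poly d)"
proof -
  note [simp] = coeff_map_poly[of d, OF derivationD(3)[OF d]]
  have "map_poly d (p + q) = map_poly d p + map_poly d q" for p q
    by (rule poly_eqI) (simp add: derivationD(1)[OF d])
  moreover have "map_poly d (p * q) = map_poly d p * q + p * map_poly d q" for p q
    by (rule poly_eqI) (simp add: coeff_mult derivationD[OF d] sum.distrib)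
  ultimately show ?thesis by (auto simp: derivation_def)
qed

text \<open>With \<open>ex\<close> the exponent of t this is t d/dt, which keeps every monomial in
  place.\<close>

definition euler :: "('g \<Rightarrow> int) \<Rightarrow> ('g \<Rightarrow>\<^sub>0 'a) \<Rightarrow> ('g \<Rightarrow>\<^sub>0 'a::comm_ring_1)" where
  "euler ex f = Poly_Mapping.mapp (\<lambda>g a. of_int (ex g) * a) f"

lemma lookup_euler: "Poly_Mapping.lookup (euler ex f) g = of_int (ex g) * Poly_Mapping.lookup f g"
  by (auto simp: euler_def lookup_mapp when_def in_keys_iff)

lemma euler_single: "euler ex (Poly_Mapping.single g a) = Poly_Mapping.single g (of_int (ex g) * a)"
  by (rule poly_mapping_eqI) (auto simp: lookup_euler lookup_single when_def)

lemma poly_mapping_sum_single: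
  "f = (\<Sum>g\<in>Poly_Mapping.keys f. Poly_Mapping.single g (Poly_Mapping.lookup f g))"
proof (rule poly_mapping_eqI)
  fix k
  have "Poly_Mapping.lookup (\<Sum>g\<in>Poly_Mapping.keys f. Poly_Mapping.single g (Poly_Mapping.lookup f g)) k
      = (\<Sum>g\<in>Poly_Mapping.keys f. if g = k then Poly_Mapping.lookup f g else 0)"
    by (simp add: lookup_sum lookup_single when_def)
  also have "\<dots> = Poly_Mapping.lookup f k"
    by (subst sum.delta) (auto simp: in_keys_iff)
  finally show "Poly_Mapping.lookup f k = Poly_Mapping.lookup
     (\<Sum>g\<in>Poly_Mapping.keys f. Poly_Mapping.single g (Poly_Mapping.lookup f g)) k" by simp
qed

text \<open>Both sides of the Leibniz rule are bilinear, so it reduces to monomials, where it is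
  additivity of \<open>ex\<close>.\<close>

lemma derivation_euler:
  fixes ex :: "'g::comm_monoid_add \<Rightarrow> int"
  assumes ex: "\<And>a b. ex (a + b) = ex a + ex b"
  shows "derivation (euler ex :: ('g \<Rightarrow>\<^sub>0 'a::comm_ring_1) \<Rightarrow> _)"
proof -
  have A: "euler ex (f + g) = euler ex f + euler ex g" for f g :: "'g \<Rightarrow>\<^sub>0 'a"
    by (rule poly_mapping_eqI) (simp add: lookup_euler lookup_add algebra_simps)
  have Z: "euler ex 0 = (0 :: 'g \<Rightarrow>\<^sub>0 'a)"
    by (rule poly_mapping_eqI) (simp add: lookup_euler)
  have S: "euler ex (sum h I) = (\<Sum>i\<in>I. euler ex (h i))" for h :: "'i \<Rightarrow> 'g \<Rightarrow>\<^sub>0 'a" and I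
    by (induction I rule: infinite_finite_induct) (auto simp: A Z)
  have M1: "euler ex (Poly_Mapping.single a c * Poly_Mapping.single b e) =
      euler ex (Poly_Mapping.single a c) * Poly_Mapping.single b e +
      Poly_Mapping.single a c * euler ex (Poly_Mapping.single b (e::'a))" for a b c e
    by (simp add: euler_single mult_single ex algebra_simps flip: single_add)
  have "euler ex (f * g) = euler ex f * g + f * euler ex g" for f g :: "'g \<Rightarrow>\<^sub>0 'a"
  proof -
    define F G where "F = (\<lambda>k. Poly_Mapping.single k (Poly_Mapping.lookup f k))"
      and "G = (\<lambda>k. Poly_Mapping.single k (Poly_Mapping.lookup g k))"
    have f: "f = (\<Sum>k\<in>Poly_Mapping.keys f. F k)" and g: "g = (\<Sum>k\<in>Poly_Mapping.keys g. G k)"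
      unfolding F_def G_def by (rule poly_mapping_sum_single)+
    have "euler ex (f * g) = (\<Sum>i\<in>Poly_Mapping.keys f. \<Sum>j\<in>Poly_Mapping.keys g. euler ex (F i * G j))"
      by (subst f, subst g) (simp add: sum_product S)
    also have "\<dots> = (\<Sum>i\<in>Poly_Mapping.keys f. \<Sum>j\<in>Poly_Mapping.keys g. euler ex (F i) * G j + F i * euler ex (G j))"
      by (simp add: F_def G_def M1)
    also have "\<dots> = (\<Sum>i\<in>Poly_Mapping.keys f. euler ex (F i)) * (\<Sum>j\<in>Poly_Mapping.keys g. G j)
        + (\<Sum>i\<in>Poly_Mapping.keys f. F i) * (\<Sum>j\<in>Poly_Mapping.keys g. euler ex (G j))"
      by (simp add: sum.distrib sum_product)
    also have "\<dots> = euler ex f * g + f * euler ex g"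
      by (simp only: S[symmetric] f[symmetric] g[symmetric])
    finally show ?thesis .
  qed
  then show ?thesis using A by (auto simp: derivation_def)
qed

section \<open>Binary forms\<close>

text \<open>The homogenisation b^r q(a/b) of \<open>q\<close> in degree \<open>r\<close>, with
  coefficients moved along \<open>e\<close>.\<close>

definition binary_form :: "('a::comm_ring_1 \<Rightarrow> 'b::comm_ring_1) \<Rightarrow> 'a poly \<Rightarrow> nat \<Rightarrow> 'b \<Rightarrow> 'b \<Rightarrow> 'b" where
  "binary_form e q r a b = (\<Sum>i\<le>r. e (coeff q i) * a ^ i * b ^ (r - i))"

lemma binary_form_root:
  assumes e: "unital_hom e" and q: "degree q \<le> r"
  shows "binary_form e ([:- c, 1:] * q) (Suc r) a b = (a - e c * b) * binary_form e q r a b"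
proof -
  note [simp] = unital_homD[OF e]
  have "binary_form e ([:- c, 1:] * q) (Suc r) a b =
      (\<Sum>i\<le>Suc r. e (coeff (pCons 0 q) i) * a ^ i * b ^ (Suc r - i)) -
      (\<Sum>i\<le>Suc r. e c * e (coeff q i) * a ^ i * b ^ (Suc r - i))"
    unfolding binary_form_def sum_subtractf[symmetric]
    by (intro sum.cong refl) (simp add: algebra_simps)
  also have "(\<Sum>i\<le>Suc r. e (coeff (pCons 0 q) i) * a ^ i * b ^ (Suc r - i)) = a * binary_form e q r a b"
    by (subst sum.atMost_Suc_shift) (simp add: binary_form_def sum_distrib_left algebra_simps)
  also have "(\<Sum>i\<le>Suc r. e c * e (coeff q i) * a ^ i * b ^ (Suc r - i)) = e c * b * binary_form e q r a b"
    using q by (simp add: coeff_eq_0 binary_form_def sum_distrib_left Suc_diff_le algebra_simps)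
  finally show ?thesis by (simp add: algebra_simps)
qed

text \<open>The counterpart of \<open>binary_form_root\<close> for a zero of the form at
  infinity.\<close>

lemma binary_form_drop:
  assumes e: "unital_hom e" and q: "coeff q (Suc r) = 0"
  shows "binary_form e q (Suc r) a b = b * binary_form e q r a b"
  using assms by (simp add: unital_homD binary_form_def sum_distrib_left Suc_diff_le algebra_simps)

abbreviation C0 :: "'a::zero \<Rightarrow> 'g::zero \<Rightarrow>\<^sub>0 'a" where "C0 c \<equiv> Poly_Mapping.single 0 c"

lemma single_eq_0_iff [simp]: "Poly_Mapping.single g a = 0 \<longleftrightarrow> a = 0"
  by (metis lookup_single_eq lookup_zero single_zero)

lemma single_power:
  "Poly_Mapping.single g (a::'a::comm_ring_1) ^ n = Poly_Mapping.single (((+) g ^^ n) (0::'g::ab_group_add)) (a ^ n)"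
  by (induction n) (auto simp: mult_single)

lemma mon_power: "mon (a, b, c) ^ n = (mon (int n * a, int n * b, int n * c) :: 'a::comm_ring_1 laur)"
  by (induction n) (simp_all add: mult_single algebra_simps flip: zero_prod_def)

lemma binary_form_field:
  fixes A B :: "'a::field"
  assumes "B \<noteq> 0" "degree q \<le> r"
  shows "binary_form (\<lambda>c. c) q r A B = B ^ r * poly q (A / B)"
proof -
  have "poly q (A / B) = (\<Sum>i\<le>r. coeff q i * (A / B) ^ i)"
    unfolding poly_altdef using assms
    by (intro sum.mono_neutral_left) (auto simp: coeff_eq_0)
  moreover have "B ^ r = B ^ i * B ^ (r - i)" if "i \<le> r" for i
    using that by (simp flip: power_add)
  ultimately show ?thesis using assms(1)
    by (auto simp: binary_form_def sum_distrib_left power_divide intro!: sum.cong)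
qed

text \<open>At the largest monomial the equation becomes one between scalars, so the form has a zero
  (A : B) over the ground field. Its linear factor either vanishes, which is the claim, or cancels,
  which lowers \<open>r\<close>.\<close>

lemma binary_form_zero_imp_prop:
  fixes a b :: "'g::linordered_ab_group_add \<Rightarrow>\<^sub>0 'a::field"
  assumes "b \<noteq> 0" "q \<noteq> 0" "degree q \<le> r" "binary_form C0 q r a b = 0"
  shows "\<exists>c. a = C0 c * b"
  using assms(2-)
proof (induction r arbitrary: q)
  case 0
  then have "coeff q 0 = 0" by (simp add: binary_form_def)
  then have "lead_coeff q = 0" using 0(2) by simp
  then have "q = 0" by (simp only: leading_coeff_0_iff)
  with 0 show ?case by simp
next
  case (Suc r)
  interpret additive_weight "\<lambda>g::'g. g" by standard simp
  let ?K = "Poly_Mapping.keys a \<union> Poly_Mapping.keys b"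
  \<comment> \<open>The largest monomial of both elements together: one of the two coefficients at
    \<open>g\<close> may be 0, but not both.\<close>
  define g where "g = Max ?K"
  have K: "finite ?K" "?K \<noteq> {}" using assms(1) by auto
  have wt_le: "wt_le (\<lambda>g. g) g a" "wt_le (\<lambda>g. g) g b"
    using K by (auto simp: wt_le_def g_def)
  have gK: "g \<in> ?K" using Max_in[OF K] by (simp add: g_def)
  define A B where "A = Poly_Mapping.lookup a g" and "B = Poly_Mapping.lookup b g"
  have AB: "A \<noteq> 0 \<or> B \<noteq> 0" using gK by (auto simp: A_def B_def in_keys_iff)
  have hA: "homog_part (\<lambda>g. g) g a = Poly_Mapping.single g A" and hB: "homog_part (\<lambda>g. g) g b = Poly_Mapping.single g B"
    by (rule poly_mapping_eqI; auto simp: lookup_homog_part lookup_single A_def B_def when_def)+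
  have "homog_part (\<lambda>g. g) (multiple (Suc r) g) (C0 c * a ^ i * b ^ (Suc r - i)) =
     Poly_Mapping.single (multiple (Suc r) g) (c * A ^ i * B ^ (Suc r - i))" if "i \<le> Suc r" for i c
  proof -
    have e: "multiple (Suc r) g = 0 + multiple i g + multiple (Suc r - i) g"
    proof -
      have "i + (Suc r - i) = Suc r" using that by simp
      then show ?thesis by (metis add_0 multiple_add)
    qed
    have c: "wt_le (\<lambda>g. g) 0 (C0 c)" "homog_part (\<lambda>g. g) 0 (C0 c) = C0 c"
      by (auto simp: wt_le_single homog_part_single)
    note ai = wt_le_power[OF wt_le(1), of i] and bi = wt_le_power[OF wt_le(2), of "Suc r - i"]
    have "homog_part (\<lambda>g. g) (multiple (Suc r) g) (C0 c * a ^ i * b ^ (Suc r - i)) =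
       C0 c * Poly_Mapping.single g A ^ i * Poly_Mapping.single g B ^ (Suc r - i)"
      unfolding e homog_part_mult[OF wt_le_mult[OF c(1) ai] bi] homog_part_mult[OF c(1) ai]
      by (simp only: c homog_part_power[OF wt_le(1)] homog_part_power[OF wt_le(2)] hA hB)
    also have "\<dots> = Poly_Mapping.single (multiple (Suc r) g) (c * A ^ i * B ^ (Suc r - i))"
      by (simp only: e single_power mult_single multiple_def[symmetric])
    finally show ?thesis .
  qed
  then have "homog_part (\<lambda>g. g) (multiple (Suc r) g) (binary_form C0 q (Suc r) a b) =
      (\<Sum>i\<le>Suc r. Poly_Mapping.single (multiple (Suc r) g) (coeff q i * A ^ i * B ^ (Suc r - i)))"
    unfolding binary_form_def homog_part_sum by (intro sum.cong refl) (simp only: atMost_iff)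
  then have "Poly_Mapping.lookup (homog_part (\<lambda>g. g) (multiple (Suc r) g) (binary_form C0 q (Suc r) a b)) (multiple (Suc r) g) =
      binary_form (\<lambda>c. c) q (Suc r) A B"
    by (simp only: lookup_sum lookup_single_eq binary_form_def)
  then have z: "binary_form (\<lambda>c. c) q (Suc r) A B = 0" using Suc.prems(3) by simp
  show ?case
  \<comment> \<open>\<open>B = 0\<close> is the zero at infinity: the top coefficient of
    \<open>q\<close> vanishes and \<open>b\<close> splits off.\<close>
  proof (cases "B = 0")
    case True
    then have "A \<noteq> 0" using AB by simp
    have "binary_form (\<lambda>c. c) q (Suc r) A B = coeff q (Suc r) * A ^ Suc r"
      using True by (simp add: binary_form_def power_0_left)
    then have c0: "coeff q (Suc r) = 0" using z \<open>A \<noteq> 0\<close> by simp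
    then have "b * binary_form C0 q r a b = 0" using Suc.prems(3) binary_form_drop[OF single_hom c0] by metis
    moreover have "degree q \<le> r"
      using c0 Suc.prems(1,2) by (metis le_SucE leading_coeff_0_iff)
    ultimately show ?thesis using Suc.IH Suc.prems(1) assms(1) by auto
  next
    case False
    then have "poly q (A / B) = 0" using z binary_form_field[OF False Suc.prems(2)] by simp
    then obtain q1 where q1: "q = [:- (A / B), 1:] * q1" by (auto simp: poly_eq_0_iff_dvd)
    have q10: "q1 \<noteq> 0" using q1 Suc.prems(1) by auto
    have "degree q = Suc (degree q1)" using q10 unfolding q1 by (subst degree_mult_eq) auto
    then have dq1: "degree q1 \<le> r" using Suc.prems(2) by simp
    have "(a - C0 (A / B) * b) * binary_form C0 q1 r a b = 0"
      using Suc.prems(3) unfolding q1 binary_form_root[OF single_hom dq1] .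
    then have "a = C0 (A / B) * b \<or> binary_form C0 q1 r a b = 0" by simp
    then show ?thesis using Suc.IH[OF q10 dq1] by auto
  qed
qed

lemma coeff_mult_bound:
  assumes "degree p \<le> m" "degree q \<le> n"
  shows "coeff (p * q) (m + n) = coeff p m * coeff q n"
proof -
  have "coeff (p * q) (m + n) = (\<Sum>i\<le>m + n. if i = m then coeff p m * coeff q n else 0)"
    unfolding coeff_mult
  proof (rule sum.cong)
    fix i assume "i \<in> {..m + n}"
    show "coeff p i * coeff q (m + n - i) = (if i = m then coeff p m * coeff q n else 0)"
      using assms by (cases i m rule: linorder_cases) (auto simp: coeff_eq_0)
  qed simp
  then show ?thesis by simp
qed

lemma coeff_power_bound:
  assumes "degree p \<le> m"
  shows "coeff (p ^ n) (n * m) = coeff p m ^ n \<and> degree (p ^ n) \<le> n * m"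
proof (induction n)
  case (Suc n)
  have "degree (p ^ Suc n) \<le> m + n * m"
    using degree_mult_le[of p "p ^ n"] Suc assms by simp
  then show ?case using coeff_mult_bound[OF assms, of "p ^ n" "n * m"] Suc by simp
qed simp

text \<open>A nonzero product of degree 0 has only factors of degree 0, so one linear factor is
  enough. With d the larger degree, the coefficient of the form at r * d vanishes and equals the
  form in the coefficients A, B at d. Hence B = 0 and Q is a factor, or A = c B for a root c of
  \<open>q\<close> in the ground field.\<close>

lemma binary_form_degree_0:
  fixes P Q :: "('g::linordered_ab_group_add \<Rightarrow>\<^sub>0 'a::field) poly"
  assumes q: "degree q \<le> r" "r > 0" and h: "binary_form (\<lambda>c. [:C0 c:]) q r P Q \<noteq> 0"
    "degree (binary_form (\<lambda>c. [:C0 c:]) q r P Q) = 0"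
  shows "degree Q = 0 \<or> (\<exists>c. degree (P - [:C0 c:] * Q) = 0)"
proof (cases "max (degree P) (degree Q) = 0")
  case True
  then show ?thesis by simp
next
  case False
  have e: "unital_hom (\<lambda>c::'a. [:C0 c :: 'g \<Rightarrow>\<^sub>0 'a:])" using unital_hom_comp[OF single_hom unital_hom_const_poly] .
  have dv: "degree p = 0" if "p * p' = binary_form (\<lambda>c. [:C0 c:]) q r P Q" for p p'
  proof -
    have "degree (p * p') = 0" "p * p' \<noteq> 0" using that h by simp_all
    moreover from this have "p \<noteq> 0" "p' \<noteq> 0" by auto
    ultimately show ?thesis using degree_mult_eq[of p p'] by simp
  qed
  define d where "d = max (degree P) (degree Q)"
  have d: "degree P \<le> d" "degree Q \<le> d" "d > 0" using False by (auto simp: d_def)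
  define A B where "A = coeff P d" and "B = coeff Q d"
  have AB: "A \<noteq> 0 \<or> B \<noteq> 0"
  proof (cases "degree P \<le> degree Q")
    case True
    then have "d = degree Q" "Q \<noteq> 0" using d(3) by (auto simp: d_def)
    then show ?thesis by (simp add: B_def)
  next
    case False
    then have "d = degree P" "P \<noteq> 0" by (auto simp: d_def)
    then show ?thesis by (simp add: A_def)
  qed
  have "coeff (binary_form (\<lambda>c. [:C0 c:]) q r P Q) (r * d) = binary_form C0 q r A B"
    unfolding binary_form_def coeff_sum
  proof (rule sum.cong)
    fix i assume "i \<in> {..r}"
    then have rd: "r * d = 0 + i * d + (r - i) * d" by (simp flip: distrib_right)
    have "degree ([:C0 (coeff q i):] * P ^ i) \<le> 0 + i * d"
      using coeff_power_bound[OF d(1), of i] degree_mult_le[of "[:C0 (coeff q i):]" "P ^ i"] by simp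
    then show "coeff ([:C0 (coeff q i):] * P ^ i * Q ^ (r - i)) (r * d) = C0 (coeff q i) * A ^ i * B ^ (r - i)"
      unfolding rd using coeff_power_bound[OF d(1), of i] coeff_power_bound[OF d(2), of "r - i"]
      by (subst coeff_mult_bound) (auto simp: A_def B_def)
  qed simp
  moreover have "r * d > 0" using d(3) q(2) by simp
  ultimately have z: "binary_form C0 q r A B = 0" using h(2) coeff_eq_0[of "binary_form (\<lambda>c. [:C0 c:]) q r P Q" "r * d"] by simp
  have q0: "q \<noteq> 0" using h(1) by (auto simp: binary_form_def)
  show ?thesis
  proof (cases "B = 0")
    case True
    then have "A \<noteq> 0" using AB by simp
    obtain r' where r': "r = Suc r'" using q(2) by (cases r) auto
    have "binary_form C0 q r A B = C0 (coeff q r) * A ^ r"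
      using True by (simp add: binary_form_def power_0_left r')
    then have "C0 (coeff q r) = (0 :: 'g \<Rightarrow>\<^sub>0 'a)" using z \<open>A \<noteq> 0\<close> by simp
    then have c0: "coeff q (Suc r') = 0" by (simp add: r')
    then show ?thesis using dv[of Q] binary_form_drop[OF e c0, of P Q] r' by auto
  next
    case False
    obtain c where c: "A = C0 c * B" using binary_form_zero_imp_prop[OF False q0 q(1) z] by auto
    have "binary_form C0 q r A B = C0 (poly q c) * B ^ r"
    proof -
      have "poly q c = (\<Sum>i\<le>r. coeff q i * c ^ i)"
        unfolding poly_altdef using q(1)
        by (intro sum.mono_neutral_left) (auto simp: coeff_eq_0)
      then have "C0 (poly q c) = (\<Sum>i\<le>r. C0 (coeff q i) * C0 c ^ i :: 'g \<Rightarrow>\<^sub>0 'a)"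
        by (simp only: unital_homD(2,7,8)[OF single_hom])
      moreover have "B ^ r = B ^ i * B ^ (r - i)" if "i \<le> r" for i
        using that by (simp flip: power_add)
      ultimately show ?thesis
        by (auto simp: binary_form_def c sum_distrib_left sum_distrib_right power_mult_distrib algebra_simps intro!: sum.cong)
    qed
    then have "C0 (poly q c) = (0 :: 'g \<Rightarrow>\<^sub>0 'a)" using z False by simp
    then have "poly q c = 0" by simp
    then obtain q1 where q1: "q = [:- c, 1:] * q1" by (auto simp: poly_eq_0_iff_dvd)
    have q10: "q1 \<noteq> 0" using q1 q0 by auto
    have dq: "degree q = Suc (degree q1)" using q10 unfolding q1 by (subst degree_mult_eq) auto
    then obtain r' where r': "r = Suc r'" "degree q1 \<le> r'" using q(1) by (cases r) auto
    show ?thesis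
      using dv[OF binary_form_root[OF e r'(2), of c P Q, folded q1 r'(1), symmetric]] by blast
  qed
qed

section \<open>Roots of powers and linear systems\<close>

text \<open>With these instances, polynomials over a fraction field have greatest common divisors.\<close>

instantiation fract ::
  (idom) "{unique_euclidean_ring, normalization_euclidean_semiring, normalization_semidom_multiplicative}"
begin

definition [simp]: "normalize_fract = (normalize_field :: 'a fract \<Rightarrow> _)"
definition [simp]: "unit_factor_fract = (unit_factor_field :: 'a fract \<Rightarrow> _)"
definition [simp]: "modulo_fract = (mod_field :: 'a fract \<Rightarrow> _)"
definition [simp]: "euclidean_size_fract = (euclidean_size_field :: 'a fract \<Rightarrow> _)"
definition [simp]: "division_segment (x :: 'a fract) = 1"

instance
  by standard
    (simp_all add: dvd_field_iff field_split_simps split: if_splits)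

end

instantiation fract :: (idom) euclidean_ring_gcd
begin

definition gcd_fract :: "'a fract \<Rightarrow> 'a fract \<Rightarrow> 'a fract" where
  "gcd_fract = Euclidean_Algorithm.gcd"
definition lcm_fract :: "'a fract \<Rightarrow> 'a fract \<Rightarrow> 'a fract" where
  "lcm_fract = Euclidean_Algorithm.lcm"
definition Gcd_fract :: "'a fract set \<Rightarrow> 'a fract" where
  "Gcd_fract = Euclidean_Algorithm.Gcd"
definition Lcm_fract :: "'a fract set \<Rightarrow> 'a fract" where
  "Lcm_fract = Euclidean_Algorithm.Lcm"

instance by standard (simp_all add: gcd_fract_def lcm_fract_def Gcd_fract_def Lcm_fract_def)

end

instance fract :: (idom) field_gcd ..

lemma unital_hom_to_fract: "unital_hom to_fract"
  by (auto simp: unital_hom_def)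

lemma clear_denominators:
  fixes H :: "'a::idom fract poly"
  shows "\<exists>c H0. c \<noteq> 0 \<and> smult (to_fract c) H = map_poly to_fract H0"
proof (induction H)
  case 0
  show ?case by (intro exI[of _ 1] exI[of _ 0]) auto
next
  case (pCons h H)
  then obtain c H0 where c: "c \<noteq> 0" "smult (to_fract c) H = map_poly to_fract H0" by auto
  obtain a b where ab: "h = to_fract a / to_fract b" "b \<noteq> 0"
    by (cases h) (auto simp: Fract_conv_to_fract)
  have "smult (to_fract (b * c)) (pCons h H) = map_poly to_fract (pCons (c * a) (smult b H0))"
    using ab c by (simp add: map_poly_pCons map_poly_smult flip: c(2))
  then show ?case using ab c by (metis mult_eq_0_iff)
qed

text \<open>With m \<alpha> = n \<beta> + 1, the m-th power of X^\<beta> divides that of G^\<alpha>,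
  so H = G^\<alpha> / X^\<beta> is a polynomial. The scalar stays outside the power, since it need
  not have an m-th root.\<close>

lemma coprime_power_root_field:
  fixes X G :: "'a::field_gcd poly"
  assumes "X \<noteq> 0" "G \<noteq> 0" "d \<noteq> 0" and eq: "X ^ m = smult d (G ^ n)" and mn: "coprime m n" "m > 0"
  shows "\<exists>e H. e \<noteq> 0 \<and> G = smult e (H ^ m)"
proof -
  obtain \<alpha> \<beta> where ab: "m * \<alpha> = n * \<beta> + 1"
    using bezout_nat[of m n] mn by (auto simp: coprime_iff_gcd_eq_1)
  have e1: "(X ^ \<beta>) ^ m = smult (d ^ \<beta>) (G ^ (n * \<beta>))"
  proof -
    have "(X ^ \<beta>) ^ m = (X ^ m) ^ \<beta>" by (simp add: mult.commute flip: power_mult)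
    then show ?thesis by (simp add: eq smult_power power_mult)
  qed
  have e2: "(G ^ \<alpha>) ^ m = G ^ (n * \<beta>) * G"
    using ab by (metis mult.commute power_add power_mult power_one_right)
  have "(X ^ \<beta>) ^ m dvd (G ^ \<alpha>) ^ m"
    unfolding e1 e2 using assms(3) by (simp add: smult_dvd_iff)
  then have "X ^ \<beta> dvd G ^ \<alpha>" using mn(2) by (simp add: pow_divides_pow_iff)
  then obtain H where H: "G ^ \<alpha> = X ^ \<beta> * H" by (auto simp: dvd_def)
  have "G ^ (n * \<beta>) * G = smult (d ^ \<beta>) (G ^ (n * \<beta>)) * H ^ m"
    using e2 unfolding H power_mult_distrib e1 by simp
  then have "G ^ (n * \<beta>) * G = G ^ (n * \<beta>) * smult (d ^ \<beta>) (H ^ m)" by simp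
  then have "G = smult (d ^ \<beta>) (H ^ m)" using assms(2) by (simp only: mult_cancel_left) auto
  then show ?thesis using assms(3) by (metis power_not_zero)
qed

text \<open>Descent from the fraction field. Clearing denominators leaves a scalar on each side, and
  later these scalars are Laurent polynomials.\<close>

lemma coprime_power_root:
  fixes X G :: "'a::idom poly"
  assumes "X \<noteq> 0" "G \<noteq> 0" "d1 \<noteq> 0" "d2 \<noteq> 0" and eq: "smult d1 (X ^ m) = smult d2 (G ^ n)"
    and mn: "coprime m n" "m > 0"
  shows "\<exists>c e H. c \<noteq> 0 \<and> e \<noteq> 0 \<and> smult c G = smult e (H ^ m)"
proof -
  let ?f = "map_poly (to_fract :: 'a \<Rightarrow> _)"
  note h = unital_homD[OF unital_hom_map_poly[OF unital_hom_to_fract]]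
  have sm: "?f (smult c p) = smult (to_fract c) (?f p)" for c p by (simp add: map_poly_smult)
  have inj: "?f p = ?f q \<longleftrightarrow> p = q" for p q
    by (auto simp: poly_eq_iff coeff_map_poly)
  have nz: "?f p \<noteq> 0" if "p \<noteq> 0" for p using inj[of p 0] that by simp
  have "smult (to_fract d1) (?f X ^ m) = smult (to_fract d2) (?f G ^ n)"
    using arg_cong[OF eq, of ?f] by (simp add: sm h)
  then have "smult (1 / to_fract d1) (smult (to_fract d1) (?f X ^ m)) = smult (1 / to_fract d1) (smult (to_fract d2) (?f G ^ n))"
    by simp
  then have "?f X ^ m = smult (to_fract d2 / to_fract d1) (?f G ^ n)" using assms(3) by simp
  then obtain e H where eH: "e \<noteq> 0" "?f G = smult e (H ^ m)"
    using coprime_power_root_field[OF nz[OF assms(1)] nz[OF assms(2)] _ _ mn, of "to_fract d2 / to_fract d1"] assms(3,4)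
    by auto
  obtain c H0 where c: "c \<noteq> 0" "smult (to_fract c) H = ?f H0" using clear_denominators by blast
  obtain a b where ab: "e = to_fract a / to_fract b" "b \<noteq> 0"
    by (cases e) (auto simp: Fract_conv_to_fract)
  have a0: "a \<noteq> 0" using eH(1) ab by auto
  have "?f (smult (b * c ^ m) G) = smult (to_fract (b * c ^ m)) (smult e (H ^ m))" by (simp add: sm eH(2))
  also have "\<dots> = smult (to_fract a) ((smult (to_fract c) H) ^ m)"
    using ab by (simp add: smult_power unital_homD(7)[OF unital_hom_to_fract] mult.commute)
  also have "\<dots> = ?f (smult a (H0 ^ m))" unfolding c(2) by (simp add: sm h)
  finally have "smult (b * c ^ m) G = smult a (H0 ^ m)" by (simp only: inj)
  then show ?thesis using a0 ab(2) c(1) by (metis mult_eq_0_iff power_not_zero)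
qed

lemma underdetermined_system:
  fixes a :: "nat \<Rightarrow> 'i \<Rightarrow> 'a::field"
  assumes "finite I" "card I > r"
  shows "\<exists>x. (\<exists>i\<in>I. x i \<noteq> 0) \<and> (\<forall>j<r. (\<Sum>i\<in>I. a j i * x i) = 0)"
  using assms
proof (induction r arbitrary: I a)
  case 0
  then obtain i where "i \<in> I" by (metis card.empty all_not_in_conv less_irrefl)
  then show ?case by (intro exI[of _ "\<lambda>_. 1"]) auto
next
  case (Suc r)
  show ?case
  proof (cases "\<exists>k\<in>I. a r k \<noteq> 0")
    case False
    obtain x where "\<exists>i\<in>I. x i \<noteq> 0" "\<forall>j<r. (\<Sum>i\<in>I. a j i * x i) = 0"
      using Suc.IH[of I a] Suc.prems by auto
    then show ?thesis using False by (intro exI[of _ x]) (auto simp: less_Suc_eq)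
  next
    case True
    then obtain k where k: "k \<in> I" "a r k \<noteq> 0" by auto
    \<comment> \<open>Coefficients after unknown \<open>k\<close> has been eliminated by means of
      equation \<open>r\<close>; the value of \<open>y\<close> at \<open>k\<close> below then
      restores that equation.\<close>
    define b where "b = (\<lambda>j i. a j i - a j k * a r i / a r k)"
    have "card (I - {k}) > r" using Suc.prems k by simp
    then obtain x where x: "\<exists>i\<in>I - {k}. x i \<noteq> 0" "\<forall>j<r. (\<Sum>i\<in>I - {k}. b j i * x i) = 0"
      using Suc.IH[of "I - {k}" b] Suc.prems by auto
    define y where "y = x(k := - (\<Sum>i\<in>I - {k}. a r i * x i) / a r k)"
    have s: "(\<Sum>i\<in>I. a j i * y i) = (\<Sum>i\<in>I - {k}. b j i * x i)" for j
    proof -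
      have "(\<Sum>i\<in>I. a j i * y i) = a j k * y k + (\<Sum>i\<in>I - {k}. a j i * x i)"
        using Suc.prems(1) k(1) by (simp add: sum.remove[of I k] y_def)
      also have "a j k * y k = - (\<Sum>i\<in>I - {k}. a j k * a r i / a r k * x i)"
        by (simp add: y_def sum_distrib_left sum_divide_distrib sum_negf mult.assoc)
      finally show ?thesis by (simp add: b_def sum_subtractf algebra_simps)
    qed
    have "(\<Sum>i\<in>I. a j i * y i) = 0" if "j < Suc r" for j
    proof (cases "j = r")
      case True
      then show ?thesis using k(2) by (simp add: s b_def)
    next
      case False
      then show ?thesis using x(2) that by (simp add: s)
    qed
    moreover have "\<exists>i\<in>I. y i \<noteq> 0" using x(1) by (auto simp: y_def)
    ultimately show ?thesis by blast
  qed
qed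

text \<open>In 2 a^2 = b^2 the exponent of 2 is odd on the left and even on the right.\<close>

lemma sqrt2_irrational:
  assumes "of_int a * sqrt 2 = (of_int b :: real)"
  shows "a = 0"
proof (rule ccontr)
  assume a: "a \<noteq> 0"
  have "(of_int a * sqrt 2)\<^sup>2 = (of_int b :: real)\<^sup>2" using assms by simp
  then have "of_int (2 * a\<^sup>2) = (of_int (b\<^sup>2) :: real)" by (simp add: power_mult_distrib)
  then have e: "2 * a\<^sup>2 = b\<^sup>2" by (simp only: of_int_eq_iff)
  then have b: "b \<noteq> 0" using a by auto
  have p: "prime_elem (2::int)" by simp
  have "multiplicity 2 (2 * a\<^sup>2) = 1 + 2 * multiplicity 2 a"
    using a p by (simp add: prime_elem_multiplicity_mult_distrib prime_elem_multiplicity_power_distrib)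
  moreover have "multiplicity 2 (b\<^sup>2) = 2 * multiplicity 2 b"
    using b p by (simp add: prime_elem_multiplicity_power_distrib)
  ultimately have "1 + 2 * multiplicity 2 a = 2 * multiplicity 2 b" using e by simp
  then show False by presburger
qed

lemma sum_distinct_degree:
  fixes f :: "'i \<Rightarrow> 'a::comm_ring_1 poly"
  assumes "finite I" "I \<noteq> {}" "\<And>i. i \<in> I \<Longrightarrow> f i \<noteq> 0" "inj_on (\<lambda>i. degree (f i)) I"
  shows "\<exists>i\<in>I. degree (sum f I) = degree (f i) \<and> (\<forall>j\<in>I. degree (f j) \<le> degree (f i)) \<and> sum f I \<noteq> 0"
proof -
  let ?D = "(\<lambda>i. degree (f i)) ` I"
  have "Max ?D \<in> ?D" using assms by (intro Max_in) auto
  then obtain i where i: "i \<in> I" "Max ?D = degree (f i)" by (metis (no_types, lifting) imageE)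
  have le: "degree (f j) \<le> degree (f i)" if "j \<in> I" for j
    using that assms(1) by (metis (no_types, lifting) Max_ge finite_imageI image_eqI i(2))
  have lt: "coeff (f j) (degree (f i)) = 0" if "j \<in> I - {i}" for j
  proof -
    have "degree (f j) \<noteq> degree (f i)" using that i(1) assms(4) by (auto simp: inj_on_def)
    then show ?thesis using le[of j] that by (intro coeff_eq_0) auto
  qed
  have "coeff (sum f I) (degree (f i)) = coeff (f i) (degree (f i))"
    using assms(1) i(1) lt by (simp add: coeff_sum sum.remove[of I i])
  then have nz: "coeff (sum f I) (degree (f i)) \<noteq> 0" using assms(3)[OF i(1)] by simp
  have "degree (sum f I) \<le> degree (f i)"
    using assms(1) le by (intro degree_sum_le) auto
  then have "degree (sum f I) = degree (f i)" using nz le_degree by (metis le_antisym)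
  then show ?thesis using nz i(1) le by (intro bexI[of _ i]) auto
qed

section \<open>Graded parametrisations\<close>

text \<open>For m > 0 this is the least j >= 0 with n + m j >= 0, that is, the ceiling of -n/m cut
  off at 0. As y has x-degree -m, the monomial x^i y^j with i = \<open>x_exp m n\<close> has
  x-degree n.\<close>

definition y_exp :: "nat \<Rightarrow> int \<Rightarrow> nat" where "y_exp m n = nat ((int m - 1 - n) div int m)"
definition x_exp :: "nat \<Rightarrow> int \<Rightarrow> nat" where "x_exp m n = nat (n + int m * int (y_exp m n))"

definition form_at :: "(nat \<times> nat) set \<Rightarrow> (nat \<times> nat \<Rightarrow> 'a) \<Rightarrow> 'a laur poly \<Rightarrow> 'a laur poly \<Rightarrow> 'a::comm_ring_1 laur poly" where
  "form_at I c Z T = (\<Sum>e\<in>I. [:C0 (c e):] * Z ^ fst e * T ^ snd e)"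

lemma degree_0_factor:
  fixes p q :: "'b::idom poly"
  assumes "degree (p * q) = 0" "p * q \<noteq> 0"
  shows "degree p = 0" "degree q = 0"
  using assms degree_mult_eq[of p q] by auto

lemma degree_power_0:
  fixes p :: "'b::idom poly"
  assumes "degree (p ^ n) = 0" "n > 0"
  shows "degree p = 0"
  using assms by (cases "p = 0") (auto simp: degree_power_eq)

definition x_homog :: "int \<Rightarrow> ('a::zero) laur \<Rightarrow> bool" where
  "x_homog k f \<longleftrightarrow> (\<forall>g\<in>Poly_Mapping.keys f. fst g = k)"

lemma x_homog_mult: "x_homog k f \<Longrightarrow> x_homog l g \<Longrightarrow> x_homog (k + l) (f * g :: 'a::comm_ring_1 laur)"
  using keys_mult[of f g] by (fastforce simp: x_homog_def)

lemma x_homog_single: "fst g = k \<Longrightarrow> x_homog k (Poly_Mapping.single g a)"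
  by (auto simp: x_homog_def)

lemma x_homog_power: "x_homog k f \<Longrightarrow> x_homog (int n * k) (f ^ n :: 'a::comm_ring_1 laur)"
proof (induction n)
  case 0
  have "x_homog 0 (C0 1 :: 'a laur)" by (rule x_homog_single) simp
  then show ?case by simp
next
  case (Suc n)
  then show ?case using x_homog_mult[of k f "int n * k" "f ^ n"] by (simp add: algebra_simps)
qed

lemma x_homog_add: "x_homog k f \<Longrightarrow> x_homog k g \<Longrightarrow> x_homog k (f + g)"
  using keys_add[of f g] by (auto simp: x_homog_def)

lemma x_homog_uminus: "x_homog k f \<Longrightarrow> x_homog k (- f :: 'a::comm_ring_1 laur)"
  by (auto simp: x_homog_def in_keys_iff)

lemma x_homog_unique: "x_homog k f \<Longrightarrow> x_homog l f \<Longrightarrow> f \<noteq> 0 \<Longrightarrow> k = l"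
  by (metis all_not_in_conv keys_eq_empty x_homog_def)

text \<open>
  \<open>X, Y, Z, T\<close> are the images of \<open>x, y, z, t\<close> under the graded exponential map, as polynomials in its parameter.
  The exponents are related to those of the theorem by \<open>p ^ e = p ^ r * p ^ d\<close> and \<open>s * p = s1 * p ^ d\<close>.
\<close>

locale graded_curve =
  fixes p m d r s1 :: nat and X Y Z T :: "'a::field laur poly"
  assumes char: "CHAR('a) = p" "p > 0"
    and m: "m \<ge> 2" and r: "r > 0" and s1: "s1 \<ge> 2" "\<not> p dvd s1"
    and rel: "X ^ m * Y + (Z ^ (p ^ r) + T ^ s1) ^ (p ^ d) = 0"
    and X0: "coeff X 0 = mon (1, 0, 0)" and Z0: "coeff Z 0 = mon (0, 1, 0)" and T0: "coeff T 0 = mon (0, 0, 1)"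
    and Y0: "Y = [:- mon (- int m, 0, 0) * (mon (0, 1, 0) ^ (p ^ r) + mon (0, 0, 1) ^ s1) ^ (p ^ d):]"
begin

section \<open>Differentiation along t on the graded curve\<close>

lemma prime_p: "prime p"
  using char prime_CHAR_semidom[where ?'a = 'a] by simp

lemma of_nat_laur: "(of_nat n :: 'a laur) = 0 \<longleftrightarrow> p dvd n"
proof -
  have "(of_nat n :: 'a laur) = C0 (of_nat n)" by simp
  then show ?thesis
    by (metis single_eq_0_iff of_nat_eq_0_iff_char_dvd char(1))
qed

abbreviation "q1 \<equiv> p ^ r"
abbreviation "P \<equiv> p ^ d"

lemma q1: "(of_nat q1 :: 'a laur) = 0" "q1 > 1"
  using r prime_p of_nat_laur[of q1] prime_gt_1_nat[OF prime_p] one_less_power[of p r]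
  by (auto intro: dvd_power)

lemma cop_q1s1: "coprime s1 q1"
  using prime_p s1(2) by (simp add: coprime_commute prime_imp_coprime)

text \<open>The operator t d/dt. \<open>\<Theta>\<close> applies it to coefficients and treats the
  parameter of the exponential map as a constant.\<close>

definition \<theta> :: "'a laur \<Rightarrow> 'a laur" where "\<theta> = euler (\<lambda>g. snd (snd g))"

lemma derivation_\<theta>: "derivation \<theta>"
  unfolding \<theta>_def by (rule derivation_euler) auto

abbreviation "\<Theta> \<equiv> map_poly \<theta>"

lemma derivation_\<Theta>: "derivation \<Theta>"
  by (rule derivation_map_poly[OF derivation_\<theta>])

lemma nz: "X \<noteq> 0" "Z \<noteq> 0" "T \<noteq> 0"
  using X0 Z0 T0 by auto

lemma Y_nz: "Y \<noteq> 0"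
proof -
  let ?f = "mon (0, 1, 0) ^ q1 + mon (0, 0, 1) ^ s1 :: 'a laur"
  have "?f = mon (0, int q1, 0) + mon (0, 0, int s1)"
    unfolding mon_power by simp
  then have "Poly_Mapping.lookup ?f (0, int q1, 0) = 1"
    using char(2) s1(1) by (simp add: lookup_add lookup_single)
  then have "?f \<noteq> 0" by auto
  then show ?thesis unfolding Y0 by simp
qed

lemma \<Theta>_C0: "\<Theta> [:C0 c:] = 0"
  by (simp add: map_poly_pCons derivationD(3)[OF derivation_\<theta>]) (simp add: \<theta>_def euler_single zero_prod_def)

lemma \<Theta>_smult_C0: "\<Theta> (smult (C0 c) f) = smult (C0 c) (\<Theta> f)"
  using derivationD(2)[OF derivation_\<Theta>, of "[:C0 c:]" f] \<Theta>_C0 by simp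

lemma of_nat_q1: "(of_nat q1 :: 'a laur poly) = 0"
  using q1(1) by (simp add: of_nat_poly)

lemma \<Theta>_q1: "\<Theta> (f ^ q1) = 0"
  using derivation_power_0[OF derivation_\<Theta> of_nat_q1] .

lemma \<Theta>_s1: "\<Theta> (T ^ s1) = smult (of_nat s1) (T ^ (s1 - 1) * \<Theta> T)"
proof -
  have "\<Theta> (T ^ Suc (s1 - 1)) = of_nat (Suc (s1 - 1)) * T ^ (s1 - 1) * \<Theta> T"
    by (rule derivationD(8)[OF derivation_\<Theta>])
  then show ?thesis using s1(1) by (simp add: of_nat_poly)
qed

lemma \<Theta>T0: "coeff (\<Theta> T) 0 = mon (0, 0, 1)"
  by (simp add: coeff_map_poly derivationD(3)[OF derivation_\<theta>] T0) (simp add: \<theta>_def euler_single)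

lemma \<Theta>T: "\<Theta> T \<noteq> 0"
  using \<Theta>T0 by auto

lemma s1_nz: "(of_nat s1 :: 'a laur) \<noteq> 0"
  using of_nat_laur s1(2) by simp

lemma deg_\<Theta>: "degree (\<Theta> f) \<le> degree f"
  by (intro degree_le) (auto simp: coeff_map_poly derivationD(3)[OF derivation_\<theta>] coeff_eq_0)

text \<open>
  The Euler derivation in \<open>t\<close> kills the $p$-th power \<open>Z ^ q1\<close>, so \<open>T ^ (s1 - 1) * \<Theta> T\<close> is constant, and it is
  nonzero because its constant term is.
\<close>

lemma line_imp_T_const:
  assumes "c \<noteq> 0" "degree (Z ^ q1 - [:C0 c:] * T ^ s1) = 0"
  shows "degree T = 0"
proof -
  have "degree (\<Theta> (Z ^ q1 - [:C0 c:] * T ^ s1)) = 0"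
    using assms(2) deg_\<Theta> by (metis le_zero_eq)
  then have "degree (smult (- C0 c * of_nat s1) (T ^ (s1 - 1) * \<Theta> T)) = 0"
    by (simp add: derivationD(6)[OF derivation_\<Theta>] \<Theta>_q1 \<Theta>_smult_C0 \<Theta>_s1)
  then have "degree (T ^ (s1 - 1) * \<Theta> T) = 0"
    using assms(1) s1_nz by (simp split: if_splits)
  then have "degree (T ^ (s1 - 1)) = 0" by (rule degree_0_factor(1)) (use \<Theta>T nz(3) in simp)
  then show ?thesis by (rule degree_power_0) (use s1(1) in simp)
qed

text \<open>
  A constant weighted form in \<open>Z\<close>, \<open>T\<close> has a factor \<open>Z ^ q1 - c * T ^ s1\<close> with \<open>c\<close> in the ground field, since \<open>c\<close> is read
  off the leading coefficients and the ground field is algebraically closed in the Laurent polynomials.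
\<close>

lemma weighted_form_const:
  assumes I: "finite I" "I \<noteq> {}" "I \<noteq> {(0,0)}"
    and w: "\<And>a b. (a, b) \<in> I \<Longrightarrow> s1 * a + q1 * b = \<omega>"
    and h: "degree (form_at I c Z T) = 0" "form_at I c Z T \<noteq> 0"
  shows "degree Z = 0 \<or> degree T = 0"
proof -
  obtain a1 b1 where 1: "(a1, b1) \<in> I" using I(2) by auto
  \<comment> \<open>As q1 and s1 are coprime, the natural solutions of s1 * a + q1 * b = \<omega>
    form a progression (a0 + q1 * i, b0 + s1 * (R - i)), i <= R, with common residues a0 and
    b0.\<close>
  define a0 b0 R where "a0 = a1 mod q1" and "b0 = b1 mod s1" and "R = a1 div q1 + b1 div s1"
  have pos: "q1 > 0" "s1 > 0" using char(2) s1(1) by auto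
  have key: "a = a0 + q1 * (a div q1) \<and> b = b0 + s1 * (R - a div q1) \<and> a div q1 \<le> R" if "(a, b) \<in> I" for a b
  proof -
    have "s1 * a + q1 * b = s1 * a1 + q1 * b1" using w[OF that] w[OF 1] by simp
    then have "int s1 * int a + int q1 * int b = int s1 * int a1 + int q1 * int b1"
      by (metis of_nat_add of_nat_mult)
    then have e: "int s1 * (int a - int a1) = int q1 * (int b1 - int b)"
      by (simp add: algebra_simps)
    then have "int q1 dvd int a - int a1"
      using cop_q1s1 by (metis coprime_commute coprime_dvd_mult_right_iff coprime_int_iff dvd_triv_left)
    then obtain k where k: "int a = int a1 + int q1 * k" by (auto simp: dvd_def algebra_simps)
    then have "int q1 * (int s1 * k) = int q1 * (int b1 - int b)" using e by (simp add: algebra_simps)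
    then have k2: "int b = int b1 - int s1 * k" using pos(1) by auto
    have A: "int (a mod q1) = int a0" "int (a div q1) = int (a1 div q1) + k"
      using pos(1) by (simp_all add: a0_def zmod_int zdiv_int k del: of_nat_power)
    have B: "int (b mod s1) = int b0" "int (b div s1) = int (b1 div s1) - k"
      using pos(2) div_mult_self2[of "int s1" "int b1" "- k"] mod_mult_self2[of "int b1" "int s1" "- k"]
      by (simp_all add: b0_def zmod_int zdiv_int k2)
    have R: "R = a div q1 + b div s1" using A(2) B(2) by (simp add: R_def)
    have "a mod q1 = a0" "b mod s1 = b0" using A B by simp_all
    then show ?thesis using R by (metis add_diff_cancel_left' le_add1 mod_mult_div_eq)
  qed
  define \<pi> where "\<pi> = (\<lambda>i. (a0 + q1 * i, b0 + s1 * (R - i)))"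
  have inj: "inj_on \<pi> {..R}" using pos by (auto simp: inj_on_def \<pi>_def)
  have sub: "I \<subseteq> \<pi> ` {..R}"
  proof
    fix e assume "e \<in> I"
    then have "e = \<pi> (fst e div q1) \<and> fst e div q1 \<le> R" using key[of "fst e" "snd e"] by (simp add: \<pi>_def prod_eq_iff)
    then show "e \<in> \<pi> ` {..R}" by blast
  qed
  \<comment> \<open>Zero coefficients fill the gaps of I in the progression; the form is then Z^a0 *
    T^b0 times a binary form in Z^q1 and T^s1.\<close>
  define q where "q = (\<Sum>i\<le>R. monom (if \<pi> i \<in> I then c (\<pi> i) else 0) i)"
  have cq: "coeff q i = (if i \<le> R \<and> \<pi> i \<in> I then c (\<pi> i) else 0)" for i
  proof -
    have "coeff q i = (\<Sum>j\<le>R. if j = i then (if \<pi> i \<in> I then c (\<pi> i) else 0) else 0)"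
      unfolding q_def coeff_sum by (intro sum.cong) (auto simp: coeff_monom)
    then show ?thesis by (simp add: sum.delta)
  qed
  have dq: "degree q \<le> R" using cq by (intro degree_le) auto
  have "form_at I c Z T = (\<Sum>e\<in>\<pi> ` {..R}. if e \<in> I then [:C0 (c e):] * Z ^ fst e * T ^ snd e else 0)"
    unfolding form_at_def using sub by (subst sum.inter_restrict[symmetric]) (auto simp: Int_absorb1)
  also have "\<dots> = (\<Sum>i\<le>R. if \<pi> i \<in> I then [:C0 (c (\<pi> i)):] * Z ^ fst (\<pi> i) * T ^ snd (\<pi> i) else 0)"
    by (subst sum.reindex[OF inj]) simp
  also have "\<dots> = (\<Sum>i\<le>R. Z ^ a0 * T ^ b0 * ([:C0 (coeff q i):] * (Z ^ q1) ^ i * (T ^ s1) ^ (R - i)))"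
  proof (intro sum.cong refl)
    fix i assume i: "i \<in> {..R}"
    have "Z ^ fst (\<pi> i) = Z ^ a0 * (Z ^ q1) ^ i" "T ^ snd (\<pi> i) = T ^ b0 * (T ^ s1) ^ (R - i)"
      by (simp_all only: \<pi>_def fst_conv snd_conv power_add power_mult)
    then show "(if \<pi> i \<in> I then [:C0 (c (\<pi> i)):] * Z ^ fst (\<pi> i) * T ^ snd (\<pi> i) else 0) =
      Z ^ a0 * T ^ b0 * ([:C0 (coeff q i):] * (Z ^ q1) ^ i * (T ^ s1) ^ (R - i))"
      using i by (simp add: cq mult_ac)
  qed
  also have "\<dots> = Z ^ a0 * (T ^ b0 * binary_form (\<lambda>c. [:C0 c:]) q R (Z ^ q1) (T ^ s1))"
    by (simp add: binary_form_def sum_distrib_left mult.assoc)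
  finally have H: "form_at I c Z T = Z ^ a0 * (T ^ b0 * binary_form (\<lambda>c. [:C0 c:]) q R (Z ^ q1) (T ^ s1))" .
  note d1 = degree_0_factor[OF h[unfolded H]]
  have nz2: "T ^ b0 * binary_form (\<lambda>c. [:C0 c:]) q R (Z ^ q1) (T ^ s1) \<noteq> 0" using h(2)[unfolded H] by auto
  note d2 = degree_0_factor[OF d1(2) nz2]
  consider "a0 > 0" | "b0 > 0" | "a0 = 0" "b0 = 0" by blast
  then show ?thesis
  proof cases
    case 1
    then show ?thesis using degree_power_0[OF d1(1)] by simp
  next
    case 2
    then show ?thesis using degree_power_0[OF d2(1)] by simp
  next
    case 3
    \<comment> \<open>For R = 0 the progression would be the single point (0, 0), which the
      hypothesis on I excludes.\<close>
    have "R > 0"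
    proof (rule ccontr)
      assume "\<not> R > 0"
      have "e = (0, 0)" if e: "e \<in> I" for e
      proof -
        have k: "fst e = a0 + q1 * (fst e div q1) \<and> snd e = b0 + s1 * (R - fst e div q1) \<and> fst e div q1 \<le> R"
          using key[of "fst e" "snd e"] e by simp
        then have "fst e div q1 = 0" using \<open>\<not> R > 0\<close> by simp
        then have "fst e = 0" "snd e = 0" using k 3 \<open>\<not> R > 0\<close> by (metis add_0 mult_0_right diff_self_eq_0 neq0_conv)+
        then show ?thesis by (simp add: prod_eq_iff)
      qed
      then show False using I by auto
    qed
    have nz3: "binary_form (\<lambda>c. [:C0 c:]) q R (Z ^ q1) (T ^ s1) \<noteq> 0" using nz2 by auto
    consider "degree (T ^ s1) = 0" | c where "degree (Z ^ q1 - [:C0 c:] * T ^ s1) = 0"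
      using binary_form_degree_0[OF dq \<open>R > 0\<close> nz3 d2(2)] by metis
    then show ?thesis
    proof cases
      case 1
      then show ?thesis using degree_power_0[of T s1] pos(2) by simp
    next
      case (2 c)
      show ?thesis
      proof (cases "c = 0")
        case True
        then have "degree (Z ^ q1) = 0" using 2 by simp
        then show ?thesis using degree_power_0[of Z q1] pos(1) by simp
      next
        case False
        then show ?thesis using line_imp_T_const[OF False 2] by simp
      qed
    qed
  qed
qed

text \<open>The leading forms of invariants: \<open>n\<close> is the $x$-degree and \<open>I\<close> the support of the $(z, t)$-part.\<close>

definition good :: "int \<Rightarrow> (nat \<times> nat) set \<Rightarrow> (nat \<times> nat \<Rightarrow> 'a) \<Rightarrow> bool" where
  "good n I c \<longleftrightarrow> finite I \<and> I \<noteq> {} \<and> (\<forall>e\<in>I. c e \<noteq> 0) \<and> (\<exists>\<omega>. \<forall>a b. (a, b) \<in> I \<longrightarrow> s1 * a + q1 * b = \<omega>)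
    \<and> X ^ x_exp m n * Y ^ y_exp m n * form_at I c Z T \<noteq> 0
    \<and> degree (X ^ x_exp m n * Y ^ y_exp m n * form_at I c Z T) = 0"

lemma goodD:
  assumes "good n I c"
  shows "finite I" "I \<noteq> {}" "\<And>e. e \<in> I \<Longrightarrow> c e \<noteq> 0" "\<exists>\<omega>. \<forall>a b. (a, b) \<in> I \<longrightarrow> s1 * a + q1 * b = \<omega>"
    "degree (form_at I c Z T) = 0" "form_at I c Z T \<noteq> 0" "x_exp m n > 0 \<Longrightarrow> degree X = 0"
proof -
  show "finite I" "I \<noteq> {}" "\<And>e. e \<in> I \<Longrightarrow> c e \<noteq> 0" "\<exists>\<omega>. \<forall>a b. (a, b) \<in> I \<longrightarrow> s1 * a + q1 * b = \<omega>"
    using assms by (auto simp: good_def)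
  have g: "X ^ x_exp m n * Y ^ y_exp m n * form_at I c Z T \<noteq> 0" "degree (X ^ x_exp m n * Y ^ y_exp m n * form_at I c Z T) = 0"
    using assms by (auto simp: good_def)
  show "degree (form_at I c Z T) = 0" "form_at I c Z T \<noteq> 0" using degree_0_factor[OF g(2,1)] g(1) by auto
  have "degree (X ^ x_exp m n * Y ^ y_exp m n) = 0" "X ^ x_exp m n * Y ^ y_exp m n \<noteq> 0"
    using degree_0_factor[OF g(2,1)] g(1) by auto
  then have "degree (X ^ x_exp m n) = 0" by (rule degree_0_factor)
  then show "x_exp m n > 0 \<Longrightarrow> degree X = 0" by (rule degree_power_0)
qed

text \<open>By homogeneity b determines a, so the terms have distinct degrees b * degree T in the
  parameter and cannot cancel. Degree 0 of the sum leaves only b = 0.\<close>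

lemma good_Z_const:
  assumes g: "good n I c" and "degree Z = 0" "degree T > 0"
  shows "\<exists>a. I = {(a, 0)}"
proof -
  note G = goodD[OF g]
  obtain \<omega> where w: "\<And>a b. (a, b) \<in> I \<Longrightarrow> s1 * a + q1 * b = \<omega>" using G(4) by auto
  have inj: "e = e'" if "e \<in> I" "e' \<in> I" "snd e = snd e'" for e e'
  proof -
    have "s1 * fst e + q1 * snd e = \<omega>" "s1 * fst e' + q1 * snd e' = \<omega>"
      using w[of "fst e" "snd e"] w[of "fst e'" "snd e'"] that(1,2) by simp_all
    then have "s1 * fst e = s1 * fst e'" using that(3) by (metis add_right_cancel)
    then show ?thesis using that(3) s1(1) by (simp add: prod_eq_iff)
  qed
  let ?f = "\<lambda>e. [:C0 (c e):] * Z ^ fst e * T ^ snd e"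
  have deg: "degree (?f e) = snd e * degree T" if "e \<in> I" for e
    using G(3)[OF that] nz assms(2) by (simp add: degree_mult_eq degree_power_eq)
  have "inj_on (\<lambda>e. degree (?f e)) I"
  proof (rule inj_onI)
    fix e e' assume e: "e \<in> I" "e' \<in> I" "degree (?f e) = degree (?f e')"
    then show "e = e'" using inj[OF e(1,2)] assms(3) unfolding deg[OF e(1)] deg[OF e(2)] by simp
  qed
  moreover have "?f e \<noteq> 0" if "e \<in> I" for e using G(3)[OF that] nz by simp
  ultimately obtain i where i: "i \<in> I" "degree (sum ?f I) = degree (?f i)" "\<forall>j\<in>I. degree (?f j) \<le> degree (?f i)"
    using sum_distinct_degree[OF G(1,2), of ?f] by blast
  then have "degree (?f j) = 0" if "j \<in> I" for j using that G(5) by (auto simp: form_at_def)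
  then have "snd j = 0" if "j \<in> I" for j using deg[OF that] that assms(3) by simp
  then have "e = i" if "e \<in> I" for e using inj[OF that i(1)] that i(1) by simp
  then have "I = {i}" using i(1) by blast
  moreover have "i = (fst i, 0)" using \<open>\<And>j. j \<in> I \<Longrightarrow> snd j = 0\<close> i(1) by (simp add: prod_eq_iff)
  ultimately show ?thesis by metis
qed

text \<open>The same absence of cancellation, now with degrees a * degree Z.\<close>

lemma good_T_const:
  assumes g: "good n I c" and "degree T = 0" "degree Z > 0"
  shows "\<exists>b. I = {(0, b)}"
proof -
  note G = goodD[OF g]
  obtain \<omega> where w: "\<And>a b. (a, b) \<in> I \<Longrightarrow> s1 * a + q1 * b = \<omega>" using G(4) by auto
  have inj: "e = e'" if "e \<in> I" "e' \<in> I" "fst e = fst e'" for e e'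
  proof -
    have "s1 * fst e + q1 * snd e = \<omega>" "s1 * fst e' + q1 * snd e' = \<omega>"
      using w[of "fst e" "snd e"] w[of "fst e'" "snd e'"] that(1,2) by simp_all
    then have "q1 * snd e = q1 * snd e'" using that(3) by (metis add_left_cancel)
    then show ?thesis using that(3) char(2) by (simp add: prod_eq_iff)
  qed
  let ?f = "\<lambda>e. [:C0 (c e):] * Z ^ fst e * T ^ snd e"
  have deg: "degree (?f e) = fst e * degree Z" if "e \<in> I" for e
    using G(3)[OF that] nz assms(2) by (simp add: degree_mult_eq degree_power_eq)
  have "inj_on (\<lambda>e. degree (?f e)) I"
  proof (rule inj_onI)
    fix e e' assume e: "e \<in> I" "e' \<in> I" "degree (?f e) = degree (?f e')"
    then show "e = e'" using inj[OF e(1,2)] assms(3) unfolding deg[OF e(1)] deg[OF e(2)] by simp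
  qed
  moreover have "?f e \<noteq> 0" if "e \<in> I" for e using G(3)[OF that] nz by simp
  ultimately obtain i where i: "i \<in> I" "degree (sum ?f I) = degree (?f i)" "\<forall>j\<in>I. degree (?f j) \<le> degree (?f i)"
    using sum_distinct_degree[OF G(1,2), of ?f] by blast
  then have "degree (?f j) = 0" if "j \<in> I" for j using that G(5) by (auto simp: form_at_def)
  then have "fst j = 0" if "j \<in> I" for j using deg[OF that] that assms(3) by simp
  then have "e = i" if "e \<in> I" for e using inj[OF that i(1)] that i(1) by simp
  then have "I = {i}" using i(1) by blast
  moreover have "i = (0, snd i)" using \<open>\<And>j. j \<in> I \<Longrightarrow> fst j = 0\<close> i(1) by (simp add: prod_eq_iff)
  ultimately show ?thesis by metis
qed

text \<open>As Y is constant, so is Z^q1 + T^s1, and this is the case c = -1 of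
  \<open>line_imp_T_const\<close>. Thus a nontrivial action moves X.\<close>

lemma X_const:
  assumes "degree X = 0"
  shows "degree Z = 0 \<and> degree T = 0"
proof -
  have "(Z ^ q1 + T ^ s1) ^ P = - (X ^ m * Y)" using rel by (simp add: eq_neg_iff_add_eq_0 add.commute)
  moreover have "degree (X ^ m * Y) = 0" using assms nz Y_nz by (simp add: degree_mult_eq degree_power_eq Y0)
  ultimately have "degree ((Z ^ q1 + T ^ s1) ^ P) = 0" by simp
  then have d: "degree (Z ^ q1 + T ^ s1) = 0" by (rule degree_power_0) (use char in simp)
  then have "degree (Z ^ q1 - [:C0 (-1):] * T ^ s1) = 0" by (simp add: single_uminus)
  then have T: "degree T = 0" by (rule line_imp_T_const[rotated]) simp
  then have "degree (T ^ s1) = 0" by (simp add: degree_power_eq nz)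
  then have "degree (Z ^ q1) = 0" using d degree_diff_le_max[of "Z ^ q1 + T ^ s1" "T ^ s1"] by simp
  then show ?thesis using T char(2) degree_power_0[of Z q1] by simp
qed

text \<open>Up to scalars X^m is the P-th power of G = Z^q1 + T^s1, so G is an m-th power H^m. Then
  H^(m - 1) divides the derivative of G, in which the p-th power Z^q1 leaves no trace.\<close>

lemma root_dvd:
  assumes cop: "coprime m P" and G0: "Z ^ q1 + T ^ s1 \<noteq> 0"
  shows "\<exists>H c e. c \<noteq> 0 \<and> e \<noteq> 0 \<and> smult c (Z ^ q1 + T ^ s1) = smult e (H ^ m) \<and>
    H ^ (m - 1) dvd smult (c * c) (smult (of_nat s1) (T ^ (s1 - 1) * \<Theta> T))"
proof -
  define G where "G = Z ^ q1 + T ^ s1"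
  have "smult (coeff Y 0) (X ^ m) = X ^ m * Y" by (subst (2) Y0) (simp add: Y0)
  also have "\<dots> = smult (- 1) (G ^ P)" using rel by (simp add: G_def eq_neg_iff_add_eq_0)
  finally obtain c e H where c: "c \<noteq> 0" "e \<noteq> 0" "smult c G = smult e (H ^ m)"
    using coprime_power_root[of X G "coeff Y 0" "- 1" m P] nz(1) G0 Y_nz cop m Y0 by (auto simp: G_def)
  have \<Theta>s: "\<Theta> (smult a f) = smult (\<theta> a) f + smult a (\<Theta> f)" for a f
    using derivationD(2)[OF derivation_\<Theta>, of "[:a:]" f] derivationD(3)[OF derivation_\<theta>] by (simp add: map_poly_pCons)
  obtain k where k: "m = Suc k" using m by (cases m) auto
  \<comment> \<open>A quotient rule without denominators: \<open>c\<close> is a Laurent polynomial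
    that \<open>\<theta>\<close> need not kill, and a second factor \<open>c\<close> absorbs its
    derivative.\<close>
  have "smult (c * c) (\<Theta> G) = smult c (\<Theta> (smult c G)) - smult (\<theta> c) (smult c G)"
    by (simp add: \<Theta>s smult_add_right mult.commute)
  also have "\<dots> = H ^ k * (smult (c * \<theta> e) H + smult (c * e) (of_nat (Suc k) * \<Theta> H) - smult (\<theta> c * e) H)"
    unfolding c(3) \<Theta>s k derivationD(8)[OF derivation_\<Theta>] by (simp add: algebra_simps smult_add_right smult_diff_right)
  finally have "H ^ k dvd smult (c * c) (\<Theta> G)" by simp
  moreover have "\<Theta> G = smult (of_nat s1) (T ^ (s1 - 1) * \<Theta> T)"
    by (simp add: G_def derivationD(1)[OF derivation_\<Theta>] \<Theta>_q1 \<Theta>_s1)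
  ultimately show ?thesis using c k by (auto simp: G_def)
qed

lemma coprime_of_eq: "m * j' + 1 = j * N \<Longrightarrow> coprime m N"
proof -
  assume e: "m * j' + 1 = j * N"
  show ?thesis
  proof (rule coprimeI)
    fix g assume "g dvd m" "g dvd N"
    then have "g dvd m * j'" "g dvd m * j' + 1" using e by (auto simp: dvd_mult)
    then show "is_unit g" using dvd_add_right_iff[of g "m * j'" 1] by simp
  qed
qed

lemma x_homog_Y: "x_homog (- int m) (coeff Y 0)"
proof -
  have "x_homog 0 (mon (0, 1, 0) ^ q1 + mon (0, 0, 1) ^ s1 :: 'a laur)"
    unfolding mon_power by (intro x_homog_add x_homog_single) auto
  then have "x_homog (int P * 0) ((mon (0, 1, 0) ^ q1 + mon (0, 0, 1) ^ s1) ^ P :: 'a laur)"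
    by (rule x_homog_power)
  then have "x_homog (- int m + int P * 0) (- mon (- int m, 0, 0) * (mon (0, 1, 0) ^ q1 + mon (0, 0, 1) ^ s1) ^ P :: 'a laur)"
    by (intro x_homog_mult x_homog_uminus x_homog_single) auto
  then show ?thesis unfolding Y0 by simp
qed

lemma good_x_homog:
  assumes "x_exp m n = 0" "x_homog 0 (coeff (form_at I c Z T) 0)"
  shows "x_homog (int (y_exp m n) * - int m) (coeff (X ^ x_exp m n * Y ^ y_exp m n * form_at I c Z T) 0)"
proof -
  have "coeff (X ^ x_exp m n * Y ^ y_exp m n * form_at I c Z T) 0 = coeff Y 0 ^ y_exp m n * coeff (form_at I c Z T) 0"
    using assms(1) by (simp add: coeff_mult_0 coeff_0_power)
  then show ?thesis using x_homog_mult[OF x_homog_power[OF x_homog_Y] assms(2)] by simp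
qed

text \<open>The constant term in the parameter recovers the leading form itself.\<close>

definition good_value :: "int \<Rightarrow> (nat \<times> nat) set \<Rightarrow> (nat \<times> nat \<Rightarrow> 'a) \<Rightarrow> 'a laur" where
  "good_value n I c = coeff (X ^ x_exp m n * Y ^ y_exp m n * form_at I c Z T) 0"

text \<open>X is moved and hence cannot divide an invariant form, so the x-degree comes from Y alone
  and is a multiple of m.\<close>

lemma lead_x_homog:
  assumes X: "degree X > 0" and ZT: "degree Z = 0 \<and> degree T > 0 \<or> degree T = 0 \<and> degree Z > 0"
    and g: "good n I c"
  shows "x_homog (int (y_exp m n) * - int m) (good_value n I c)"
  unfolding good_value_def
proof (rule good_x_homog)
  show "x_exp m n = 0" using goodD(7)[OF g] X by auto
  obtain a b where "I = {(a, b)}" using ZT good_Z_const[OF g] good_T_const[OF g] by blast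
  then have "coeff (form_at I c Z T) 0 = C0 (c (a, b)) * mon (0, 1, 0) ^ a * mon (0, 0, 1) ^ b"
    by (simp add: form_at_def coeff_mult_0 coeff_0_power Z0 T0 mult.assoc)
  also have "x_homog (0 + 0 + 0) \<dots>"
    unfolding mon_power by (intro x_homog_mult x_homog_single) (auto simp: zero_prod_def)
  finally show "x_homog 0 (coeff (form_at I c Z T) 0)" by simp
qed

text \<open>In X^m Y = -(Z^q1 + T^s1)^P, compare the x-degrees of the leading coefficients in the
  parameter and divide by -m. The result is a Bezout relation that makes m prime to N and P.\<close>

lemma exponent_eq:
  assumes "x_homog (int j1 * - int m) (lead_coeff V)" "x_homog (int j2 * - int m) (lead_coeff X)"
    and V: "V \<noteq> 0" "lead_coeff (Z ^ q1 + T ^ s1) = lead_coeff V ^ N"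
  shows "m * j2 + 1 = j1 * (N * P)"
proof -
  have "X ^ m * Y = - ((Z ^ q1 + T ^ s1) ^ P)" using rel by (simp add: eq_neg_iff_add_eq_0)
  then have "lead_coeff (X ^ m * Y) = lead_coeff (- ((Z ^ q1 + T ^ s1) ^ P))" by simp
  moreover have "lead_coeff Y = coeff Y 0" by (simp add: Y0)
  ultimately have e: "lead_coeff X ^ m * coeff Y 0 = - ((lead_coeff V ^ N) ^ P)"
    unfolding lead_coeff_mult lead_coeff_minus lead_coeff_power V(2) by simp
  have "x_homog (int m * (int j2 * - int m) + - int m) (lead_coeff X ^ m * coeff Y 0)"
    by (intro x_homog_mult x_homog_power x_homog_Y assms)
  moreover have "x_homog (int P * (int N * (int j1 * - int m))) (- ((lead_coeff V ^ N) ^ P))"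
    by (intro x_homog_uminus x_homog_power assms)
  moreover have "lead_coeff X ^ m * coeff Y 0 \<noteq> 0" unfolding e using V(1) by simp
  ultimately have "int m * (int j2 * - int m) + - int m = int P * (int N * (int j1 * - int m))"
    unfolding e by (rule x_homog_unique)
  then have "int m * (int m * int j2 + 1) = int m * (int j1 * (int N * int P))" by (simp add: algebra_simps)
  then have "int m * int j2 + 1 = int j1 * (int N * int P)" using m by simp
  then have "int (m * j2 + 1) = int (j1 * (N * P))" by simp
  then show ?thesis by (simp only: of_nat_eq_iff)
qed

lemma lead_coeff_power_add:
  fixes f g :: "'a laur poly"
  assumes "degree f = 0" "degree g > 0" "N > 0"
  shows "lead_coeff (f ^ M + g ^ N) = lead_coeff g ^ N" "degree (f ^ M + g ^ N) = N * degree g"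
proof -
  have "degree (f ^ M) = 0" using assms(1) degree_power_le[of f M] by simp
  moreover have "degree (g ^ N) = N * degree g" using assms(2) by (subst degree_power_eq) auto
  moreover have "N * degree g > 0" using assms by simp
  ultimately have lt: "degree (f ^ M) < degree (g ^ N)" by simp
  show "lead_coeff (f ^ M + g ^ N) = lead_coeff g ^ N"
    using lead_coeff_add_le[OF lt] unfolding lead_coeff_power .
  show "degree (f ^ M + g ^ N) = N * degree g"
    using degree_add_eq_right[OF lt] \<open>degree (g ^ N) = N * degree g\<close> by simp
qed

text \<open>\<open>good2\<close> yields an invariant form that is no scalar multiple of a power of
  Y, whence Z or T is fixed; \<open>lead\<close> feeds the leading coefficients into
  \<open>exponent_eq\<close>.\<close>

theorem no_graded_action:
  assumes nontriv: "degree X > 0 \<or> degree Z > 0 \<or> degree T > 0"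
    and good2: "degree X > 0 \<Longrightarrow> \<exists>n I c. good n I c \<and> \<not> (x_exp m n = 0 \<and> I = {(0, 0)})"
    and lead: "\<And>g. g \<in> {X, Z, T} \<Longrightarrow> \<exists>n I c. good n I c \<and> lead_coeff g = good_value n I c"
  shows False
proof -
  have dX: "degree X > 0" using nontriv X_const by (metis gr0I)
  obtain n I c where g: "good n I c" "\<not> (x_exp m n = 0 \<and> I = {(0, 0)})" using good2[OF dX] by blast
  have "x_exp m n = 0" using goodD(7)[OF g(1)] dX by auto
  then have "I \<noteq> {(0, 0)}" using g(2) by simp
  note G = goodD[OF g(1)]
  obtain \<omega> where w: "\<And>a b. (a, b) \<in> I \<Longrightarrow> s1 * a + q1 * b = \<omega>" using G(4) by auto
  have or: "degree Z = 0 \<or> degree T = 0"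
    using weighted_form_const[OF G(1,2) \<open>I \<noteq> {(0, 0)}\<close> w G(5,6)] .
  have nb: "\<not> (degree Z = 0 \<and> degree T = 0)"
  proof
    assume z: "degree Z = 0 \<and> degree T = 0"
    have "degree (Z ^ q1) = 0" "degree (T ^ s1) = 0" using z nz by (simp_all add: degree_power_eq)
    then have "degree (Z ^ q1 + T ^ s1) = 0" using degree_add_le_max[of "Z ^ q1" "T ^ s1"] by simp
    then have "degree ((Z ^ q1 + T ^ s1) ^ P) = 0" using degree_power_le[of "Z ^ q1 + T ^ s1" P] by simp
    moreover have "X ^ m * Y = - ((Z ^ q1 + T ^ s1) ^ P)" using rel by (simp add: eq_neg_iff_add_eq_0)
    ultimately have "degree (X ^ m * Y) = 0" by simp
    then have "degree (X ^ m) = 0" by (rule degree_0_factor) (use nz Y_nz in simp)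
    then have "degree X = 0" by (rule degree_power_0) (use m in simp)
    then show False using dX by simp
  qed
  have ZT: "degree Z = 0 \<and> degree T > 0 \<or> degree T = 0 \<and> degree Z > 0" using or nb by auto
  have lx: "\<exists>j. x_homog (int j * - int m) (lead_coeff g)" if "g \<in> {X, Z, T}" for g
    using lead[OF that] lead_x_homog[OF dX ZT] by metis
  obtain j2 where j2: "x_homog (int j2 * - int m) (lead_coeff X)" using lx[of X] by blast
  define G where "G = Z ^ q1 + T ^ s1"
  from ZT show False
  proof
    assume c: "degree Z = 0 \<and> degree T > 0"
    obtain j1 where j1: "x_homog (int j1 * - int m) (lead_coeff T)" using lx[of T] by blast
    have dG: "lead_coeff G = lead_coeff T ^ s1" "degree G = s1 * degree T"
      using lead_coeff_power_add[of Z T s1 q1] c s1(1) by (auto simp: G_def)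
    have cop: "coprime m (s1 * P)"
      using coprime_of_eq[OF exponent_eq[OF j1 j2 nz(3), of s1]] dG(1) by (auto simp: G_def)
    then have cP: "coprime m P" "coprime m s1" by auto
    have "degree G > 0" using dG(2) c s1(1) by simp
    then have G0: "G \<noteq> 0" by auto
    obtain H a b where H: "a \<noteq> 0" "b \<noteq> 0" "smult a G = smult b (H ^ m)"
        "H ^ (m - 1) dvd smult (a * a) (smult (of_nat s1) (T ^ (s1 - 1) * \<Theta> T))"
      using root_dvd[OF cP(1)] G0 by (auto simp: G_def)
    have Hnz: "H \<noteq> 0"
    proof
      assume "H = 0"
      then have "smult a G = 0" using H(3) m by (simp add: power_0_left)
      then show False using H(1) G0 by simp
    qed
    have "degree (smult a G) = degree (smult b (H ^ m))" using H(3) by simp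
    then have dH: "s1 * degree T = m * degree H" using H(1,2) dG(2) Hnz by (simp add: degree_power_eq)
    have Ts: "T ^ s1 = T * T ^ (s1 - 1)" using s1(1) by (cases s1) auto
    \<comment> \<open>Multiplying by T and subtracting from a multiple of G trades T^(s1 - 1) for
      Z^q1, which has degree 0. The bound on the degree of H^(m - 1) improves from s1 * degree T to
      degree T.\<close>
    have "H ^ (m - 1) dvd T * smult (a * a) (smult (of_nat s1) (T ^ (s1 - 1) * \<Theta> T))"
      using H(4) by (rule dvd_mult)
    also have "\<dots> = smult (a * a * of_nat s1) (T ^ s1 * \<Theta> T)" by (simp add: Ts algebra_simps)
    finally have 1: "H ^ (m - 1) dvd smult (a * a * of_nat s1) (T ^ s1 * \<Theta> T)" .
    have "H ^ (m - 1) dvd smult a G" unfolding H(3) using m by (intro dvd_smult le_imp_power_dvd) simp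
    then have "H ^ (m - 1) dvd smult (a * of_nat s1) (\<Theta> T) * smult a G" by (rule dvd_mult)
    also have "\<dots> = smult (a * a * of_nat s1) (G * \<Theta> T)" by (simp add: mult_ac)
    finally have "H ^ (m - 1) dvd smult (a * a * of_nat s1) (G * \<Theta> T) - smult (a * a * of_nat s1) (T ^ s1 * \<Theta> T)"
      using 1 by (rule dvd_diff)
    also have "\<dots> = smult (a * a * of_nat s1) (Z ^ q1 * \<Theta> T)"
      by (simp add: G_def algebra_simps smult_add_right)
    finally have dv: "H ^ (m - 1) dvd smult (a * a * of_nat s1) (Z ^ q1 * \<Theta> T)" .
    have "smult (a * a * of_nat s1) (Z ^ q1 * \<Theta> T) \<noteq> 0" using H(1) s1_nz nz \<Theta>T by simp
    then have "degree (H ^ (m - 1)) \<le> degree (smult (a * a * of_nat s1) (Z ^ q1 * \<Theta> T))"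
      by (rule dvd_imp_degree_le[OF dv])
    also have "\<dots> \<le> degree (Z ^ q1 * \<Theta> T)" by (rule degree_smult_le)
    also have "\<dots> \<le> degree T"
      using degree_mult_le[of "Z ^ q1" "\<Theta> T"] degree_power_le[of Z q1] c deg_\<Theta>[of T] by simp
    finally have le: "(m - 1) * degree H \<le> degree T" using Hnz by (simp add: degree_power_eq)
    have H0: "degree H > 0" using dH c s1(1) by (cases "degree H") auto
    obtain k where k: "m = Suc (Suc k)" using m by (metis add_2_eq_Suc le_Suc_ex)
    obtain l where l: "s1 = Suc (Suc l)" using s1(1) by (metis add_2_eq_Suc le_Suc_ex)
    \<comment> \<open>Since s1 * degree T = m * degree H, the bound becomes (m - 1) * s1 <= m. This
      forces m = s1 = 2, against coprimality.\<close>
    have "(k + 1) * degree H * (l + 2) \<le> (k + 2) * degree H"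
      using mult_le_mono1[OF le, of "l + 2"] dH by (simp add: k l algebra_simps)
    then have "((k + 1) * (l + 2)) * degree H \<le> (k + 2) * degree H" by (simp only: mult_ac)
    then have "(k + 1) * (l + 2) \<le> k + 2" using H0 by (simp only: mult_le_cancel2) 
    then have "k = 0" "l = 0" by (auto simp: algebra_simps)
    then show False using cP(2) by (simp add: k l)
  next
    \<comment> \<open>Now the multiple of H^(m - 1) from \<open>root_dvd\<close> already has degree
      0, so H and with it G would be constant.\<close>
    assume c: "degree T = 0 \<and> degree Z > 0"
    obtain j1 where j1: "x_homog (int j1 * - int m) (lead_coeff Z)" using lx[of Z] by blast
    have dG: "lead_coeff G = lead_coeff Z ^ q1" "degree G = q1 * degree Z"
    proof -
      have GG: "G = T ^ s1 + Z ^ q1" and q: "q1 > 0" using char(2) by (simp_all add: G_def add.commute)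
      note D = lead_coeff_power_add[OF conjunct1[OF c] conjunct2[OF c] q, of s1]
      show "lead_coeff G = lead_coeff Z ^ q1" "degree G = q1 * degree Z"
        unfolding GG by (rule D)+
    qed
    have cop: "coprime m (q1 * P)"
      using coprime_of_eq[OF exponent_eq[OF j1 j2 nz(2), of q1]] dG(1) by (auto simp: G_def)
    then have cP: "coprime m P" by auto
    have dG0: "degree G > 0" using dG(2) c char(2) by simp
    then have G0: "G \<noteq> 0" by auto
    obtain H a b where H: "a \<noteq> 0" "b \<noteq> 0" "smult a G = smult b (H ^ m)"
        "H ^ (m - 1) dvd smult (a * a) (smult (of_nat s1) (T ^ (s1 - 1) * \<Theta> T))"
      using root_dvd[OF cP(1)] G0 by (auto simp: G_def)
    let ?r = "smult (a * a) (smult (of_nat s1) (T ^ (s1 - 1) * \<Theta> T))"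
    have "?r \<noteq> 0" using H(1) s1_nz nz \<Theta>T by simp
    then have "degree (H ^ (m - 1)) \<le> degree ?r" by (rule dvd_imp_degree_le[OF H(4)])
    also have "\<dots> \<le> degree (T ^ (s1 - 1) * \<Theta> T)" by (meson degree_smult_le le_trans)
    also have "\<dots> = 0"
      using degree_mult_le[of "T ^ (s1 - 1)" "\<Theta> T"] degree_power_le[of T "s1 - 1"] c deg_\<Theta>[of T] by simp
    finally have "degree (H ^ (m - 1)) = 0" by simp
    then have "degree H = 0" by (rule degree_power_0) (use m in simp)
    then have "degree (smult b (H ^ m)) = 0"
      using degree_power_le[of H m] degree_smult_le[of b "H ^ m"] by simp
    then have "degree (smult a G) = 0" using H(3) by simp
    then show False using H(1) dG0 by simp
  qed
qed

end

section \<open>The Laurent model\<close>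

lemma lookup_C0_mult:
  "Poly_Mapping.lookup (C0 c * (f :: 'g::ab_group_add \<Rightarrow>\<^sub>0 'a::comm_ring_1)) g = c * Poly_Mapping.lookup f g"
proof -
  have "C0 c * f = Poly_Mapping.map ((*) c) f" by (simp add: mult_map_scale_conv_mult)
  also have "Poly_Mapping.lookup \<dots> g = c * Poly_Mapping.lookup f g"
    by transfer (simp add: when_def)
  finally show ?thesis .
qed

lemma homog_part_C0_mult: "homog_part v k (C0 c * (f :: 'g::ab_group_add \<Rightarrow>\<^sub>0 'a::comm_ring_1)) = C0 c * homog_part v k f"
  by (rule poly_mapping_eqI) (simp add: lookup_homog_part lookup_C0_mult)

text \<open>The cut-off in \<open>x_exp\<close> never takes effect: the remainder of m - 1 - n
  modulo m is at most m - 1.\<close>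

lemma x_exp_y_exp:
  assumes "m > 0"
  shows "int (x_exp m n) = n + int m * int (y_exp m n)"
proof -
  have "0 \<le> n + int m * int (y_exp m n)"
  proof (cases "(int m - 1 - n) div int m \<ge> 0")
    case True
    have "int m * ((int m - 1 - n) div int m) = (int m - 1 - n) - (int m - 1 - n) mod int m"
      by (simp add: minus_mod_eq_mult_div)
    moreover have "(int m - 1 - n) mod int m \<le> int m - 1" using assms by (simp add: zle_diff1_eq)
    ultimately show ?thesis using True by (simp add: y_exp_def)
  next
    case False
    then have "int m - 1 - n < 0" using assms by (simp add: pos_imp_zdiv_nonneg_iff)
    then have "n \<ge> 0" using assms by simp
    then show ?thesis by simp
  qed
  then show ?thesis by (simp add: x_exp_def)
qed

text \<open>A copy of A inside an arbitrary domain, to be instantiated with k[U, V, W].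
  \<open>gen\<close> says that x, y, z, t generate over k, as an induction principle; injectivity of
  \<open>\<iota>\<close> is derived from normal forms in \<open>\<iota>_inj\<close>.\<close>

locale laurent_model =
  fixes p m d r s1 :: nat and K :: "'a::field \<Rightarrow> 'b::idom" and x y z t :: 'b and \<iota> :: "'b \<Rightarrow> 'a laur"
  assumes char: "CHAR('a) = p" "p > 0"
    and m: "m \<ge> 2" and r: "r > 0" and s1: "s1 \<ge> 2" "\<not> p dvd s1"
    and K: "unital_hom K" and \<iota>: "unital_hom \<iota>"
    and \<iota>K: "\<iota> (K c) = C0 c" and \<iota>x: "\<iota> x = mon (1, 0, 0)"
    and \<iota>z: "\<iota> z = mon (0, 1, 0)" and \<iota>t: "\<iota> t = mon (0, 0, 1)"
    and \<iota>y: "\<iota> y = - mon (- int m, 0, 0) *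
      (mon (0, 1, 0) ^ (p ^ r * p ^ d) + mon (0, 0, 1) + mon (0, 0, 1) ^ (s1 * p ^ d))"
    and rel: "x ^ m * y + z ^ (p ^ r * p ^ d) + t + t ^ (s1 * p ^ d) = 0"
    and gen: "\<And>S a. (\<And>c. K c \<in> S) \<Longrightarrow> (\<And>a b. a \<in> S \<Longrightarrow> b \<in> S \<Longrightarrow> a + b \<in> S) \<Longrightarrow>
      (\<And>a b. a \<in> S \<Longrightarrow> b \<in> S \<Longrightarrow> a * b \<in> S) \<Longrightarrow> x \<in> S \<Longrightarrow> y \<in> S \<Longrightarrow> z \<in> S \<Longrightarrow> t \<in> S \<Longrightarrow> a \<in> S"
begin

abbreviation "q1 \<equiv> p ^ r"
abbreviation "P \<equiv> p ^ d"

text \<open>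
  Since \<open>x ^ m * y\<close> is a polynomial in \<open>z, t\<close>, it suffices to use \<open>y\<close> just often enough to reach $x$-degree \<open>n\<close>.
\<close>

definition E :: "int \<times> nat \<times> nat \<Rightarrow> 'b" where
  "E e = x ^ x_exp m (fst e) * y ^ y_exp m (fst e) * z ^ fst (snd e) * t ^ snd (snd e)"

section \<open>Normal forms\<close>

inductive_set NF :: "'b set" where
  zero: "0 \<in> NF"
| add: "a \<in> NF \<Longrightarrow> K c * E e + a \<in> NF"

lemma NF_add: "a \<in> NF \<Longrightarrow> b \<in> NF \<Longrightarrow> a + b \<in> NF"
  by (induction rule: NF.induct) (auto simp: add.assoc intro: NF.add)

lemma NF_E: "K c * E e \<in> NF"
  using NF.add[OF NF.zero, of c e] by simp

lemma NF_E1: "E e \<in> NF"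
  using NF_E[of 1 e] unital_homD(3)[OF K] by simp

lemma NF_K: "a \<in> NF \<Longrightarrow> K c * a \<in> NF"
proof (induction rule: NF.induct)
  case (add a c' e)
  have "K c * (K c' * E e + a) = K (c * c') * E e + K c * a" by (simp add: unital_homD(2)[OF K] algebra_simps)
  then show ?case using add NF.add by simp
qed (simp add: NF.zero)

lemma NF_uminus: "a \<in> NF \<Longrightarrow> - a \<in> NF"
  using NF_K[of a "- 1"] unital_homD(3,5)[OF K] by simp

lemma NF_multI:
  assumes "\<And>e. b * E e \<in> NF" "a \<in> NF"
  shows "b * a \<in> NF"
  using assms(2)
proof (induction rule: NF.induct)
  case (add a c e)
  have "b * (K c * E e + a) = K c * (b * E e) + b * a" by (simp add: algebra_simps)
  then show ?case using add NF_add NF_K assms(1) by simp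
qed (simp add: NF.zero)

lemma NF_z: "z * E e \<in> NF"
proof -
  have "z * E e = E (fst e, Suc (fst (snd e)), snd (snd e))" by (simp add: E_def mult_ac)
  then show ?thesis by (metis NF_E1)
qed

lemma NF_t: "t * E e \<in> NF"
proof -
  have "t * E e = E (fst e, fst (snd e), Suc (snd (snd e)))" by (simp add: E_def mult_ac)
  then show ?thesis by (metis NF_E1)
qed

lemma NF_zt_pow: "a \<in> NF \<Longrightarrow> z ^ i * a \<in> NF" "a \<in> NF \<Longrightarrow> t ^ i * a \<in> NF"
  by (induction i) (auto simp: mult.assoc intro: NF_multI NF_z NF_t)

text \<open>The relation turns x^m y into a polynomial in z and t, which only raise the exponents of
  a normal monomial.\<close>

lemma NF_F: "x ^ m * y * E e \<in> NF"
proof -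
  have "x ^ m * y = - (z ^ (q1 * P) + t + t ^ (s1 * P))" using rel by (simp only: eq_neg_iff_add_eq_0 add.assoc)
  then have "x ^ m * y * E e = - (z ^ (q1 * P) * E e + t * E e + t ^ (s1 * P) * E e)"
    by (simp only: distrib_right mult_minus_left)
  also have "\<dots> \<in> NF" by (intro NF_uminus NF_add NF_zt_pow NF_t NF_E1)
  finally show ?thesis .
qed

lemma m0: "m > 0" using m by simp

lemma NF_x: "x * E e \<in> NF"
proof -
  obtain n a b where e: "e = (n, a, b)" by (metis prod.collapse)
  have I: "int (x_exp m (n + 1)) = n + 1 + int m * int (y_exp m (n + 1))" "int (x_exp m n) = n + int m * int (y_exp m n)"
    using x_exp_y_exp[OF m0] by auto
  \<comment> \<open>Raising n by one keeps the exponent of y or lowers it by one; in the second case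
    the product contains x^m y.\<close>
  have "(int m - 1 - (n + 1)) div int m = (int m - 1 - n) div int m \<or> (int m - 1 - (n + 1)) div int m + 1 = (int m - 1 - n) div int m"
  proof -
    have le: "(int m - 1 - (n + 1)) div int m \<le> (int m - 1 - n) div int m" using m0 by (intro zdiv_mono1) auto
    have "(int m - 1 - n) div int m \<le> (int m - 1 - (n + 1) + int m) div int m" using m0 by (intro zdiv_mono1) auto
    also have "\<dots> = (int m - 1 - (n + 1)) div int m + 1" using m0 by (intro div_add_self2) simp
    finally show ?thesis using le by linarith
  qed
  then have "y_exp m (n + 1) = y_exp m n \<or> y_exp m n = y_exp m (n + 1) + 1" unfolding y_exp_def by linarith
  then show ?thesis
  proof
    assume j: "y_exp m (n + 1) = y_exp m n"
    then have "x_exp m (n + 1) = Suc (x_exp m n)" using I by simp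
    then have "x * E e = E (n + 1, a, b)" using j by (simp add: E_def e mult_ac)
    then show ?thesis using NF_E1 by simp
  next
    assume j: "y_exp m n = y_exp m (n + 1) + 1"
    have "int (Suc (x_exp m n)) = int (m + x_exp m (n + 1))" using I by (simp add: j algebra_simps)
    then have i: "Suc (x_exp m n) = m + x_exp m (n + 1)" by (simp only: of_nat_eq_iff)
    have "x * E e = x ^ Suc (x_exp m n) * y ^ y_exp m n * z ^ a * t ^ b" by (simp add: E_def e mult_ac)
    also have "\<dots> = x ^ m * y * E (n + 1, a, b)" unfolding i j by (simp add: E_def power_add mult_ac)
    finally show ?thesis using NF_F by simp
  qed
qed

lemma NF_y: "y * E e \<in> NF"
proof -
  obtain n a b where e: "e = (n, a, b)" by (metis prod.collapse)
  have I: "int (x_exp m (n - int m)) = n - int m + int m * int (y_exp m (n - int m))" "int (x_exp m n) = n + int m * int (y_exp m n)"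
    using x_exp_y_exp[OF m0] by auto
  have dv: "(int m - 1 - (n - int m)) div int m = (int m - 1 - n) div int m + 1"
  proof -
    have "int m - 1 - (n - int m) = int m - 1 - n + int m" by simp
    then show ?thesis using m0 by (simp only: div_add_self2)
  qed
  show ?thesis
  \<comment> \<open>The condition says n <= m - 1, and then one more y is a normal monomial.
    Otherwise x^n contains x^m.\<close>
  proof (cases "(int m - 1 - n) div int m \<ge> 0")
    case True
    then have j: "y_exp m (n - int m) = Suc (y_exp m n)" unfolding y_exp_def dv by simp
    then have "int (x_exp m (n - int m)) = int (x_exp m n)" using I by (simp add: algebra_simps)
    then have "x_exp m (n - int m) = x_exp m n" by simp
    then have "y * E e = E (n - int m, a, b)" using j by (simp add: E_def e mult_ac)
    then show ?thesis using NF_E1 by simp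
  next
    case False
    then have j: "y_exp m (n - int m) = 0" "y_exp m n = 0" unfolding y_exp_def dv by auto
    then have "int (x_exp m n) = int (m + x_exp m (n - int m))" using I by simp
    then have i: "x_exp m n = m + x_exp m (n - int m)" by (simp only: of_nat_eq_iff)
    have "y * E e = x ^ m * y * E (n - int m, a, b)" by (simp add: E_def e i j power_add mult_ac)
    then show ?thesis by (simp only: NF_F)
  qed
qed

text \<open>The elements that multiply \<open>NF\<close> into itself form a subalgebra containing
  the generators; apply each of them to 1.\<close>

lemma NF_UNIV: "a \<in> NF"
proof -
  have "a \<in> {a. \<forall>b\<in>NF. a * b \<in> NF}"
    by (rule gen) (auto simp: NF_K distrib_right NF_add mult.assoc intro: NF_multI NF_x NF_y NF_z NF_t)
  then have "\<forall>b\<in>NF. a * b \<in> NF" by simp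
  moreover have "E (0, 0, 0) = 1" using m by (simp add: E_def x_exp_def y_exp_def)
  then have "1 \<in> NF" using NF_E1[of "(0, 0, 0)"] by simp
  ultimately have "a * 1 \<in> NF" by blast
  then show ?thesis by simp
qed

lemma normal_form: "\<exists>I c. finite I \<and> (\<forall>e\<in>I. c e \<noteq> 0) \<and> a = (\<Sum>e\<in>I. K (c e) * E e)"
proof -
  have "\<exists>I c. finite I \<and> a = (\<Sum>e\<in>I. K (c e) * E e)"
    using NF_UNIV[of a]
  proof (induction rule: NF.induct)
    case zero
    show ?case by (intro exI[of _ "{}"]) auto
  next
    case (add a c e)
    then obtain I f where If: "finite I" "a = (\<Sum>e\<in>I. K (f e) * E e)" by blast
    show ?case
    proof (cases "e \<in> I")
      case True
      have "K c * E e + a = (\<Sum>e'\<in>I. K ((f(e := f e + c)) e') * E e')"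
        using If True by (simp add: sum.remove[of I e] unital_homD(1)[OF K] algebra_simps)
      then show ?thesis using If(1) by blast
    next
      case False
      have "K c * E e + a = (\<Sum>e'\<in>insert e I. K ((f(e := c)) e') * E e')"
      proof -
        have "(\<Sum>e'\<in>I. K ((f(e := c)) e') * E e') = a" unfolding If(2) using False by (intro sum.cong) auto
        then show ?thesis using If(1) False by simp
      qed
      then show ?thesis using If(1) by blast
    qed
  qed
  then obtain I c where Ic: "finite I" "a = (\<Sum>e\<in>I. K (c e) * E e)" by blast
  have "a = (\<Sum>e\<in>{e\<in>I. c e \<noteq> 0}. K (c e) * E e)"
    unfolding Ic(2) using Ic(1) unital_homD(4)[OF K] by (intro sum.mono_neutral_right) auto
  then show ?thesis using Ic(1) by (intro exI[of _ "{e\<in>I. c e \<noteq> 0}"] exI[of _ c]) auto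
qed

text \<open>The (z, t)-weight with s1 for z and q1 for t. Then z^(q1 P) and t^(s1 P) both weigh s1 *
  q1 * P, which is what y contributes.\<close>

definition \<omega>0 :: "int \<times> nat \<times> nat \<Rightarrow> nat" where
  "\<omega>0 e = y_exp m (fst e) * (s1 * q1 * P) + s1 * fst (snd e) + q1 * snd (snd e)"

lemma x_homog_\<iota>y: "x_homog (- int m) (\<iota> y)"
proof -
  have "x_homog (- int m + 0) (\<iota> y)"
    unfolding \<iota>y mon_power by (intro x_homog_mult x_homog_add x_homog_uminus x_homog_single) auto
  then show ?thesis by simp
qed

lemma x_homog_\<iota>E: "x_homog (fst e) (\<iota> (E e))"
proof -
  have "x_homog (int (x_exp m (fst e)) * 1 + int (y_exp m (fst e)) * - int m + int (fst (snd e)) * 0 + int (snd (snd e)) * 0) (\<iota> (E e))"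
    unfolding E_def unital_homD(2,7)[OF \<iota>] by (intro x_homog_mult x_homog_power x_homog_\<iota>y; simp add: \<iota>x \<iota>z \<iota>t x_homog_single)
  then show ?thesis using x_exp_y_exp[OF m0, of "fst e"] by simp
qed

end

text \<open>
  With an irrational weight for \<open>x\<close>, the real weight of a monomial determines both its $x$-degree and its weight in \<open>z, t\<close>.
\<close>

locale weighted_model = laurent_model p m d r s1 K x y z t \<iota>
  for p m d r s1 and K :: "'a::field \<Rightarrow> 'b::idom" and x y z t \<iota> +
  fixes N :: real
  assumes N_irr: "\<And>a b. of_int a * N = of_int b \<Longrightarrow> a = 0"
    and N_pos: "N > 0"
begin

section \<open>Weights and leading forms of normal monomials\<close>

definition w :: "int \<times> int \<times> int \<Rightarrow> real" where
  "w g = - N * of_int (fst g) + real s1 * of_int (fst (snd g)) + real q1 * of_int (snd (snd g))"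

sublocale additive_weight w
  by standard (simp add: w_def algebra_simps)

lemma multiple_real: "multiple n (c::real) = real n * c"
  by (induction n) (auto simp: multiple_simps algebra_simps)

lemma w_simps [simp]: "w (1, 0, 0) = - N" "w (0, 1, 0) = s1" "w (0, 0, 1) = q1"
  by (auto simp: w_def)

definition wy :: real where "wy = N * m + s1 * q1 * P"
definition y0 :: "'a laur" where
  "y0 = - mon (- int m, 0, 0) * (mon (0, 1, 0) ^ q1 + mon (0, 0, 1) ^ s1) ^ P"
definition \<omega> :: "int \<times> nat \<times> nat \<Rightarrow> real" where "\<omega> e = - N * of_int (fst e) + real (\<omega>0 e)"

lemma \<omega>_alt: "\<omega> e = real (x_exp m (fst e)) * (- N) + real (y_exp m (fst e)) * wy + real (fst (snd e)) * s1 + real (snd (snd e)) * q1"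
proof -
  have "real (x_exp m (fst e)) = of_int (int (x_exp m (fst e)))" by simp
  also have "\<dots> = of_int (fst e) + real m * real (y_exp m (fst e))" unfolding x_exp_y_exp[OF m0] by simp
  finally show ?thesis by (simp add: \<omega>_def \<omega>0_def wy_def algebra_simps)
qed

lemma prime_p: "prime p"
  using char prime_CHAR_semidom[where ?'a = 'a] by simp

lemma CHAR_laur: "CHAR('a laur) = p"
proof (rule CHAR_eqI)
  have "(of_nat n :: 'a laur) = C0 (of_nat n)" for n by simp
  then have *: "(of_nat n :: 'a laur) = 0 \<longleftrightarrow> p dvd n" for n
    by (metis single_eq_0_iff of_nat_eq_0_iff_char_dvd char(1))
  show "of_nat p = (0 :: 'a laur)" using * by simp
  show "p dvd n" if "of_nat n = (0 :: 'a laur)" for n using that * by simp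
qed

lemma frob: "(a + b :: 'a laur) ^ P = a ^ P + b ^ P"
  using freshmans_dream'[where ?'a = "'a laur", of P d a b] prime_p CHAR_laur by simp

lemma q1_pos: "q1 > 0" "P > 0" using char by auto

lemma pow_z: "mon (0, 1, 0) ^ n = (mon (0, int n, 0) :: 'a laur)"
  and pow_t: "mon (0, 0, 1) ^ n = (mon (0, 0, int n) :: 'a laur)"
  and pow_x: "mon (1, 0, 0) ^ n = (mon (int n, 0, 0) :: 'a laur)"
  by (simp_all add: mon_power)

text \<open>As s1 >= 2, the linear term t of F weighs less than the other two terms, and these
  combine to a P-th power by Frobenius.\<close>

lemma y_top: "wt_le w wy (\<iota> y)" "homog_part w wy (\<iota> y) = y0"
proof -
  let ?F = "mon (0, int (q1 * P), 0) + mon (0, 0, 1) + mon (0, 0, int (s1 * P)) :: 'a laur"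
  have c: "real q1 < real s1 * (real q1 * real P)" "real q1 \<le> real s1 * (real q1 * real P)"
  proof -
    have "1 \<le> P" using char(2) by simp
    then have "2 * 1 \<le> s1 * P" by (rule mult_le_mono[OF s1(1)])
    then have "q1 * 2 \<le> q1 * (s1 * P)" by (intro mult_le_mono2) simp
    moreover have "q1 * (s1 * P) = s1 * (q1 * P)" by (simp only: mult_ac)
    moreover have "q1 < q1 * 2" using char(2) by simp
    ultimately have "q1 < s1 * (q1 * P)" by linarith
    then show "real q1 < real s1 * (real q1 * real P)" by (metis of_nat_less_iff of_nat_mult)
    then show "real q1 \<le> real s1 * (real q1 * real P)" by simp
  qed
  have wc: "w (0, int (q1 * P), 0) = real s1 * (real q1 * real P)" "w (0, 0, int (s1 * P)) = real s1 * (real q1 * real P)"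
    by (simp_all add: w_def)
  have b1: "wt_le w (real s1 * (real q1 * real P)) ?F"
    by (intro wt_le_add wt_le_single) (simp_all only: wc w_simps c order_refl)
  have h1: "homog_part w (real s1 * (real q1 * real P)) ?F = mon (0, int (q1 * P), 0) + mon (0, 0, int (s1 * P))"
  proof -
    have "real q1 \<noteq> real s1 * (real q1 * real P)" using c(1) by linarith
    then show ?thesis unfolding homog_part_add homog_part_single wc w_simps by (simp only: if_False if_True refl add_0_right)
  qed
  have b2: "wt_le w (N * m) (- mon (- int m, 0, 0) :: 'a laur)"
    by (intro wt_le_uminus wt_le_single) (simp add: w_def)
  have h2: "homog_part w (N * m) (- mon (- int m, 0, 0) :: 'a laur) = - mon (- int m, 0, 0)"
    by (simp add: homog_part_uminus homog_part_single w_def)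
  have \<iota>: "\<iota> y = - mon (- int m, 0, 0) * ?F" unfolding \<iota>y pow_z pow_t ..
  have wy: "wy = N * m + real s1 * (real q1 * real P)" by (simp add: wy_def)
  show "wt_le w wy (\<iota> y)" unfolding \<iota> wy by (rule wt_le_mult[OF b2 b1])
  have "homog_part w wy (\<iota> y) = - mon (- int m, 0, 0) * (mon (0, int (q1 * P), 0) + mon (0, 0, int (s1 * P)))"
    unfolding \<iota> wy homog_part_mult[OF b2 b1] h1 h2 ..
  also have "\<dots> = y0"
    unfolding y0_def frob unfolding power_mult[symmetric] unfolding pow_z pow_t ..
  finally show "homog_part w wy (\<iota> y) = y0" .
qed

lemma gen_top: "wt_le w (- N) (\<iota> x)" "homog_part w (- N) (\<iota> x) = mon (1, 0, 0)" "wt_le w s1 (\<iota> z)" "homog_part w s1 (\<iota> z) = mon (0, 1, 0)"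
   "wt_le w q1 (\<iota> t)" "homog_part w q1 (\<iota> t) = mon (0, 0, 1)"
  unfolding \<iota>x \<iota>z \<iota>t by (auto intro: wt_le_single simp: homog_part_single)

definition y1 :: "'a laur" where "y1 = - ((mon (0, 1, 0) ^ q1 + mon (0, 0, 1) ^ s1) ^ P)"

lemma y0_y1: "y0 = mon (- int m, 0, 0) * y1"
  by (simp add: y0_def y1_def)

lemma y1_nz: "y1 \<noteq> 0"
proof -
  have "Poly_Mapping.lookup (mon (0, 1, 0) ^ q1 + mon (0, 0, 1) ^ s1 :: 'a laur) (0, int q1, 0) = 1"
    unfolding pow_z pow_t using q1_pos s1(1) by (simp add: lookup_add lookup_single)
  then have "mon (0, 1, 0) ^ q1 + mon (0, 0, 1) ^ s1 \<noteq> (0 :: 'a laur)" by (metis lookup_zero zero_neq_one)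
  then show ?thesis by (simp add: y1_def)
qed

lemma E_wt_le: "wt_le w (\<omega> e) (\<iota> (E e))"
  and E_homog_part: "homog_part w (\<omega> e) (\<iota> (E e)) = mon (fst e, int (fst (snd e)), int (snd (snd e))) * y1 ^ y_exp m (fst e)"
proof -
  let ?i = "x_exp m (fst e)" and ?j = "y_exp m (fst e)" and ?a = "fst (snd e)" and ?b = "snd (snd e)"
  note bx = wt_le_power[OF gen_top(1), of ?i] and bby = wt_le_power[OF y_top(1), of ?j]
    and bz = wt_le_power[OF gen_top(3), of ?a] and bt = wt_le_power[OF gen_top(5), of ?b]
  note b2 = wt_le_mult[OF bx bby]
  note b3 = wt_le_mult[OF b2 bz]
  note b4 = wt_le_mult[OF b3 bt]
  have om: "\<omega> e = multiple ?i (- N) + multiple ?j wy + multiple ?a s1 + multiple ?b q1"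
    unfolding multiple_real \<omega>_alt ..
  show "wt_le w (\<omega> e) (\<iota> (E e))" unfolding om E_def unital_homD(2,7)[OF \<iota>] by (rule b4)
  have "homog_part w (\<omega> e) (\<iota> (E e)) = mon (1, 0, 0) ^ ?i * y0 ^ ?j * mon (0, 1, 0) ^ ?a * mon (0, 0, 1) ^ ?b"
    unfolding om E_def unital_homD(2,7)[OF \<iota>] homog_part_mult[OF b3 bt] homog_part_mult[OF b2 bz] homog_part_mult[OF bx bby]
      homog_part_power[OF gen_top(1)] homog_part_power[OF gen_top(3)] homog_part_power[OF gen_top(5)] homog_part_power[OF y_top(1)]
      gen_top y_top ..
  also have "\<dots> = mon (int ?i, 0, 0) * mon (- int m, 0, 0) ^ ?j * mon (0, int ?a, 0) * mon (0, 0, int ?b) * y1 ^ ?j"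
    unfolding pow_x pow_z pow_t y0_y1 power_mult_distrib by (simp only: mult_ac)
  also have "mon (- int m, 0, 0) ^ ?j = (mon (- int m * int ?j, 0, 0) :: 'a laur)"
    by (simp add: mon_power mult.commute)
  also have "mon (int ?i, 0, 0) * mon (- int m * int ?j, 0, 0) * mon (0, int ?a, 0) * mon (0, 0, int ?b) =
     (mon (fst e, int ?a, int ?b) :: 'a laur)"
    unfolding mon_mult using x_exp_y_exp[OF m0, of "fst e"] by simp
  finally show "homog_part w (\<omega> e) (\<iota> (E e)) = mon (fst e, int ?a, int ?b) * y1 ^ ?j" .
qed

lemma \<omega>_fst: "\<omega> e = \<omega> e' \<Longrightarrow> fst e = fst e' \<and> s1 * fst (snd e) + q1 * snd (snd e) = s1 * fst (snd e') + q1 * snd (snd e')"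
proof -
  assume e: "\<omega> e = \<omega> e'"
  then have "of_int (fst e - fst e') * N = of_int (int (\<omega>0 e) - int (\<omega>0 e'))"
    by (simp add: \<omega>_def algebra_simps)
  then have "fst e - fst e' = 0" by (rule N_irr)
  then have f: "fst e = fst e'" by simp
  then have "\<omega>0 e = \<omega>0 e'" using e by (simp add: \<omega>_def)
  then show ?thesis using f by (simp add: \<omega>0_def)
qed

text \<open>Normal monomials of maximal weight share their x-degree and so their power of y. After
  the common power of \<open>y1\<close> is factored out, distinct monomials remain, which cannot
  cancel.\<close>

lemma top_part:
  assumes I: "finite I" "I \<noteq> {}" "\<And>e. e \<in> I \<Longrightarrow> c e \<noteq> 0"
    and a: "a = (\<Sum>e\<in>I. K (c e) * E e)"
  defines "c0 \<equiv> Max (\<omega> ` I)"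
  shows "wt_le w c0 (\<iota> a)" "homog_part w c0 (\<iota> a) \<noteq> 0" "\<exists>e\<in>I. \<omega> e = c0" "\<And>e. e \<in> I \<Longrightarrow> \<omega> e \<le> c0"
proof -
  have "c0 \<in> \<omega> ` I" unfolding c0_def using I by (intro Max_in) auto
  then obtain e0 where e0: "e0 \<in> I" "\<omega> e0 = c0" by auto
  then show "\<exists>e\<in>I. \<omega> e = c0" by blast
  show le: "\<omega> e \<le> c0" if "e \<in> I" for e using that I(1) by (auto simp: c0_def)
  have \<iota>a: "\<iota> a = (\<Sum>e\<in>I. C0 (c e) * \<iota> (E e))" unfolding a by (simp add: unital_homD[OF \<iota>] \<iota>K)
  have b0: "wt_le w 0 (C0 k)" for k by (simp add: wt_le_single v_0)
  have "wt_le w c0 (C0 (c e) * \<iota> (E e))" if "e \<in> I" for e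
    using wt_le_mult[OF b0 wt_le_mono[OF E_wt_le le[OF that]]] by simp
  then show "wt_le w c0 (\<iota> a)" unfolding \<iota>a by (intro wt_le_sum)
  define I0 where "I0 = {e\<in>I. \<omega> e = c0}"
  have "homog_part w c0 (\<iota> a) = (\<Sum>e\<in>I. C0 (c e) * homog_part w c0 (\<iota> (E e)))"
    unfolding \<iota>a by (simp add: homog_part_sum homog_part_C0_mult)
  also have "\<dots> = (\<Sum>e\<in>I0. C0 (c e) * homog_part w c0 (\<iota> (E e)))"
  proof (intro sum.mono_neutral_right ballI)
    fix e assume "e \<in> I - I0"
    then have "\<omega> e < c0" using le[of e] by (auto simp: I0_def)
    then show "C0 (c e) * homog_part w c0 (\<iota> (E e)) = 0" using wt_le_homog_part_eq_0[OF E_wt_le] by simp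
  qed (auto simp: I0_def I)
  also have "\<dots> = (\<Sum>e\<in>I0. Poly_Mapping.single (fst e0, int (fst (snd e)), int (snd (snd e))) (c e)) * y1 ^ y_exp m (fst e0)"
    unfolding sum_distrib_right
  proof (intro sum.cong refl)
    fix e assume "e \<in> I0"
    then have "\<omega> e = \<omega> e0" "\<omega> e = c0" using e0 by (auto simp: I0_def)
    then have "homog_part w c0 (\<iota> (E e)) = mon (fst e0, int (fst (snd e)), int (snd (snd e))) * y1 ^ y_exp m (fst e0)"
      using E_homog_part[of e] \<omega>_fst[of e e0] by simp
    then show "C0 (c e) * homog_part w c0 (\<iota> (E e)) = Poly_Mapping.single (fst e0, int (fst (snd e)), int (snd (snd e))) (c e) * y1 ^ y_exp m (fst e0)"
      by (simp add: mult.assoc[symmetric] mult_single)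
  qed
  finally have H: "homog_part w c0 (\<iota> a) = (\<Sum>e\<in>I0. Poly_Mapping.single (fst e0, int (fst (snd e)), int (snd (snd e))) (c e)) * y1 ^ y_exp m (fst e0)" .
  have "Poly_Mapping.lookup (\<Sum>e\<in>I0. Poly_Mapping.single (fst e0, int (fst (snd e)), int (snd (snd e))) (c e)) (fst e0, int (fst (snd e0)), int (snd (snd e0)))
     = (\<Sum>e\<in>I0. if e = e0 then c e0 else 0)"
    unfolding lookup_sum
  proof (intro sum.cong refl)
    fix e assume "e \<in> I0"
    then have "fst e = fst e0" using e0 \<omega>_fst[of e e0] by (simp add: I0_def)
    then show "Poly_Mapping.lookup (Poly_Mapping.single (fst e0, int (fst (snd e)), int (snd (snd e))) (c e)) (fst e0, int (fst (snd e0)), int (snd (snd e0)))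
      = (if e = e0 then c e0 else 0)"
      by (cases e; cases e0) (auto simp: lookup_single when_def)
  qed
  also have "\<dots> = c e0" using e0 I(1) by (simp add: I0_def)
  finally have "(\<Sum>e\<in>I0. Poly_Mapping.single (fst e0, int (fst (snd e)), int (snd (snd e))) (c e)) \<noteq> 0"
    using I(3)[OF e0(1)] by auto
  then show "homog_part w c0 (\<iota> a) \<noteq> 0" unfolding H using y1_nz by simp
qed

lemma \<iota>_inj: "\<iota> a = 0 \<Longrightarrow> a = 0"
proof -
  assume z: "\<iota> a = 0"
  obtain I c where I: "finite I" "\<forall>e\<in>I. c e \<noteq> 0" "a = (\<Sum>e\<in>I. K (c e) * E e)" using normal_form by blast
  have "I = {}"
  proof (rule ccontr)
    assume "I \<noteq> {}"
    then have "homog_part w (Max (\<omega> ` I)) (\<iota> a) \<noteq> 0" using top_part(2)[OF I(1) _ _ I(3)] I(2) by blast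
    then show False using z by simp
  qed
  then show "a = 0" using I(3) by simp
qed

end

lemma homog_part_of_nat_mult: "homog_part v k f = 0 \<Longrightarrow> homog_part v k (of_nat n * (f :: 'g::ab_group_add \<Rightarrow>\<^sub>0 'a::comm_ring_1)) = 0"
  by (induction n) (auto simp: homog_part_add algebra_simps)

section \<open>Graded exponential maps\<close>

text \<open>An exponential map. \<open>coact\<close> is the coefficient form of the rule that
  applying it with parameter S and then with S' is applying it with S + S'.\<close>

locale action = weighted_model p m d r s1 K x y z t \<iota> N
  for p m d r s1 and K :: "'a::field \<Rightarrow> 'b::idom" and x y z t \<iota> N +
  fixes \<phi> :: "'b \<Rightarrow> 'b poly"
  assumes \<phi>: "unital_hom \<phi>" and \<phi>K: "\<phi> (K c) = [:K c:]" and \<phi>0: "coeff (\<phi> a) 0 = a"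
    and coact: "coeff (\<phi> (coeff (\<phi> a) i)) j = of_nat ((i + j) choose i) * coeff (\<phi> a) (i + j)"
begin

definition weighted_gens :: "('b \<times> real) set" where
  "weighted_gens = {(x, - N), (y, wy), (z, real s1), (t, real q1)}"

lemma weighted_gens_wt_le: "(g, c) \<in> weighted_gens \<Longrightarrow> wt_le w c (\<iota> g)"
  using gen_top y_top by (auto simp: weighted_gens_def)

text \<open>At 0 this is \<open>Max\<close> of the empty set, an unspecified value; as a bound it
  still holds vacuously.\<close>

definition top_weight :: "'b \<Rightarrow> real" where "top_weight a = Max (w ` Poly_Mapping.keys (\<iota> a))"

lemma top_weight: "wt_le w (top_weight a) (\<iota> a)"
  by (auto simp: wt_le_def top_weight_def)

lemma top_weight_homog_part:
  assumes "a \<noteq> 0"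
  shows "homog_part w (top_weight a) (\<iota> a) \<noteq> 0"
proof -
  have "Poly_Mapping.keys (\<iota> a) \<noteq> {}" using \<iota>_inj assms by auto
  then have "top_weight a \<in> w ` Poly_Mapping.keys (\<iota> a)" unfolding top_weight_def by (intro Max_in) auto
  then obtain k where k: "k \<in> Poly_Mapping.keys (\<iota> a)" "w k = top_weight a" by auto
  then have "Poly_Mapping.lookup (homog_part w (top_weight a) (\<iota> a)) k \<noteq> 0" by (simp add: lookup_homog_part in_keys_iff)
  then show ?thesis by auto
qed

lemma const_all:
  assumes "\<And>g c. (g, c) \<in> weighted_gens \<Longrightarrow> degree (\<phi> g) = 0"
  shows "degree (\<phi> a) = 0"
proof -
  have "a \<in> {a. degree (\<phi> a) = 0}"
  proof (rule gen)
    fix a b assume ab: "a \<in> {a. degree (\<phi> a) = 0}" "b \<in> {a. degree (\<phi> a) = 0}"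
    then show "a + b \<in> {a. degree (\<phi> a) = 0}"
      using degree_add_le_max[of "\<phi> a" "\<phi> b"] by (simp add: unital_homD(1)[OF \<phi>])
    show "a * b \<in> {a. degree (\<phi> a) = 0}"
      using ab degree_mult_le[of "\<phi> a" "\<phi> b"] by (simp add: unital_homD(2)[OF \<phi>])
  qed (use assms in \<open>auto simp: \<phi>K weighted_gens_def\<close>)
  then show ?thesis by simp
qed

text \<open>\<open>- \<mu>\<close> is the weight of the parameter that keeps the leading part of the exponential map nontrivial.\<close>

lemma ex_\<mu>:
  assumes "degree (\<phi> a) > 0"
  shows "\<exists>\<mu>. (\<forall>g c i. (g, c) \<in> weighted_gens \<longrightarrow> wt_le w (c + real i * \<mu>) (\<iota> (coeff (\<phi> g) i))) \<and>
    (\<exists>g c i. (g, c) \<in> weighted_gens \<and> i > 0 \<and> homog_part w (c + real i * \<mu>) (\<iota> (coeff (\<phi> g) i)) \<noteq> 0)"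
proof -
  define Q where "Q = {((g, c), i). (g, c) \<in> weighted_gens \<and> i \<in> {1..degree (\<phi> g)} \<and> coeff (\<phi> g) i \<noteq> 0}"
  \<comment> \<open>Slopes at which the coefficients of the generators gain weight. The largest one
    bounds all coefficients, and where it is attained a coefficient of positive index
    survives.\<close>
  define f where "f = (\<lambda>((g, c), i). (top_weight (coeff (\<phi> g) i) - c) / real i)"
  have "Q \<subseteq> (SIGMA gc:weighted_gens. {1..degree (\<phi> (fst gc))})" by (auto simp: Q_def)
  moreover have "finite (SIGMA gc:weighted_gens. {1..degree (\<phi> (fst gc))})" by (intro finite_SigmaI) (auto simp: weighted_gens_def)
  ultimately have fin: "finite Q" by (rule finite_subset)
  obtain g0 c0 where g0: "(g0, c0) \<in> weighted_gens" "degree (\<phi> g0) > 0" using const_all[of a] assms by fastforce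
  then have "((g0, c0), degree (\<phi> g0)) \<in> Q" by (auto simp: Q_def)
  then have ne: "Q \<noteq> {}" by auto
  define \<mu> where "\<mu> = Max (f ` Q)"
  have "\<mu> \<in> f ` Q" unfolding \<mu>_def using fin ne by (intro Max_in) auto
  then obtain g c i where q: "((g, c), i) \<in> Q" "\<mu> = f ((g, c), i)" by (auto simp: image_iff) 
  then have i: "i > 0" "(g, c) \<in> weighted_gens" "coeff (\<phi> g) i \<noteq> 0" by (auto simp: Q_def)
  have "c + real i * \<mu> = top_weight (coeff (\<phi> g) i)" using i(1) by (simp add: q(2) f_def)
  then have hmn: "homog_part w (c + real i * \<mu>) (\<iota> (coeff (\<phi> g) i)) \<noteq> 0" using top_weight_homog_part[OF i(3)] by simp
  have "wt_le w (c + real i * \<mu>) (\<iota> (coeff (\<phi> g) i))" if gc: "(g, c) \<in> weighted_gens" for g c i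
  proof (cases "i = 0")
    case True
    then show ?thesis using weighted_gens_wt_le[OF gc] by (simp add: \<phi>0)
  next
    case False
    show ?thesis
    proof (cases "coeff (\<phi> g) i = 0")
      case True
      then show ?thesis by (simp add: unital_homD(4)[OF \<iota>])
    next
      case nz: False
      then have "((g, c), i) \<in> Q" using gc False le_degree by (auto simp: Q_def)
      then have "f ((g, c), i) \<le> \<mu>" unfolding \<mu>_def using fin by (intro Max_ge) auto
      then have "top_weight (coeff (\<phi> g) i) \<le> c + real i * \<mu>" using False by (simp add: f_def field_simps)
      then show ?thesis using wt_le_mono[OF top_weight] by blast
    qed
  qed
  then show ?thesis using hmn i by blast
qed

end

locale graded_action = action p m d r s1 K x y z t \<iota> N \<phi>
  for p m d r s1 and K :: "'a::field \<Rightarrow> 'b::idom" and x y z t \<iota> N \<phi> +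
  fixes \<mu> :: real
  assumes \<mu>_wt_le: "(g, c) \<in> weighted_gens \<Longrightarrow> wt_le w (c + real i * \<mu>) (\<iota> (coeff (\<phi> g) i))"
    and \<mu>_homog_part: "\<exists>g c i. (g, c) \<in> weighted_gens \<and> i > 0 \<and> homog_part w (c + real i * \<mu>) (\<iota> (coeff (\<phi> g) i)) \<noteq> 0"
begin

text \<open>\<open>\<phi> a\<close> has weight at most \<open>c\<close> if the parameter weighs
  \<open>- \<mu>\<close>. \<open>\<Phi> c a\<close> below is its part of weight exactly
  \<open>c\<close>; where \<open>B\<close> holds, it is multiplicative and stands for the graded map
  on the component of \<open>a\<close>.\<close>

definition B :: "'b \<Rightarrow> real \<Rightarrow> bool" where
  "B a c \<longleftrightarrow> (\<forall>i. wt_le w (c + real i * \<mu>) (\<iota> (coeff (\<phi> a) i)))"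

definition \<Phi> :: "real \<Rightarrow> 'b \<Rightarrow> 'a laur poly" where
  "\<Phi> c a = (\<Sum>i\<le>degree (\<phi> a). monom (homog_part w (c + real i * \<mu>) (\<iota> (coeff (\<phi> a) i))) i)"

lemma coeff_\<Phi>: "coeff (\<Phi> c a) i = homog_part w (c + real i * \<mu>) (\<iota> (coeff (\<phi> a) i))"
proof -
  have "coeff (\<Phi> c a) i = (\<Sum>j\<le>degree (\<phi> a). if j = i then homog_part w (c + real i * \<mu>) (\<iota> (coeff (\<phi> a) i)) else 0)"
    unfolding \<Phi>_def coeff_sum by (intro sum.cong) (auto simp: coeff_monom)
  also have "\<dots> = homog_part w (c + real i * \<mu>) (\<iota> (coeff (\<phi> a) i))"
    by (cases "i \<le> degree (\<phi> a)") (auto simp: coeff_eq_0 unital_homD(4)[OF \<iota>])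
  finally show ?thesis .
qed

lemma coeff_\<Phi>_0: "coeff (\<Phi> c a) 0 = homog_part w c (\<iota> a)"
  by (simp add: coeff_\<Phi> \<phi>0)

lemma B_wt_le: "B a c \<Longrightarrow> wt_le w c (\<iota> a)"
  unfolding B_def by (drule spec[of _ 0]) (simp add: \<phi>0)

lemma B_add: "B a c \<Longrightarrow> B b c \<Longrightarrow> B (a + b) c"
  by (simp add: B_def unital_homD(1)[OF \<phi>] unital_homD(1)[OF \<iota>] wt_le_add)

lemma B_0: "B 0 c"
  by (simp add: B_def unital_homD(4)[OF \<phi>] unital_homD(4)[OF \<iota>])

lemma B_sum: "(\<And>i. i \<in> I \<Longrightarrow> B (f i) c) \<Longrightarrow> B (sum f I) c"
  by (induction I rule: infinite_finite_induct) (auto simp: B_0 B_add)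

lemma B_mono: "B a c \<Longrightarrow> c \<le> c' \<Longrightarrow> B a c'"
  unfolding B_def by (meson add_right_mono wt_le_mono)

lemma \<Phi>_add: "\<Phi> c (a + b) = \<Phi> c a + \<Phi> c b"
  by (rule poly_eqI) (simp add: coeff_\<Phi> unital_homD(1)[OF \<phi>] unital_homD(1)[OF \<iota>] homog_part_add)

lemma \<Phi>_0: "\<Phi> c 0 = 0"
  by (rule poly_eqI) (simp add: coeff_\<Phi> unital_homD(4)[OF \<phi>] unital_homD(4)[OF \<iota>])

lemma \<Phi>_sum: "\<Phi> c (sum f I) = (\<Sum>i\<in>I. \<Phi> c (f i))"
  by (induction I rule: infinite_finite_induct) (auto simp: \<Phi>_0 \<Phi>_add)

lemma \<Phi>_low: "B a c \<Longrightarrow> c < c' \<Longrightarrow> \<Phi> c' a = 0"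
  by (rule poly_eqI) (auto simp: coeff_\<Phi> B_def intro: wt_le_homog_part_eq_0)

lemma \<iota>_coeff_mult: "\<iota> (coeff (\<phi> (a * b)) k) = (\<Sum>i\<le>k. \<iota> (coeff (\<phi> a) i) * \<iota> (coeff (\<phi> b) (k - i)))"
  by (simp add: unital_homD(2)[OF \<phi>] coeff_mult unital_homD(2,8)[OF \<iota>])

lemma split_weight: "i \<le> (k::nat) \<Longrightarrow> c + c' + real k * \<mu> = (c + real i * \<mu>) + (c' + real (k - i) * \<mu>)"
  by (simp add: of_nat_diff algebra_simps)

lemma B_mult: "B a c \<Longrightarrow> B b c' \<Longrightarrow> B (a * b) (c + c')"
proof -
  assume a: "B a c" and b: "B b c'"
  show ?thesis unfolding B_def \<iota>_coeff_mult
  proof (intro allI wt_le_sum)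
    fix k i :: nat assume "i \<in> {..k}"
    then have e: "c + c' + real k * \<mu> = (c + real i * \<mu>) + (c' + real (k - i) * \<mu>)" using split_weight by simp
    show "wt_le w (c + c' + real k * \<mu>) (\<iota> (coeff (\<phi> a) i) * \<iota> (coeff (\<phi> b) (k - i)))"
      unfolding e using a b by (intro wt_le_mult) (simp_all only: B_def)
  qed
qed

lemma \<Phi>_mult: "B a c \<Longrightarrow> B b c' \<Longrightarrow> \<Phi> (c + c') (a * b) = \<Phi> c a * \<Phi> c' b"
proof (rule poly_eqI)
  fix k
  assume a: "B a c" and b: "B b c'"
  show "coeff (\<Phi> (c + c') (a * b)) k = coeff (\<Phi> c a * \<Phi> c' b) k"
    unfolding coeff_mult coeff_\<Phi> \<iota>_coeff_mult homog_part_sum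
  proof (intro sum.cong refl)
    fix i assume "i \<in> {..k}"
    then have e: "c + c' + real k * \<mu> = (c + real i * \<mu>) + (c' + real (k - i) * \<mu>)" using split_weight by simp
    show "homog_part w (c + c' + real k * \<mu>) (\<iota> (coeff (\<phi> a) i) * \<iota> (coeff (\<phi> b) (k - i))) =
       homog_part w (c + real i * \<mu>) (\<iota> (coeff (\<phi> a) i)) * homog_part w (c' + real (k - i) * \<mu>) (\<iota> (coeff (\<phi> b) (k - i)))"
      unfolding e using a b by (intro homog_part_mult) (simp_all only: B_def)
  qed
qed

lemma B_K: "B (K c) 0" and \<Phi>_K: "\<Phi> 0 (K c) = [:C0 c:]"
proof -
  have *: "\<iota> (coeff (\<phi> (K c)) i) = (if i = 0 then C0 c else 0)" for i
    by (auto simp: \<phi>K \<iota>K coeff_pCons unital_homD(4)[OF \<iota>] split: nat.split)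
  show "B (K c) 0" unfolding B_def * by (auto simp: v_0 intro: wt_le_single)
  show "\<Phi> 0 (K c) = [:C0 c:]"
    by (rule poly_eqI) (auto simp: coeff_\<Phi> * coeff_pCons homog_part_single v_0 split: nat.split)
qed

lemma B_power: "B a c \<Longrightarrow> B (a ^ n) (real n * c)"
  and \<Phi>_power: "B a c \<Longrightarrow> \<Phi> (real n * c) (a ^ n) = \<Phi> c a ^ n"
proof -
  assume a: "B a c"
  have "B (a ^ n) (real n * c) \<and> \<Phi> (real n * c) (a ^ n) = \<Phi> c a ^ n"
  proof (induction n)
    case 0
    show ?case using B_K[of 1] \<Phi>_K[of 1] unital_homD(3)[OF K] by (simp add: one_pCons)
  next
    case (Suc n)
    have e: "real (Suc n) * c = c + real n * c" by (simp add: algebra_simps)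
    show ?case unfolding e power_Suc using B_mult[OF a] \<Phi>_mult[OF a] Suc by simp
  qed
  then show "B (a ^ n) (real n * c)" "\<Phi> (real n * c) (a ^ n) = \<Phi> c a ^ n" by auto
qed

section \<open>Leading parts of the images of the generators\<close>

definition "X = \<Phi> (- N) x"
definition "Y = \<Phi> wy y"
definition "Z = \<Phi> (real s1) z"
definition "T = \<Phi> (real q1) t"

lemma B_gen: "B x (- N)" "B y wy" "B z (real s1)" "B t (real q1)"
  unfolding B_def by (intro allI \<mu>_wt_le; simp add: weighted_gens_def)+

lemma B_E: "B (E e) (\<omega> e)"
  and \<Phi>_E: "\<Phi> (\<omega> e) (E e) = X ^ x_exp m (fst e) * Y ^ y_exp m (fst e) * Z ^ fst (snd e) * T ^ snd (snd e)"
proof -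
  let ?i = "x_exp m (fst e)" and ?j = "y_exp m (fst e)" and ?a = "fst (snd e)" and ?b = "snd (snd e)"
  note bx = B_power[OF B_gen(1), of ?i] and bb = B_power[OF B_gen(2), of ?j]
    and bz = B_power[OF B_gen(3), of ?a] and bt = B_power[OF B_gen(4), of ?b]
  note b2 = B_mult[OF bx bb]
  note b3 = B_mult[OF b2 bz]
  note b4 = B_mult[OF b3 bt]
  show "B (E e) (\<omega> e)" unfolding \<omega>_alt E_def by (rule b4)
  show "\<Phi> (\<omega> e) (E e) = X ^ ?i * Y ^ ?j * Z ^ ?a * T ^ ?b"
    unfolding \<omega>_alt E_def \<Phi>_mult[OF b3 bt] \<Phi>_mult[OF b2 bz] \<Phi>_mult[OF bx bb]
      \<Phi>_power[OF B_gen(1)] \<Phi>_power[OF B_gen(2)] \<Phi>_power[OF B_gen(3)] \<Phi>_power[OF B_gen(4)]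
      X_def Y_def Z_def T_def ..
qed

text \<open>The leading terms of \<open>a\<close> share the factor x^i y^j, so \<open>\<Phi>\<close>
  takes \<open>a\<close> to X^i Y^j times a weighted form in Z and T. The term attaining
  \<open>c0\<close> is recorded because the sign of its x-degree matters later.\<close>

lemma top_form:
  assumes I: "finite I" "I \<noteq> {}" "\<And>e. e \<in> I \<Longrightarrow> c e \<noteq> 0"
    and a: "a = (\<Sum>e\<in>I. K (c e) * E e)"
  shows "\<exists>c0 n J c'. B a c0 \<and> homog_part w c0 (\<iota> a) \<noteq> 0 \<and> finite J \<and> J \<noteq> {} \<and> (\<forall>e\<in>J. c' e \<noteq> 0) \<and>
    (\<exists>\<omega>'. (\<forall>a b. (a, b) \<in> J \<longrightarrow> s1 * a + q1 * b = \<omega>')) \<and>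
    (\<forall>a b. (a, b) \<in> J \<longrightarrow> c0 = \<omega> (n, a, b)) \<and> (\<forall>e\<in>I. \<omega> e \<le> c0) \<and>
    (\<exists>e\<in>I. fst e = n \<and> \<omega> e = c0) \<and> \<Phi> c0 a = X ^ x_exp m n * Y ^ y_exp m n * form_at J c' Z T"
proof -
  define c0 where "c0 = Max (\<omega> ` I)"
  have tp: "wt_le w c0 (\<iota> a)" "homog_part w c0 (\<iota> a) \<noteq> 0" "\<exists>e\<in>I. \<omega> e = c0" "\<And>e. e \<in> I \<Longrightarrow> \<omega> e \<le> c0"
    unfolding c0_def using top_part[OF I(1,2) _ a] I(3) by blast+
  obtain e0 where e0: "e0 \<in> I" "\<omega> e0 = c0" using tp(3) by blast
  define I0 where "I0 = {e\<in>I. \<omega> e = c0}"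
  define J where "J = snd ` I0"
  define n where "n = fst e0"
  have same: "fst e = n" "s1 * fst (snd e) + q1 * snd (snd e) = s1 * fst (snd e0) + q1 * snd (snd e0)" if "e \<in> I0" for e
    using \<omega>_fst[of e e0] that e0 by (auto simp: I0_def n_def)
  have inj: "inj_on snd I0" using same(1) by (auto simp: inj_on_def prod_eq_iff)
  have b0: "B (K (c e) * E e) (\<omega> e)" for e using B_mult[OF B_K[of "c e"] B_E[of e]] by simp
  have "B (K (c e) * E e) c0" if "e \<in> I" for e using B_mono[OF b0 tp(4)[OF that]] .
  then have Ba: "B a c0" unfolding a by (rule B_sum)
  have "\<Phi> c0 a = (\<Sum>e\<in>I. \<Phi> c0 (K (c e) * E e))" unfolding a by (rule \<Phi>_sum)
  also have "\<dots> = (\<Sum>e\<in>I0. \<Phi> c0 (K (c e) * E e))"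
  proof (intro sum.mono_neutral_right ballI)
    fix e assume "e \<in> I - I0"
    then have "\<omega> e < c0" using tp(4)[of e] by (auto simp: I0_def)
    then show "\<Phi> c0 (K (c e) * E e) = 0" using \<Phi>_low[OF b0] by simp
  qed (auto simp: I0_def I)
  also have "\<dots> = (\<Sum>e\<in>I0. X ^ x_exp m n * Y ^ y_exp m n * ([:C0 (c (n, snd e)):] * Z ^ fst (snd e) * T ^ snd (snd e)))"
  proof (intro sum.cong refl)
    fix e assume e: "e \<in> I0"
    then have "\<omega> e = c0" by (simp add: I0_def)
    then have "\<Phi> c0 (K (c e) * E e) = [:C0 (c e):] * \<Phi> (\<omega> e) (E e)"
      using \<Phi>_mult[OF B_K[of "c e"] B_E[of e]] by (simp add: \<Phi>_K)
    moreover have "(n, snd e) = e" using same(1)[OF e] by (simp add: prod_eq_iff)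
    ultimately show "\<Phi> c0 (K (c e) * E e) = X ^ x_exp m n * Y ^ y_exp m n * ([:C0 (c (n, snd e)):] * Z ^ fst (snd e) * T ^ snd (snd e))"
      unfolding \<Phi>_E same(1)[OF e] by (simp only: mult_ac)
  qed
  also have "\<dots> = X ^ x_exp m n * Y ^ y_exp m n * form_at J (\<lambda>e. c (n, e)) Z T"
    unfolding form_at_def J_def sum.reindex[OF inj] by (simp add: sum_distrib_left)
  finally have \<Phi>a: "\<Phi> c0 a = X ^ x_exp m n * Y ^ y_exp m n * form_at J (\<lambda>e. c (n, e)) Z T" .
  have J1: "(n, e) \<in> I0" if eJ: "e \<in> J" for e
  proof -
    obtain e' where "e' \<in> I0" "e = snd e'" using eJ unfolding J_def by blast
    moreover have "e' = (n, snd e')" using same(1)[of e'] calculation(1) by (simp add: prod_eq_iff)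
    ultimately show ?thesis by simp
  qed
  show ?thesis
  proof (intro exI conjI)
    show "B a c0" "homog_part w c0 (\<iota> a) \<noteq> 0" by fact+
    show "\<Phi> c0 a = X ^ x_exp m n * Y ^ y_exp m n * form_at J (\<lambda>e. c (n, e)) Z T" by fact
    show "finite J" using I(1) by (simp add: J_def I0_def)
    have "e0 \<in> I0" using e0 by (simp add: I0_def)
    then show "J \<noteq> {}" unfolding J_def by blast
    show "\<forall>e\<in>J. c (n, e) \<noteq> 0" using J1 I(3) by (auto simp: I0_def)
    show "\<forall>a b. (a, b) \<in> J \<longrightarrow> s1 * a + q1 * b = s1 * fst (snd e0) + q1 * snd (snd e0)"
      using J1 same(2) by fastforce
    show "\<forall>a b. (a, b) \<in> J \<longrightarrow> c0 = \<omega> (n, a, b)" using J1 by (auto simp: I0_def)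
    show "\<forall>e\<in>I. \<omega> e \<le> c0" using tp(4) by blast
    show "\<exists>e\<in>I. fst e = n \<and> \<omega> e = c0" using e0 n_def by blast
  qed
qed

lemma nonzero_top_form:
  assumes "a \<noteq> 0"
  shows "\<exists>c0 n J c'. B a c0 \<and> homog_part w c0 (\<iota> a) \<noteq> 0 \<and> finite J \<and> J \<noteq> {} \<and> (\<forall>e\<in>J. c' e \<noteq> 0) \<and>
    (\<exists>\<omega>'. (\<forall>a b. (a, b) \<in> J \<longrightarrow> s1 * a + q1 * b = \<omega>')) \<and>
    (\<forall>a b. (a, b) \<in> J \<longrightarrow> c0 = \<omega> (n, a, b)) \<and> \<Phi> c0 a = X ^ x_exp m n * Y ^ y_exp m n * form_at J c' Z T"
proof -
  obtain I c where I: "finite I" "\<forall>e\<in>I. c e \<noteq> 0" "a = (\<Sum>e\<in>I. K (c e) * E e)" using normal_form by blast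
  have "I \<noteq> {}" using assms I(3) by auto
  show ?thesis using top_form[OF I(1) \<open>I \<noteq> {}\<close> _ I(3)] I(2) by metis
qed

text \<open>Take the part of weight k = s1 * q1 * P of the defining relation: t lies strictly below
  and drops out, and Frobenius collects the rest.\<close>

lemma rel_XYZT: "X ^ m * Y + (Z ^ q1 + T ^ s1) ^ P = 0"
proof -
  define k where "k = real s1 * real q1 * real P"
  have k: "k = real m * (- N) + wy" "k = real (q1 * P) * real s1" "k = real (s1 * P) * real q1"
    by (simp_all add: k_def wy_def algebra_simps)
  have "q1 < s1 * q1 * P"
  proof -
    have "1 \<le> P" using char(2) by simp
    then have "2 * 1 \<le> s1 * P" by (rule mult_le_mono[OF s1(1)])
    then have "q1 * 2 \<le> q1 * (s1 * P)" by (intro mult_le_mono2) simp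
    moreover have "q1 * (s1 * P) = s1 * q1 * P" by (simp only: mult_ac)
    moreover have "q1 < q1 * 2" using char(2) by simp
    ultimately show ?thesis by linarith
  qed
  then have lt: "real q1 < k" unfolding k_def by (metis of_nat_less_iff of_nat_mult)
  have 1: "\<Phi> k (x ^ m * y) = X ^ m * Y"
    unfolding k(1) \<Phi>_mult[OF B_power[OF B_gen(1)] B_gen(2)] \<Phi>_power[OF B_gen(1)] X_def Y_def ..
  have 2: "\<Phi> k (z ^ (q1 * P)) = Z ^ (q1 * P)"
    unfolding k(2) \<Phi>_power[OF B_gen(3)] Z_def ..
  have 3: "\<Phi> k (t ^ (s1 * P)) = T ^ (s1 * P)"
    unfolding k(3) \<Phi>_power[OF B_gen(4)] T_def ..
  have "\<Phi> k (x ^ m * y + z ^ (q1 * P) + t + t ^ (s1 * P)) = X ^ m * Y + Z ^ (q1 * P) + 0 + T ^ (s1 * P)"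
    unfolding \<Phi>_add 1 2 3 \<Phi>_low[OF B_gen(4) lt] ..
  then have "X ^ m * Y + (Z ^ (q1 * P) + T ^ (s1 * P)) = 0" unfolding rel \<Phi>_0 by (simp add: add.assoc)
  moreover have "(Z ^ q1 + T ^ s1) ^ P = Z ^ (q1 * P) + T ^ (s1 * P)"
    using freshmans_dream'[where ?'a = "'a laur poly", of P d "Z ^ q1" "T ^ s1"] prime_p CHAR_laur
    by (simp add: power_mult)
  ultimately show ?thesis by simp
qed


lemma deg_0_iff: "degree (\<phi> a) = 0 \<Longrightarrow> \<phi> a = [:a:]"
  by (metis \<phi>0 degree_0_id)

lemma invariant_\<Phi>: "degree (\<phi> a) = 0 \<Longrightarrow> degree (\<Phi> c a) = 0"
proof -
  assume "degree (\<phi> a) = 0"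
  then have "coeff (\<Phi> c a) i = 0" if "i > 0" for i
    using that by (simp add: coeff_\<Phi> coeff_eq_0 unital_homD(4)[OF \<iota>])
  then have "degree (\<Phi> c a) \<le> 0" by (intro degree_le) auto
  then show ?thesis by simp
qed

text \<open>By the coaction identity, leading coefficients with respect to the parameter are invariant.\<close>

lemma lead_coeff_const:
  assumes g: "(g, c) \<in> weighted_gens"
  defines "l \<equiv> degree (\<Phi> c g)"
  shows "degree (\<Phi> (c + real l * \<mu>) (coeff (\<phi> g) l)) = 0"
proof -
  have "coeff (\<Phi> (c + real l * \<mu>) (coeff (\<phi> g) l)) j = 0" if "j > 0" for j
  proof -
    have "homog_part w (c + real (l + j) * \<mu>) (\<iota> (coeff (\<phi> g) (l + j))) = coeff (\<Phi> c g) (l + j)"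
      by (simp only: coeff_\<Phi>)
    also have "\<dots> = 0" using that by (intro coeff_eq_0) (simp add: l_def)
    finally have "homog_part w (c + real (l + j) * \<mu>) (of_nat ((l + j) choose l) * \<iota> (coeff (\<phi> g) (l + j))) = 0"
      by (rule homog_part_of_nat_mult)
    moreover have e: "c + real l * \<mu> + real j * \<mu> = c + real (l + j) * \<mu>" by (simp add: algebra_simps)
    ultimately show ?thesis unfolding coeff_\<Phi> coact unital_homD(2,9)[OF \<iota>] e by blast
  qed
  then have "degree (\<Phi> (c + real l * \<mu>) (coeff (\<phi> g) l)) \<le> 0" by (intro degree_le) auto
  then show ?thesis by simp
qed

lemma gen_\<Phi>_0:
  "coeff X 0 = mon (1, 0, 0)" "coeff Z 0 = mon (0, 1, 0)" "coeff T 0 = mon (0, 0, 1)" "coeff Y 0 = y0"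
  by (simp_all only: X_def Y_def Z_def T_def coeff_\<Phi>_0 gen_top y_top)

text \<open>
  If all leading forms of the invariants in $k[u, v]$ were scalar multiples of powers of \<open>y0\<close>, the polynomials of degree
  at most \<open>M\<close> in each of \<open>u\<close> and \<open>v\<close> would inject into a space of dimension about $M^2$, while they form a
  space of dimension $(M + 1)^2$.
\<close>

lemma rank_two_false:
  assumes u: "degree (\<phi> u) = 0" and v: "degree (\<phi> v) = 0"
    and u_form: "finite Iu" "\<And>e. e \<in> Iu \<Longrightarrow> cu e \<noteq> 0" "u = (\<Sum>e\<in>Iu. K (cu e) * E e)"
    and u_neg: "\<exists>e\<in>Iu. fst e < 0" and N_big: "\<And>e. e \<in> Iu \<Longrightarrow> real (\<omega>0 e) < N"
    and indep: "\<And>n c. (\<Sum>e\<in>{..n} \<times> {..n}. K (c e) * (u ^ fst e * v ^ snd e)) = 0 \<Longrightarrow>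
        \<forall>e\<in>{..n::nat} \<times> {..n::nat}. c e = 0"
  shows False
proof -
  have Yc: "degree Y = 0"
  proof -
    have ne: "Iu \<noteq> {}" using u_neg by auto
    obtain c0 n J c' where H: "B u c0" "homog_part w c0 (\<iota> u) \<noteq> 0"
        "\<forall>e\<in>Iu. \<omega> e \<le> c0" "\<exists>e\<in>Iu. fst e = n \<and> \<omega> e = c0"
        "\<Phi> c0 u = X ^ x_exp m n * Y ^ y_exp m n * form_at J c' Z T"
      using top_form[OF u_form(1) ne _ u_form(3)] u_form(2) by metis
    obtain e1 where e1: "e1 \<in> Iu" "fst e1 = n" "\<omega> e1 = c0" using H(4) by blast
    obtain e2 where e2: "e2 \<in> Iu" "fst e2 < 0" using u_neg by blast
    \<comment> \<open>Terms of negative x-degree weigh at least N, all others less than N; so a pole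
      of \<open>u\<close> survives in its leading form and forces a factor Y.\<close>
    have "n < 0"
    proof (rule ccontr)
      assume "\<not> n < 0"
      then have "N * of_int n \<ge> 0" using N_pos by simp
      then have "\<omega> e1 < N" using N_big[OF e1(1)] e1(2) by (simp add: \<omega>_def)
      moreover have "N * of_int (fst e2) \<le> N * (-1)" using e2(2) N_pos by (intro mult_left_mono) auto
      then have "\<omega> e2 \<ge> N" by (simp add: \<omega>_def)
      ultimately show False using H(3) e2(1) e1(3) by fastforce
    qed
    then have "int m * int (y_exp m n) > 0" using x_exp_y_exp[OF m0, of n] by linarith
    then have j: "y_exp m n > 0" by (simp add: zero_less_mult_iff)
    have nz: "\<Phi> c0 u \<noteq> 0" using H(2) coeff_\<Phi>_0[of c0 u] by auto
    have d: "degree (\<Phi> c0 u) = 0" using invariant_\<Phi>[OF u] .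
    have "degree (X ^ x_exp m n * Y ^ y_exp m n) = 0" "X ^ x_exp m n * Y ^ y_exp m n \<noteq> 0"
      using degree_0_factor[OF d[unfolded H(5)] nz[unfolded H(5)]] nz[unfolded H(5)] by auto
    then have "degree (Y ^ y_exp m n) = 0" by (rule degree_0_factor)
    then show ?thesis using j by (rule degree_power_0)
  qed
  interpret G: graded_curve p m d r s1 X Y Z T
  proof
    show "Y = [:- mon (- int m, 0, 0) * (mon (0, 1, 0) ^ q1 + mon (0, 0, 1) ^ s1) ^ P:]"
      using degree_0_id[OF Yc] gen_\<Phi>_0(4) unfolding y0_def by simp
  qed (use char m r s1 rel_XYZT gen_\<Phi>_0 in auto)
  have good: "\<exists>n J c'. G.good n J c' \<and> coeff (\<Phi> c0 a) 0 = G.good_value n J c' \<and> (\<forall>a b. (a, b) \<in> J \<longrightarrow> c0 = \<omega> (n, a, b)) \<and>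
      \<Phi> c0 a = X ^ x_exp m n * Y ^ y_exp m n * form_at J c' Z T"
    if c0: "wt_le w c0 (\<iota> a)" "homog_part w c0 (\<iota> a) \<noteq> 0" "degree (\<Phi> c0 a) = 0" for a c0
  proof -
    have "a \<noteq> 0" using c0(2) unital_homD(4)[OF \<iota>] by auto
    from nonzero_top_form[OF this] obtain c1 n J c' where H: "B a c1" "homog_part w c1 (\<iota> a) \<noteq> 0" "finite J" "J \<noteq> {}" "\<forall>e\<in>J. c' e \<noteq> 0"
        "\<exists>\<omega>'. (\<forall>a b. (a, b) \<in> J \<longrightarrow> s1 * a + q1 * b = \<omega>')"
        "\<forall>a b. (a, b) \<in> J \<longrightarrow> c1 = \<omega> (n, a, b)" "\<Phi> c1 a = X ^ x_exp m n * Y ^ y_exp m n * form_at J c' Z T"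
      by (elim exE conjE) (rule that; blast)
    \<comment> \<open>Two bounds that are both attained agree.\<close>
    have c: "c1 = c0" using wt_le_le_homog_part[OF c0(1) H(2)] wt_le_le_homog_part[OF B_wt_le[OF H(1)] c0(2)] by simp
    have "\<Phi> c0 a \<noteq> 0" using c0(2) coeff_\<Phi>_0[of c0 a] by auto
    then have "G.good n J c'" unfolding G.good_def using H c0(3) by (simp add: c)
    moreover have "coeff (\<Phi> c0 a) 0 = G.good_value n J c'" unfolding G.good_value_def using H(8) by (simp only: c)
    ultimately show ?thesis using H(7,8) unfolding c by blast
  qed
  show False
  proof (rule G.no_graded_action)
    obtain g c i where g: "(g, c) \<in> weighted_gens" "i > 0" "homog_part w (c + real i * \<mu>) (\<iota> (coeff (\<phi> g) i)) \<noteq> 0"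
      using \<mu>_homog_part by blast
    have "coeff (\<Phi> c g) i \<noteq> 0" using g(3) by (simp add: coeff_\<Phi>)
    then have "degree (\<Phi> c g) > 0" using g(2) le_degree by (metis gr_zeroI le_zero_eq not_gr_zero)
    then show "degree X > 0 \<or> degree Z > 0 \<or> degree T > 0"
      using g(1) Yc by (auto simp: weighted_gens_def X_def Y_def Z_def T_def)
  next
    fix h assume "h \<in> {X, Z, T}"
    then obtain g c where g: "(g, c) \<in> weighted_gens" "h = \<Phi> c g" by (auto simp: weighted_gens_def X_def Z_def T_def)
    let ?l = "degree (\<Phi> c g)"
    have hnz: "h \<noteq> 0" using \<open>h \<in> {X, Z, T}\<close> gen_\<Phi>_0 by auto
    have "homog_part w (c + real ?l * \<mu>) (\<iota> (coeff (\<phi> g) ?l)) = lead_coeff h" unfolding g(2) coeff_\<Phi> ..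
    then have "homog_part w (c + real ?l * \<mu>) (\<iota> (coeff (\<phi> g) ?l)) \<noteq> 0" using hnz by simp
    then obtain n J c' where "G.good n J c'" "coeff (\<Phi> (c + real ?l * \<mu>) (coeff (\<phi> g) ?l)) 0 = G.good_value n J c'"
      using good[OF \<mu>_wt_le[OF g(1)] _ lead_coeff_const[OF g(1)]] by blast
    then show "\<exists>n I c. G.good n I c \<and> lead_coeff h = G.good_value n I c"
      unfolding coeff_\<Phi>_0 \<open>homog_part w _ _ = lead_coeff h\<close> by blast
  next
    show "\<exists>n I c. G.good n I c \<and> \<not> (x_exp m n = 0 \<and> I = {(0, 0)})"
    proof (rule ccontr)
      assume "\<not> ?thesis"
      then have all: "x_exp m n = 0 \<and> I = {(0, 0)}" if "G.good n I c" for n I c using that by blast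
      define C where "C = max 0 (top_weight u) + max 0 (top_weight v)"
      have wy: "wy > 0" unfolding wy_def using N_pos m0 by (intro add_pos_nonneg) auto
      \<comment> \<open>\<open>C\<close> bounds the sum of the weights of u and v. For this M, all
        products with exponents up to M weigh at most M * C <= M * M * wy.\<close>
      obtain M where M: "real M \<ge> C / wy" "M \<ge> 1"
      proof -
        obtain M where "real M \<ge> C / wy" using real_arch_simple by blast
        then show ?thesis using that[of "max 1 M"] by auto
      qed
      have y0nz: "y0 \<noteq> 0" unfolding y0_y1 using y1_nz by simp
      \<comment> \<open>One monomial of each power of \<open>y0\<close>; a vanishing coefficient
        there rules out that power as leading form. The unknowns number (M + 1)^2, the conditions
        for j <= M * M only M * M + 1.\<close>
      define \<kappa> where "\<kappa> = (\<lambda>j. SOME k. k \<in> Poly_Mapping.keys (y0 ^ j))"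
      have \<kappa>: "Poly_Mapping.lookup (y0 ^ j) (\<kappa> j) \<noteq> 0" for j
      proof -
        have "Poly_Mapping.keys (y0 ^ j) \<noteq> {}" using y0nz by simp
        then have "\<kappa> j \<in> Poly_Mapping.keys (y0 ^ j)" unfolding \<kappa>_def by (simp add: some_in_eq)
        then show ?thesis by (simp add: in_keys_iff)
      qed
      define I where "I = {..M} \<times> {..M}"
      have "card I > M * M + 1" using M(2) by (simp add: I_def algebra_simps)
      then obtain c where c: "\<exists>i\<in>I. c i \<noteq> 0"
          "\<forall>j<M * M + 1. (\<Sum>i\<in>I. Poly_Mapping.lookup (\<iota> (u ^ fst i * v ^ snd i)) (\<kappa> j) * c i) = 0"
        using underdetermined_system[of I "M * M + 1" "\<lambda>j i. Poly_Mapping.lookup (\<iota> (u ^ fst i * v ^ snd i)) (\<kappa> j)"]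
        by (auto simp: I_def)
      define Q where "Q = (\<Sum>i\<in>I. K (c i) * (u ^ fst i * v ^ snd i))"
      have "Q \<noteq> 0" using indep[of c M] c(1) unfolding Q_def I_def by blast
      have "degree (\<phi> Q) = 0"
      proof -
        have "\<phi> Q = [:Q:]"
          unfolding Q_def
          by (simp only: unital_homD(2,7,8)[OF \<phi>] unital_homD(2,7,8)[OF unital_hom_const_poly] deg_0_iff[OF u] deg_0_iff[OF v] \<phi>K)
        then show ?thesis by simp
      qed
      then have "degree (\<Phi> (top_weight Q) Q) = 0" by (rule invariant_\<Phi>)
      then obtain n J c' where H: "G.good n J c'" "\<forall>a b. (a, b) \<in> J \<longrightarrow> top_weight Q = \<omega> (n, a, b)"
          "\<Phi> (top_weight Q) Q = X ^ x_exp m n * Y ^ y_exp m n * form_at J c' Z T"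
        using good[OF top_weight top_weight_homog_part[OF \<open>Q \<noteq> 0\<close>]] by blast
      have nJ: "x_exp m n = 0" "J = {(0, 0)}" using all[OF H(1)] by auto
      define j where "j = y_exp m n"
      have n: "n = - (int m * int j)" using x_exp_y_exp[OF m0, of n] nJ(1) by (simp add: j_def)
      have tw: "top_weight Q = real j * wy"
      proof -
        have w0: "real (\<omega>0 (n, 0, 0)) = real j * (real s1 * real q1 * real P)" by (simp add: \<omega>0_def j_def)
        have rn: "real_of_int n = - (real m * real j)" by (simp add: n)
        have "top_weight Q = \<omega> (n, 0, 0)" using H(2) nJ by blast
        then show ?thesis unfolding \<omega>_def fst_conv w0 rn wy_def by (simp add: algebra_simps)
      qed
      have "homog_part w (top_weight Q) (\<iota> Q) = C0 (c' (0, 0)) * y0 ^ j"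
        using coeff_\<Phi>_0[of "top_weight Q" Q] unfolding H(3)
        by (simp add: nJ form_at_def coeff_mult_0 coeff_0_power gen_\<Phi>_0 j_def mult.commute)
      moreover have "c' (0, 0) \<noteq> 0" using G.goodD(3)[OF H(1)] nJ(2) by simp
      ultimately have "Poly_Mapping.lookup (homog_part w (top_weight Q) (\<iota> Q)) (\<kappa> j) \<noteq> 0"
        using \<kappa>[of j] by (simp add: lookup_C0_mult)
      then have lk: "Poly_Mapping.lookup (\<iota> Q) (\<kappa> j) \<noteq> 0" by (auto simp: lookup_homog_part split: if_splits)
      have "Poly_Mapping.lookup (\<iota> Q) (\<kappa> j) = (\<Sum>i\<in>I. Poly_Mapping.lookup (\<iota> (u ^ fst i * v ^ snd i)) (\<kappa> j) * c i)"
        unfolding Q_def unital_homD(8)[OF \<iota>] lookup_sum unital_homD(2)[OF \<iota>, of "K _"] \<iota>K lookup_C0_mult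
        by (simp add: mult.commute)
      \<comment> \<open>The leading form of Q is a multiple of a power that no condition ruled out,
        so Q weighs more than its construction from u and v allows.\<close>
      then have "\<not> j < M * M + 1" using c(2) lk by auto
      then have j: "j \<ge> M * M + 1" by simp
      have bu: "wt_le w (max 0 (top_weight u)) (\<iota> u)" "wt_le w (max 0 (top_weight v)) (\<iota> v)"
        using wt_le_mono[OF top_weight] by auto
      have "wt_le w (real M * C) (\<iota> Q)"
        unfolding Q_def unital_homD(8)[OF \<iota>]
      proof (rule wt_le_sum)
        fix i assume i: "i \<in> I"
        have b0: "wt_le w 0 (C0 (c i))" by (simp add: wt_le_single v_0)
        have "wt_le w (0 + (multiple (fst i) (max 0 (top_weight u)) + multiple (snd i) (max 0 (top_weight v)))) (\<iota> (K (c i) * (u ^ fst i * v ^ snd i)))"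
          unfolding unital_homD(2,7)[OF \<iota>] \<iota>K by (intro wt_le_mult b0 wt_le_power bu)
        moreover have "0 + (multiple (fst i) (max 0 (top_weight u)) + multiple (snd i) (max 0 (top_weight v))) \<le> real M * C"
          unfolding multiple_real C_def using i by (auto simp: I_def distrib_left intro!: add_mono mult_right_mono)
        ultimately show "wt_le w (real M * C) (\<iota> (K (c i) * (u ^ fst i * v ^ snd i)))" by (rule wt_le_mono)
      qed
      then have "top_weight Q \<le> real M * C" using wt_le_le_homog_part top_weight_homog_part[OF \<open>Q \<noteq> 0\<close>] by blast
      also have "\<dots> \<le> real M * (real M * wy)" using M(1) wy by (intro mult_left_mono) (auto simp: field_simps)
      finally have "real j * wy \<le> real (M * M) * wy" unfolding tw by (simp add: mult_ac)
      then have "j \<le> M * M" using wy by (simp only: mult_le_cancel_right of_nat_le_iff)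
      then show False using j by simp
    qed
  qed
qed

end

section \<open>Polynomial coordinates\<close>

lemma cring_ring_of: "cring (ring_of :: 'b::comm_ring_1 ring)"
proof (rule cringI)
  show "abelian_group (ring_of :: 'b ring)"
  proof (rule abelian_groupI)
    fix x :: 'b
    show "\<exists>y\<in>carrier ring_of. y \<oplus>\<^bsub>ring_of\<^esub> x = \<zero>\<^bsub>ring_of\<^esub>"
      by (rule bexI[of _ "- x"]) (auto simp: ring_of_def)
  qed (auto simp: ring_of_def)
  show "comm_monoid (ring_of :: 'b ring)"
    by (rule comm_monoidI) (auto simp: ring_of_def mult.commute)
qed (auto simp: ring_of_def algebra_simps)

text \<open>Composing \<open>h\<close> with the projection replaces cosets by a surjection with
  kernel generated by \<open>f\<close>; injectivity of \<open>h\<close> gives the kernel.\<close>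

lemma quotient_iso_imp_unital_hom:
  fixes f :: "'b::comm_ring_1"
  assumes h: "h \<in> ring_iso (ring_of Quot genideal ring_of {f}) (ring_of :: 'c::comm_ring_1 ring)"
  defines "\<eta> \<equiv> \<lambda>P. h (genideal ring_of {f} +>\<^bsub>ring_of\<^esub> P)"
  shows "unital_hom \<eta>" "surj \<eta>" "\<eta> f = 0" "\<And>P. \<eta> P = 0 \<Longrightarrow> \<exists>Q. P = Q * f"
proof -
  interpret R: cring "ring_of :: 'b ring" by (rule cring_ring_of)
  let ?I = "genideal ring_of {f}"
  have car: "carrier ring_of = UNIV" for R :: "'z::comm_ring_1 ring" by (simp add: ring_of_def)
  have I: "ideal ?I ring_of" by (rule R.genideal_ideal) (simp add: ring_of_def)
  interpret I: ideal ?I ring_of by (rule I)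
  have pid: "?I = {x * f | x. True}"
    using R.cgenideal_eq_genideal[of f] by (auto simp: cgenideal_def ring_of_def)
  have h1: "h \<in> ring_hom (ring_of Quot ?I) ring_of" and bij: "bij_betw h (carrier (ring_of Quot ?I)) UNIV"
    using h by (auto simp: ring_iso_def ring_of_def)
  have comp: "h \<circ> (\<lambda>a. ?I +>\<^bsub>ring_of\<^esub> a) \<in> ring_hom ring_of ring_of"
    by (rule ring_hom_trans[OF I.rcos_ring_hom h1])
  have e: "h \<circ> (\<lambda>a. ?I +>\<^bsub>ring_of\<^esub> a) = \<eta>" by (auto simp: \<eta>_def)
  show r: "unital_hom \<eta>"
    using comp unfolding e ring_hom_def unital_hom_def by (auto simp: ring_of_def)
  have cq: "carrier (ring_of Quot ?I) = range (\<lambda>a. ?I +>\<^bsub>ring_of\<^esub> a)"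
    by (auto simp: FactRing_def A_RCOSETS_def' ring_of_def)
  show "surj \<eta>"
  proof (unfold surj_def, rule allI)
    fix y
    have "y \<in> h ` carrier (ring_of Quot ?I)" using bij by (simp add: bij_betw_def)
    then show "\<exists>x. y = \<eta> x" unfolding cq \<eta>_def by auto
  qed
  have inI: "P \<in> ?I \<longleftrightarrow> ?I +>\<^bsub>ring_of\<^esub> P = ?I" for P
  proof
    assume "?I +>\<^bsub>ring_of\<^esub> P = ?I"
    then show "P \<in> ?I" using I.a_rcos_self[of P] by (simp add: ring_of_def)
  qed (rule I.a_rcos_const)
  have "0 = 0 * f" by simp
  then have zI: "0 \<in> ?I" unfolding pid by blast
  have z: "h ?I = 0"
  proof -
    have "?I +>\<^bsub>ring_of\<^esub> 0 = ?I" using inI[of 0] zI by simp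
    then show ?thesis using unital_homD(4)[OF r] by (simp add: \<eta>_def)
  qed
  have "f \<in> ?I" unfolding pid by (auto intro: exI[of _ 1])
  then show "\<eta> f = 0" using inI[of f] z by (simp add: \<eta>_def)
  fix P assume "\<eta> P = 0"
  then have "h (?I +>\<^bsub>ring_of\<^esub> P) = h ?I" by (simp add: \<eta>_def z)
  moreover have "?I \<in> carrier (ring_of Quot ?I)"
    unfolding cq using inI[of 0] zI by (metis rangeI)
  moreover have "?I +>\<^bsub>ring_of\<^esub> P \<in> carrier (ring_of Quot ?I)" unfolding cq by simp
  ultimately have "?I +>\<^bsub>ring_of\<^esub> P = ?I" using bij by (auto simp: bij_betw_def inj_on_def)
  then show "\<exists>Q. P = Q * f" using inI[of P] pid by auto
qed

section \<open>Subalgebras that contain all indeterminates\<close>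

lemma poly_subring_UNIV:
  fixes S :: "'b::comm_ring_1 poly set"
  assumes "\<And>c. [:c:] \<in> S" "\<And>a b. a \<in> S \<Longrightarrow> b \<in> S \<Longrightarrow> a + b \<in> S"
    "\<And>a b. a \<in> S \<Longrightarrow> b \<in> S \<Longrightarrow> a * b \<in> S" "monom 1 1 \<in> S"
  shows "q \<in> S"
proof (induction q)
  case 0
  then show ?case using assms(1)[of 0] by simp
next
  case (pCons a q)
  have "pCons a q = [:a:] + monom 1 1 * q" by (simp add: monom_altdef)
  then show ?case using assms pCons by simp
qed

lemma poly_const_mem:
  fixes S :: "'b::comm_ring_1 poly poly set"
  assumes "\<And>c. [:[:c:]:] \<in> S" "\<And>a b. a \<in> S \<Longrightarrow> b \<in> S \<Longrightarrow> a + b \<in> S"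
    "\<And>a b. a \<in> S \<Longrightarrow> b \<in> S \<Longrightarrow> a * b \<in> S" "[:monom 1 1:] \<in> S"
  shows "[:q:] \<in> S"
proof -
  have "q \<in> {q. [:q:] \<in> S}"
  proof (rule poly_subring_UNIV)
    fix a b assume "a \<in> {q. [:q:] \<in> S}" "b \<in> {q. [:q:] \<in> S}"
    then show "a + b \<in> {q. [:q:] \<in> S}" "a * b \<in> {q. [:q:] \<in> S}"
      using assms(2)[of "[:a:]" "[:b:]"] assms(3)[of "[:a:]" "[:b:]"] by (simp_all add: mult.commute)
  qed (use assms in auto)
  then show ?thesis by simp
qed

lemma poly3_subring_UNIV:
  fixes S :: "'b::comm_ring_1 poly3 set"
  assumes c: "\<And>c. const3 c \<in> S" and a: "\<And>a b. a \<in> S \<Longrightarrow> b \<in> S \<Longrightarrow> a + b \<in> S"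
    and m: "\<And>a b. a \<in> S \<Longrightarrow> b \<in> S \<Longrightarrow> a * b \<in> S"
    and v: "[:[:monom 1 1:]:] \<in> S" "[:monom 1 1:] \<in> S" "monom 1 1 \<in> S"
  shows "q \<in> S"
proof -
  have 1: "[:[:q:]:] \<in> S" for q
  proof -
    have "[:q:] \<in> {q. [:q:] \<in> S}"
    proof (rule poly_const_mem)
      fix a b assume "a \<in> {q. [:q:] \<in> S}" "b \<in> {q. [:q:] \<in> S}"
      then show "a + b \<in> {q. [:q:] \<in> S}" "a * b \<in> {q. [:q:] \<in> S}"
        using a[of "[:a:]" "[:b:]"] m[of "[:a:]" "[:b:]"] by (simp_all add: mult.commute)
    qed (use c v in \<open>auto simp: const3_def\<close>)
    then show ?thesis by simp
  qed
  have "[:q:] \<in> S" for q by (rule poly_const_mem) (use 1 a m v in auto)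
  then show ?thesis by (rule poly_subring_UNIV) (use a m v in auto)
qed

lemma poly4_subring_UNIV:
  fixes S :: "'b::comm_ring_1 poly4 set"
  assumes c: "\<And>c. const4 c \<in> S" and a: "\<And>a b. a \<in> S \<Longrightarrow> b \<in> S \<Longrightarrow> a + b \<in> S"
    and m: "\<And>a b. a \<in> S \<Longrightarrow> b \<in> S \<Longrightarrow> a * b \<in> S"
    and v: "varX \<in> S" "varY \<in> S" "varZ \<in> S" "varT \<in> S"
  shows "q \<in> S"
proof -
  have "[:q:] \<in> S" for q
  proof -
    have "q \<in> {q. [:q:] \<in> S}"
    proof (rule poly3_subring_UNIV)
      fix a b assume "a \<in> {q. [:q:] \<in> S}" "b \<in> {q. [:q:] \<in> S}"
      then show "a + b \<in> {q. [:q:] \<in> S}" "a * b \<in> {q. [:q:] \<in> S}"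
        using a[of "[:a:]" "[:b:]"] m[of "[:a:]" "[:b:]"] by (simp_all add: mult.commute)
    qed (use c v in \<open>auto simp: const3_def const4_def varX_def varY_def varZ_def\<close>)
    then show ?thesis by simp
  qed
  then show ?thesis by (rule poly_subring_UNIV) (use a m v in \<open>auto simp: varT_def\<close>)
qed

lemma poly3_unital_hom_eqI:
  fixes f g :: "'b::comm_ring_1 poly3 \<Rightarrow> 'c::comm_ring_1"
  assumes f: "unital_hom f" and g: "unital_hom g" and "\<And>c. f (const3 c) = g (const3 c)"
    "f [:[:monom 1 1:]:] = g [:[:monom 1 1:]:]" "f [:monom 1 1:] = g [:monom 1 1:]" "f (monom 1 1) = g (monom 1 1)"
  shows "f q = g q"
proof -
  have "q \<in> {q. f q = g q}"
    by (rule poly3_subring_UNIV) (use assms unital_homD(1,2)[OF f] unital_homD(1,2)[OF g] in auto)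
  then show ?thesis by simp
qed

lemma unital_hom_const3: "unital_hom (const3 :: 'a::comm_ring_1 \<Rightarrow> _)"
  by (auto simp: unital_hom_def const3_def one_pCons)

text \<open>
  The exponential map $U \mapsto U - \epsilon S$, $V \mapsto V$, $W \mapsto W + S$ of $k[U, V, W]$.
  It fixes $V$, and also $U$ if $\epsilon = 0$ and $U + W$ if $\epsilon = 1$.
\<close>

definition shift :: "'a::comm_ring_1 \<Rightarrow> 'a poly3 \<Rightarrow> 'a poly3 poly" where
  "shift \<epsilon> = eval_hom (eval_hom (eval_hom (\<lambda>c. [:const3 c:]) [:[:[:monom 1 1:]:], - const3 \<epsilon>:]) [:[:monom 1 1:]:]) [:monom 1 1, 1:]"

lemma unital_hom_shift: "unital_hom (shift \<epsilon>)"
  unfolding shift_def by (intro unital_hom_eval_hom unital_hom_comp[OF unital_hom_const3 unital_hom_const_poly])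

lemma shift_simps:
  "shift \<epsilon> (const3 c) = [:const3 c:]"
  "shift \<epsilon> [:[:monom 1 1:]:] = [:[:[:monom 1 1:]:], - const3 \<epsilon>:]"
  "shift \<epsilon> [:monom 1 1:] = [:[:monom 1 1:]:]"
  "shift \<epsilon> (monom 1 1) = [:monom 1 1, 1:]"
proof -
  note r0 = unital_hom_comp[OF unital_hom_const3 unital_hom_const_poly]
  note r1 = unital_hom_eval_hom[OF r0]
  note r2 = unital_hom_eval_hom[OF r1]
  show "shift \<epsilon> (const3 c) = [:const3 c:]"
    unfolding shift_def by (subst (3) const3_def) (simp only: eval_hom_const[OF r2] eval_hom_const[OF r1] eval_hom_const[OF r0])
  show "shift \<epsilon> [:[:monom 1 1:]:] = [:[:[:monom 1 1:]:], - const3 \<epsilon>:]"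
    unfolding shift_def by (simp only: eval_hom_const[OF r2] eval_hom_const[OF r1] eval_hom_monom[OF r0])
  show "shift \<epsilon> [:monom 1 1:] = [:[:monom 1 1:]:]"
    unfolding shift_def by (simp only: eval_hom_const[OF r2] eval_hom_monom[OF r1])
  show "shift \<epsilon> (monom 1 1) = [:monom 1 1, 1:]"
    unfolding shift_def by (simp only: eval_hom_monom[OF r2])
qed

lemma unital_hom_coeff_0: "unital_hom (\<lambda>q. coeff q 0)"
  by (auto simp: unital_hom_def coeff_mult_0)

lemma shift_0: "coeff (shift \<epsilon> a) 0 = a"
proof -
  have "(\<lambda>q. coeff (shift \<epsilon> q) 0) a = (\<lambda>q. q) a"
    by (rule poly3_unital_hom_eqI[OF unital_hom_comp[OF unital_hom_shift unital_hom_coeff_0]]) (simp_all only: shift_simps coeff_pCons_0, simp add: unital_hom_def)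
  then show ?thesis by simp
qed

text \<open>The binomial theorem for the sum of the outer and the inner indeterminate, by Pascal's
  rule.\<close>

lemma coeff_two_var_power:
  "coeff (coeff ([:monom 1 1, 1:] ^ n :: 'b::comm_ring_1 poly poly) i) j = (if i + j = n then of_nat (n choose i) else 0)"
proof (induction n arbitrary: i j)
  case 0
  show ?case by (auto simp: coeff_1)
next
  case (Suc n)
  have "[:monom 1 1, 1:] ^ Suc n = smult (monom 1 1) ([:monom 1 1, 1:] ^ n) + pCons 0 ([:monom 1 1, 1:] ^ n :: 'b poly poly)"
    by simp
  then have "coeff ([:monom 1 1, 1:] ^ Suc n :: 'b poly poly) i =
     monom 1 1 * coeff ([:monom 1 1, 1:] ^ n) i + (case i of 0 \<Rightarrow> 0 | Suc i' \<Rightarrow> coeff ([:monom 1 1, 1:] ^ n) i')"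
    by (simp only: coeff_add coeff_smult coeff_pCons)
  then have "coeff (coeff ([:monom 1 1, 1:] ^ Suc n :: 'b poly poly) i) j =
     (case j of 0 \<Rightarrow> 0 | Suc j' \<Rightarrow> coeff (coeff ([:monom 1 1, 1:] ^ n) i) j') +
     (case i of 0 \<Rightarrow> 0 | Suc i' \<Rightarrow> coeff (coeff ([:monom 1 1, 1:] ^ n) i') j)"
    by (cases i; cases j) (simp_all add: monom_altdef del: power_Suc)
  then show ?case
    unfolding Suc by (cases i; cases j) (auto simp del: power_Suc)
qed

text \<open>\<open>\<psi>1\<close> shifts twice with separate parameters, \<open>\<psi>2\<close>
  shifts once by their sum. Both are homomorphisms that agree on constants and coordinates; the
  identity compares their coefficients.\<close>

lemma shift_coaction:
  "coeff (shift \<epsilon> (coeff (shift \<epsilon> a) i)) j = of_nat ((i + j) choose i) * coeff (shift \<epsilon> a) (i + j)"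
proof -
  define \<psi>1 where "\<psi>1 = (\<lambda>a. map_poly (shift \<epsilon>) (shift \<epsilon> a))"
  define \<psi>2 where "\<psi>2 = (\<lambda>a. eval_hom (\<lambda>c. [:[:c:]:]) [:monom 1 1, 1:] (shift \<epsilon> a))"
  have cc: "unital_hom (\<lambda>c. [:[:c:]:] :: 'a poly3 poly poly)" by (rule unital_hom_comp[OF unital_hom_const_poly unital_hom_const_poly])
  have 1: "unital_hom \<psi>1" unfolding \<psi>1_def by (rule unital_hom_comp[OF unital_hom_shift unital_hom_map_poly[OF unital_hom_shift]])
  have 2: "unital_hom \<psi>2" unfolding \<psi>2_def by (rule unital_hom_comp[OF unital_hom_shift unital_hom_eval_hom[OF cc]])
  note s = unital_homD(3,4,5)[OF unital_hom_shift, of \<epsilon>]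
  have mp: "map_poly (shift \<epsilon>) [:a, b:] = [:shift \<epsilon> a, shift \<epsilon> b:]" for a b by (simp add: map_poly_pCons s)
  have mp0: "map_poly (shift \<epsilon>) [:a:] = [:shift \<epsilon> a:]" for a by (simp add: map_poly_pCons s)
  have e: "eval_hom (\<lambda>c. [:[:c:]:]) [:monom 1 1, 1:] [:a, b:] = [:[:a, b:], [:b:]:]" for a b :: "'a poly3"
    by (simp add: eval_hom_pCons[where f = "\<lambda>c. [:[:c:]:]", OF unital_homD(4)[OF cc]] monom_altdef)
  have e0: "eval_hom (\<lambda>c. [:[:c:]:]) [:monom 1 1, 1:] [:a:] = [:[:a:]:]" for a :: "'a poly3"
    by (rule eval_hom_const[OF cc])
  have "\<psi>1 a = \<psi>2 a"
    by (rule poly3_unital_hom_eqI[OF 1 2])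
      (simp_all only: \<psi>1_def \<psi>2_def shift_simps mp mp0 e e0 s, simp_all add: one_pCons)
  moreover have "coeff (coeff (\<psi>1 a) i) j = coeff (shift \<epsilon> (coeff (shift \<epsilon> a) i)) j"
    by (simp add: \<psi>1_def coeff_map_poly s)
  moreover have "coeff (coeff (\<psi>2 a) i) j = of_nat ((i + j) choose i) * coeff (shift \<epsilon> a) (i + j)"
  proof -
    let ?f = "shift \<epsilon> a"
    have "\<psi>2 a = (\<Sum>n\<le>degree ?f. [:[:coeff ?f n:]:] * [:monom 1 1, 1:] ^ n)"
    proof -
      have "degree (map_poly (\<lambda>c. [:[:c:]:]) ?f) = degree ?f" by (rule degree_map_poly) auto
      then show ?thesis unfolding \<psi>2_def eval_hom_def poly_altdef by (simp add: coeff_map_poly)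
    qed
    then have "coeff (coeff (\<psi>2 a) i) j = (\<Sum>n\<le>degree ?f. coeff ?f n * (if i + j = n then of_nat (n choose i) else 0))"
      by (simp add: coeff_sum coeff_two_var_power[unfolded One_nat_def])
    also have "\<dots> = (\<Sum>n\<le>degree ?f. if n = i + j then of_nat ((i + j) choose i) * coeff ?f (i + j) else 0)"
      by (intro sum.cong) auto
    also have "\<dots> = of_nat ((i + j) choose i) * coeff ?f (i + j)"
      by (cases "i + j \<le> degree ?f") (auto simp: coeff_eq_0)
    finally show ?thesis .
  qed
  ultimately show ?thesis by simp
qed

section \<open>Independent invariants and the contradiction\<close>

lemma mon_x_inverse: "mon (1, 0, 0) ^ m * mon (- int m, 0, 0) = (1 :: 'a::comm_ring_1 laur)"
  by (simp add: mon_power mult_single, simp flip: zero_prod_def)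

text \<open>\<open>\<pi>\<close> will be the specialisation W = 0, which sends both U and U + W to
  U; the coefficients can then be read off.\<close>

lemma vars_independent:
  fixes c :: "nat \<times> nat \<Rightarrow> 'a::comm_ring_1" and \<pi> :: "'a poly3 \<Rightarrow> 'a poly poly"
  assumes \<pi>: "unital_hom \<pi>" "\<And>c. \<pi> (const3 c) = [:[:c:]:]" "\<pi> u = [:monom 1 1:]" "\<pi> v = monom 1 1"
    and z: "(\<Sum>e\<in>{..n} \<times> {..n}. const3 (c e) * (u ^ fst e * v ^ snd e)) = 0"
  shows "\<forall>e\<in>{..n} \<times> {..n}. c e = 0"
proof
  fix k assume k: "k \<in> {..n} \<times> {..n}"
  have t: "[:[:c e:]:] * ([:monom 1 1:] ^ fst e * monom 1 1 ^ snd e) = monom (monom (c e) (fst e)) (snd e)" for e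
  proof -
    have "monom (1::'a) 1 ^ i = monom 1 i" for i by (simp add: monom_power)
    moreover have "[:monom (1::'a) 1:] ^ i = [:monom 1 1 ^ i:]" for i
      using unital_homD(7)[OF unital_hom_const_poly, of "monom (1::'a) 1" i] by simp
    moreover have "monom (1::'a poly) 1 ^ j = monom 1 j" for j by (simp add: monom_power)
    ultimately have "[:[:c e:]:] * ([:monom 1 1:] ^ fst e * monom 1 1 ^ snd e) = smult ([:c e:] * monom 1 (fst e)) (monom 1 (snd e))"
      by simp
    also have "\<dots> = monom (monom (c e) (fst e)) (snd e)" by (simp add: smult_monom)
    finally show ?thesis .
  qed
  have "\<pi> (\<Sum>e\<in>{..n} \<times> {..n}. const3 (c e) * (u ^ fst e * v ^ snd e)) = 0"
    unfolding z by (rule unital_homD(4)[OF \<pi>(1)])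
  then have "(\<Sum>e\<in>{..n} \<times> {..n}. monom (monom (c e) (fst e)) (snd e)) = 0"
    unfolding unital_homD(2,7,8)[OF \<pi>(1)] \<pi>(2-4) t .
  then have "coeff (coeff (\<Sum>e\<in>{..n} \<times> {..n}. monom (monom (c e) (fst e)) (snd e)) (snd k)) (fst k) = 0" by simp
  then have "(\<Sum>e\<in>{..n} \<times> {..n}. if e = k then c k else 0) = 0"
    unfolding coeff_sum coeff_monom
    by (subst sum.cong[OF refl]) (auto simp: prod_eq_iff split: if_splits)
  then show "c k = 0" using k by simp
qed

lemma vars_independent_swap:
  fixes u v :: "'a::comm_ring_1 poly3"
  assumes "\<And>c. (\<Sum>e\<in>{..n} \<times> {..n}. const3 (c e) * (u ^ fst e * v ^ snd e)) = 0 \<Longrightarrow> \<forall>e\<in>{..n} \<times> {..n}. c e = 0"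
    and z: "(\<Sum>e\<in>{..n} \<times> {..n}. const3 (c e) * (v ^ fst e * u ^ snd e)) = 0"
  shows "\<forall>e\<in>{..n} \<times> {..n}. c e = 0"
proof -
  have "(\<Sum>e\<in>{..n} \<times> {..n}. const3 (c (prod.swap e)) * (u ^ fst e * v ^ snd e)) =
      (\<Sum>e\<in>{..n} \<times> {..n}. const3 (c e) * (v ^ fst e * u ^ snd e))"
    by (rule sum.reindex_bij_witness[of _ prod.swap prod.swap]) (auto simp: mult_ac)
  then have "\<forall>e\<in>{..n} \<times> {..n}. (c \<circ> prod.swap) e = 0" using assms(1)[of "c \<circ> prod.swap"] z by simp
  then show ?thesis by auto
qed

theorem no_polynomial_coordinates:
  fixes \<iota> :: "'a::field poly3 \<Rightarrow> 'a laur"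
  assumes L: "laurent_model p m d r s1 const3 x y z t \<iota>"
  shows False
proof -
  interpret laurent_model p m d r s1 const3 x y z t \<iota> by (rule L)
  let ?U = "[:[:monom 1 1:]:] :: 'a poly3" and ?V = "[:monom 1 1:] :: 'a poly3" and ?W = "monom 1 1 :: 'a poly3"
  \<comment> \<open>Absence of a pole along x = 0. This is a subalgebra without y, so it misses a
    coordinate.\<close>
  define nonneg where "nonneg = (\<lambda>a. \<forall>g\<in>Poly_Mapping.keys (\<iota> a). fst g \<ge> 0)"
  have add: "nonneg (a + b)" if "nonneg a" "nonneg b" for a b
    using that keys_add[of "\<iota> a" "\<iota> b"] by (auto simp: nonneg_def unital_homD(1)[OF \<iota>])
  have mult: "nonneg (a * b)" if "nonneg a" "nonneg b" for a b
    using that keys_mult[of "\<iota> a" "\<iota> b"] by (fastforce simp: nonneg_def unital_homD(2)[OF \<iota>])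
  have "\<not> nonneg y"
  proof
    assume "nonneg y"
    moreover have "\<iota> y \<noteq> 0"
    proof
      assume "\<iota> y = 0"
      moreover have "\<iota> (x ^ m * y + z ^ (q1 * P) + t + t ^ (s1 * P)) = 0" unfolding rel by (rule unital_homD(4)[OF \<iota>])
      ultimately have "mon (0, 1, 0) ^ (q1 * P) + mon (0, 0, 1) + mon (0, 0, 1) ^ (s1 * P) = (0 :: 'a laur)"
        by (simp add: unital_homD(1,2,7)[OF \<iota>] \<iota>z \<iota>t)
      then have "Poly_Mapping.lookup (mon (0, 1, 0) ^ (q1 * P) + mon (0, 0, 1) + mon (0, 0, 1) ^ (s1 * P) :: 'a laur) (0, 0, 1) = 0"
        by simp
      moreover have "s1 * P \<noteq> 1" "q1 * P \<noteq> 0" using s1(1) char(2) by auto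
      ultimately show False by (auto simp: mon_power lookup_add lookup_single when_def simp flip: of_nat_mult split: if_splits)
    qed
    then obtain g where g: "g \<in> Poly_Mapping.keys (\<iota> y)" by (metis all_not_in_conv keys_eq_empty)
    moreover have "fst g = - int m" using x_homog_\<iota>y g by (simp add: x_homog_def)
    ultimately show False using m0 g by (force simp: nonneg_def)
  qed
  moreover have "nonneg a" if "nonneg ?U" "nonneg ?V" "nonneg ?W" for a
  proof -
    have "a \<in> {a. nonneg a}"
    proof (rule poly3_subring_UNIV)
      show "const3 c \<in> {a. nonneg a}" for c by (simp add: nonneg_def \<iota>K)
      show "a + b \<in> {a. nonneg a}" if "a \<in> {a. nonneg a}" "b \<in> {a. nonneg a}" for a b
        using that add by blast
      show "a * b \<in> {a. nonneg a}" if "a \<in> {a. nonneg a}" "b \<in> {a. nonneg a}" for a b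
        using that mult by blast
    qed (use that in blast)+
    then show ?thesis by simp
  qed
  \<comment> \<open>A pole of U or V gives an invariant of the shift of W alone. If only W is known
    to have one, it passes to U + W, which the shift with \<epsilon> = 1 fixes.\<close>
  ultimately have disj: "\<not> nonneg ?U \<or> \<not> nonneg ?V \<or> nonneg ?U \<and> \<not> nonneg ?W" by blast
  have UW: "\<not> nonneg (?U + ?W)" if nUW: "nonneg ?U" "\<not> nonneg ?W"
  proof -
    obtain g where g: "g \<in> Poly_Mapping.keys (\<iota> ?W)" "fst g < 0" using nUW(2) by (auto simp: nonneg_def)
    have "g \<notin> Poly_Mapping.keys (\<iota> ?U)" using nUW(1) g(2) unfolding nonneg_def by force
    then have "Poly_Mapping.lookup (\<iota> ?U) g = 0" by (simp add: in_keys_iff)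
    then have "g \<in> Poly_Mapping.keys (\<iota> (?U + ?W))" using g(1) by (simp add: unital_homD(1)[OF \<iota>] lookup_add in_keys_iff)
    then show ?thesis using g(2) unfolding nonneg_def by force
  qed
  have r1: "unital_hom (\<lambda>q::'a poly3. coeff q 0)" by (rule unital_hom_coeff_0)
  have ind0: "\<forall>e\<in>{..n} \<times> {..n}. c e = 0"
    if "(\<Sum>e\<in>{..n} \<times> {..n}. const3 (c e) * (?U ^ fst e * ?V ^ snd e)) = 0" for n c
    by (rule vars_independent[OF r1 _ _ _ that]) (simp_all add: const3_def)
  have ind1: "\<forall>e\<in>{..n} \<times> {..n}. c e = 0"
    if "(\<Sum>e\<in>{..n} \<times> {..n}. const3 (c e) * ((?U + ?W) ^ fst e * ?V ^ snd e)) = 0" for n c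
    by (rule vars_independent[OF r1 _ _ _ that]) (simp_all add: const3_def)
  have main: False if sh: "degree (shift \<epsilon> u) = 0" "degree (shift \<epsilon> v) = 0" and nn: "\<not> nonneg u"
    and indep: "\<And>n c. (\<Sum>e\<in>{..n} \<times> {..n}. const3 (c e) * (u ^ fst e * v ^ snd e)) = 0 \<Longrightarrow> \<forall>e\<in>{..n} \<times> {..n}. c e = 0"
    for u v \<epsilon>
  proof -
    obtain I c where I: "finite I" "\<forall>e\<in>I. c e \<noteq> 0" "u = (\<Sum>e\<in>I. const3 (c e) * E e)" using normal_form by blast
    have neg: "\<exists>e\<in>I. fst e < 0"
    proof (rule ccontr)
      assume "\<not> ?thesis"
      then have nn_e: "nonneg (const3 (c e) * E e)" if "e \<in> I" for e
        using that x_homog_\<iota>E[of e] by (intro mult) (fastforce simp: nonneg_def x_homog_def \<iota>K split: if_splits)+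
      have "nonneg 0" by (simp add: nonneg_def unital_homD(4)[OF \<iota>])
      then have ns: "nonneg (sum f J)" if "\<And>e. e \<in> J \<Longrightarrow> nonneg (f e)" for f and J :: "(int \<times> nat \<times> nat) set"
        using that by (induction J rule: infinite_finite_induct) (simp_all add: add)
      have "nonneg u" unfolding I(3) by (rule ns) (rule nn_e)
      then show False using nn by simp
    qed
    \<comment> \<open>The sum exceeds or equals each single (z, t)-weight, and \<open>sqrt 2\<close>
      makes the bound strict and N irrational.\<close>
    define N where "N = sqrt 2 + real (\<Sum>e\<in>I. \<omega>0 e)"
    interpret weighted_model p m d r s1 const3 x y z t \<iota> N
    proof
      fix a b :: int assume "of_int a * N = of_int b"
      then have "of_int a * sqrt 2 = of_int (b - a * int (\<Sum>e\<in>I. \<omega>0 e))" by (simp add: N_def algebra_simps)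
      then show "a = 0" by (rule sqrt2_irrational)
    next
      have "real (\<Sum>e\<in>I. \<omega>0 e) \<ge> 0" by (rule of_nat_0_le_iff)
      then show "N > 0" unfolding N_def by (intro add_pos_nonneg real_sqrt_gt_zero) simp_all
    qed
    interpret action p m d r s1 const3 x y z t \<iota> N "shift \<epsilon>"
      by unfold_locales (rule unital_hom_shift shift_simps shift_0 shift_coaction)+
    have "degree (shift \<epsilon> ?W) > 0" by (simp only: shift_simps) simp
    then obtain \<mu> where \<mu>: "\<forall>g c i. (g, c) \<in> weighted_gens \<longrightarrow> wt_le w (c + real i * \<mu>) (\<iota> (coeff (shift \<epsilon> g) i))"
        "\<exists>g c i. (g, c) \<in> weighted_gens \<and> i > 0 \<and> homog_part w (c + real i * \<mu>) (\<iota> (coeff (shift \<epsilon> g) i)) \<noteq> 0"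
      using ex_\<mu> by blast
    interpret graded_action p m d r s1 const3 x y z t \<iota> N "shift \<epsilon>" \<mu>
      using \<mu> by unfold_locales blast+
    show False
    proof (rule rank_two_false[OF sh I(1) _ I(3) neg])
      fix e assume e: "e \<in> I"
      show "c e \<noteq> 0" using I(2) e by blast
      have "real (\<omega>0 e) \<le> real (\<Sum>e\<in>I. \<omega>0 e)" using I(1) e by (intro of_nat_mono member_le_sum) auto
      moreover have "sqrt 2 > 0" by simp
      ultimately show "real (\<omega>0 e) < N" unfolding N_def by linarith
    qed (rule indep)
  qed
  consider "\<not> nonneg ?U" | "\<not> nonneg ?V" | "\<not> nonneg (?U + ?W)" using disj UW by blast
  then show False
  proof cases
    case 1
    show False
      by (rule main[of 0 ?U ?V, OF _ _ 1 ind0]) (simp_all only: shift_simps, simp_all add: const3_def)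
  next
    case 2
    show False
      by (rule main[of 0 ?V ?U, OF _ _ 2 vars_independent_swap[OF ind0]])
        (simp_all only: shift_simps, simp_all add: const3_def)
  next
    case 3
    have "shift 1 (?U + ?W) = [:?U + ?W:]"
      unfolding unital_homD(1)[OF unital_hom_shift] shift_simps by (simp add: const3_def one_pCons)
    then have "degree (shift 1 (?U + ?W)) = 0" by simp
    then show False
      by (rule main[of 1 "?U + ?W" ?V, OF _ _ 3 ind1]) (simp_all only: shift_simps, simp_all)
  qed
qed

theorem theorem3p8:
  fixes p m e s :: nat
  assumes "CHAR('a::field) = p" and "p > 0"
    and "m > 0" and "e > 0" and "s > 0"
    and "\<not> p ^ e dvd s * p" and "\<not> s * p dvd p ^ e" and "m > 1"
  shows "kalg_isos_A p m e s = ({} :: ('a poly4 set \<Rightarrow> 'a poly3) set)"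
proof (rule equals0I)
  fix h :: "'a poly4 set \<Rightarrow> 'a poly3"
  assume "h \<in> kalg_isos_A p m e s"
  then have h: "h \<in> ring_iso (ring_of Quot genideal ring_of {defpoly p m e s}) ring_of"
    and hc: "\<And>c. h (genideal ring_of {defpoly p m e s} +>\<^bsub>ring_of\<^esub> const4 c) = const3 c"
    by (auto simp: kalg_isos_A_def algA_def)
  have prime: "prime p" using assms(1,2) prime_CHAR_semidom[where ?'a = 'a] by simp
  obtain s1 where s1: "s * p = p ^ multiplicity p (s * p) * s1" "\<not> p dvd s1"
    using multiplicity_decompose'[of "s * p" p] assms(2,5) prime by (metis mult_is_0 not_prime_unit neq0_conv)
  \<comment> \<open>The p-adic valuation of s * p. The two divisibility hypotheses now become d < e
    and s1 \<noteq> 1.\<close>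
  define d where "d = multiplicity p (s * p)"
  have sp: "s * p = s1 * p ^ d" using s1(1) by (simp add: d_def mult.commute)
  have "d < e"
  proof (rule ccontr)
    assume "\<not> d < e"
    then have "p ^ e dvd s * p" unfolding sp by (intro dvd_mult le_imp_power_dvd) simp
    then show False using assms(6) by simp
  qed
  define r where "r = e - d"
  have r: "r > 0" "p ^ e = p ^ r * p ^ d" using \<open>d < e\<close> by (auto simp: r_def simp flip: power_add)
  have "s1 \<noteq> 1"
  proof
    assume "s1 = 1"
    then have "s * p dvd p ^ e" unfolding sp r(2) by simp
    then show False using assms(7) by simp
  qed
  moreover have "s1 \<noteq> 0" using s1(2) by (metis dvd_0_right)
  ultimately have s12: "s1 \<ge> 2" by simp
  define f where "f = (defpoly p m e s :: 'a poly4)"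
  define \<eta> where "\<eta> = (\<lambda>P. h (genideal ring_of {f} +>\<^bsub>ring_of\<^esub> P))"
  have \<eta>: "unital_hom \<eta>" "surj \<eta>" "\<eta> f = 0" "\<And>P. \<eta> P = 0 \<Longrightarrow> \<exists>Q. P = Q * f"
    unfolding \<eta>_def using quotient_iso_imp_unital_hom[OF h[folded f_def]] by blast+
  have \<eta>c: "\<eta> (const4 c) = const3 c" for c using hc by (simp add: \<eta>_def f_def)
  \<comment> \<open>The value that the relation forces on y once x is invertible.\<close>
  define y' :: "'a laur" where "y' = - mon (- int m, 0, 0) *
      (mon (0, 1, 0) ^ (p ^ r * p ^ d) + mon (0, 0, 1) + mon (0, 0, 1) ^ (s1 * p ^ d))"
  define \<theta> where "\<theta> = eval_hom (eval_hom (eval_hom (eval_hom C0 (mon (1, 0, 0))) y') (mon (0, 1, 0))) (mon (0, 0, 1) :: 'a laur)"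
  note e0 = single_hom[where ?'a = 'a and ?'g = "int \<times> int \<times> int"]
  note e1 = unital_hom_eval_hom[OF e0]
  note e2 = unital_hom_eval_hom[OF e1]
  note e3 = unital_hom_eval_hom[OF e2]
  note \<theta> = unital_hom_eval_hom[OF e3, of "mon (1, 0, 0)" y' "mon (0, 1, 0)" "mon (0, 0, 1)", folded \<theta>_def]
  have \<theta>v: "\<theta> (const4 c) = C0 c" "\<theta> varX = mon (1, 0, 0)" "\<theta> varY = y'" "\<theta> varZ = mon (0, 1, 0)" "\<theta> varT = mon (0, 0, 1)" for c
    unfolding \<theta>_def const4_def varX_def varY_def varZ_def varT_def
    by (simp_all only: eval_hom_const[OF e0] eval_hom_const[OF e1] eval_hom_const[OF e2] eval_hom_const[OF e3]
        eval_hom_monom[OF e0] eval_hom_monom[OF e1] eval_hom_monom[OF e2] eval_hom_monom[OF e3])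
  have "mon (1, 0, 0) ^ m * y' = - (mon (1, 0, 0) ^ m * mon (- int m, 0, 0)) *
      (mon (0, 1, 0) ^ (p ^ r * p ^ d) + mon (0, 0, 1) + mon (0, 0, 1) ^ (s1 * p ^ d))"
    unfolding y'_def by (simp only: mult_minus_left mult_minus_right mult.assoc)
  then have "\<theta> f = 0"
    unfolding f_def defpoly_def unital_homD(1,2,7)[OF \<theta>] \<theta>v sp r(2) mon_x_inverse by (simp add: algebra_simps)
  then have ker: "\<theta> P = \<theta> Q" if "\<eta> P = \<eta> Q" for P Q
  proof -
    have "\<eta> (P - Q) = 0" using that by (simp add: unital_homD(6)[OF \<eta>(1)])
    then obtain R where "P - Q = R * f" using \<eta>(4) by blast
    then have "\<theta> P - \<theta> Q = \<theta> R * \<theta> f" by (metis unital_homD(2,6)[OF \<theta>])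
    then show ?thesis using \<open>\<theta> f = 0\<close> by simp
  qed
  \<comment> \<open>\<open>\<theta>\<close> kills the defining polynomial, so it factors through
    \<open>\<eta>\<close> and the choice of preimage is immaterial.\<close>
  define \<iota> where "\<iota> = (\<lambda>a. \<theta> (inv_into UNIV \<eta> a))"
  have \<iota>\<eta>: "\<iota> (\<eta> P) = \<theta> P" for P
    unfolding \<iota>_def by (rule ker) (simp add: surj_f_inv_f[OF \<eta>(2)])
  have ex: "\<exists>P. a = \<eta> P" for a using \<eta>(2) by (metis surjD)
  have "laurent_model p m d r s1 const3 (\<eta> varX) (\<eta> varY) (\<eta> varZ) (\<eta> varT) \<iota>"
  proof
    show "unital_hom \<iota>" unfolding unital_hom_def
    proof (intro conjI allI)
      fix a b
      obtain A B where AB: "a = \<eta> A" "b = \<eta> B" using ex by blast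
      show "\<iota> (a + b) = \<iota> a + \<iota> b" "\<iota> (a * b) = \<iota> a * \<iota> b"
        unfolding AB unital_homD(1,2)[OF \<eta>(1), symmetric] \<iota>\<eta> unital_homD(1,2)[OF \<theta>] by simp_all
      show "\<iota> 1 = 1" using \<iota>\<eta>[of 1] unital_homD(3)[OF \<eta>(1)] unital_homD(3)[OF \<theta>] by simp
    qed
    show "\<iota> (const3 c) = C0 c" for c using \<iota>\<eta>[of "const4 c"] by (simp add: \<eta>c \<theta>v)
    show "\<iota> (\<eta> varY) = - mon (- int m, 0, 0) *
      (mon (0, 1, 0) ^ (p ^ r * p ^ d) + mon (0, 0, 1) + mon (0, 0, 1) ^ (s1 * p ^ d))"
      unfolding \<iota>\<eta> \<theta>v y'_def ..
    show "\<eta> varX ^ m * \<eta> varY + \<eta> varZ ^ (p ^ r * p ^ d) + \<eta> varT + \<eta> varT ^ (s1 * p ^ d) = 0"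
      using \<eta>(3) unfolding f_def defpoly_def unital_homD(1,2,7)[OF \<eta>(1)] sp r(2) .
    fix S a
    assume S: "\<And>c. const3 c \<in> S" "\<And>a b. a \<in> S \<Longrightarrow> b \<in> S \<Longrightarrow> a + b \<in> S" "\<And>a b. a \<in> S \<Longrightarrow> b \<in> S \<Longrightarrow> a * b \<in> S"
      "\<eta> varX \<in> S" "\<eta> varY \<in> S" "\<eta> varZ \<in> S" "\<eta> varT \<in> S"
    obtain A where A: "a = \<eta> A" using ex by blast
    have "A \<in> {A. \<eta> A \<in> S}"
      by (rule poly4_subring_UNIV) (use S in \<open>auto simp: \<eta>c unital_homD(1,2)[OF \<eta>(1)]\<close>)
    then show "a \<in> S" using A by simp
  qed (use assms r s12 s1(2) unital_hom_const3 \<iota>\<eta> \<theta>v in auto)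
  then show False by (rule no_polynomial_coordinates)
qed

end
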